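(* Let $\boldsymbol r=(r_1,\ldots,r_d)\in\mathbb N^d$ and $\Omega=\Omega_1\times\cdots\times\Omega_d$. The set $\mathcal T_{\boldsymbol r}\left({}_a\bigotimes_{j=1}^dH^1(\Omega_j)\right)$ of tensors in the algebraic tensor product of the spaces $H^1(\Omega_j)$ with Tucker rank bounded by $\boldsymbol r$ is weakly closed in $H^1(\Omega)$, and therefore proximinal in $H^1(\Omega)$.
   Context: $\Omega_1,\dots,\Omega_d\subset\mathbb R$ are domains (open intervals) and $\Omega=\Omega_1\times\cdots\times\Omega_d$. ${}_a\bigotimes_{j=1}^dX_j$ denotes the algebraic tensor product (finite sums of elementary tensors, without completion); for function spaces, $(\bigotimes_jv_j)(x_1,\dots,x_d)=\prod_jv_j(x_j)$, so ${}_a\bigotimes_jH^1(\Omega_j)\subset H^1(\Omega)$. For $u\in L^2(\Omega)$ (in particular for $u\in H^1(\Omega)$) and $1\le j\le d$, $$U^j(u):=\operatorname{span}\Big\{\varphi(u):\varphi=\bigotimes_{k=1}^d\varphi_k,\ \varphi_j=\operatorname{id}_j,\ \varphi_k\in(L^2(\Omega_k))^*\text{ for }k\ne j\Big\},$$ where $\operatorname{id}_j$ is the identity; i.e. if $\varphi_k=\langle\cdot,g_k\rangle_{L^2(\Omega_k)}$, then $\varphi(u)(x_j)=\int u(x)\prod_{k\ne j}g_k(x_k)\prod_{k\neq j}dx_k$. Tucker format: for $V={}_a\bigotimes_{j=1}^dH^1(\Omega_j)$, $\mathcal T_{\boldsymbol r}(V):=\{v\in V:\dim U^j(v)\le r_j,\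 1\le j\le d\}$. A subset $M$ of a normed space $X$ is proximinal if every $x\in X$ has a best approximation in $M$, i.e. there is $m\in M$ with $\|x-m\|=\inf_{m'\in M}\|x-m'\|$. *)

theory Defs
  imports "HOL-Analysis.Analysis"
begin

section \<open>Weak closedness and proximinality\<close>

text \<open>A normed space is given by a carrier \<open>X\<close> (a linear subspace of a vector space type) and
  a norm \<open>nrm\<close> on it, since the Sobolev spaces below depend on a domain and hence are not types.\<close>

definition continuous_dual :: "'v::real_vector set \<Rightarrow> ('v \<Rightarrow> real) \<Rightarrow> ('v \<Rightarrow> real) set" where
  "continuous_dual X nrm =
    {f. (\<forall>x\<in>X. \<forall>y\<in>X. f (x + y) = f x + f y) \<and> (\<forall>c. \<forall>x\<in>X. f (c *\<^sub>R x) = c * f x) \<and>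
        (\<exists>C. \<forall>x\<in>X. \<bar>f x\<bar> \<le> C * nrm x)}"

definition weak_topology :: "'v::real_vector set \<Rightarrow> ('v \<Rightarrow> real) \<Rightarrow> 'v topology" where
  "weak_topology X nrm =
    topology_generated_by {{x\<in>X. f x \<in> S} | f S. f \<in> continuous_dual X nrm \<and> open S}"

definition weakly_closed_in :: "'v::real_vector set \<Rightarrow> ('v \<Rightarrow> real) \<Rightarrow> 'v set \<Rightarrow> bool" where
  "weakly_closed_in X nrm M \<longleftrightarrow> closedin (weak_topology X nrm) M"

definition proximinal_in :: "'v::real_vector set \<Rightarrow> ('v \<Rightarrow> real) \<Rightarrow> 'v set \<Rightarrow> bool" where
  "proximinal_in X nrm M \<longleftrightarrow>
    M \<subseteq> X \<and> (\<forall>x\<in>X. \<exists>m\<in>M. nrm (x - m) = (INF m'\<in>M. nrm (x - m')))"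

lemma topspace_weak_topology: "topspace (weak_topology X nrm) = X"
proof -
  have "(\<lambda>_. 0) \<in> continuous_dual X nrm"
    by (auto simp: continuous_dual_def intro: exI[of _ 0])
  then have "X \<in> {{x\<in>X. f x \<in> S} | f S. f \<in> continuous_dual X nrm \<and> open S}"
    by (auto intro!: exI[of _ "\<lambda>_. 0"] exI[of _ UNIV])
  then show ?thesis
    unfolding weak_topology_def topology_generated_by_topspace by blast
qed


section \<open>Almost everywhere classes of measurable functions\<close>

text \<open>The elements of type \<open>'a L0\<close> are the Borel functions modulo equality almost everywhere;
  \<open>rep_L0 u\<close> is a Borel representative of \<open>u\<close>. Functions on a domain \<open>\<Omega>\<close> are identified with
  their extension by zero, see \<open>L2\<close>.\<close>

quotient_type (overloaded) 'a L0 = "'a::euclidean_space \<Rightarrow> real" /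
  partial: "\<lambda>f g. f \<in> borel_measurable borel \<and> g \<in> borel_measurable borel \<and>
                  (AE x in lborel. f x = g x)"
  by (rule part_equivpI)
    (auto simp: symp_def transp_def eq_commute intro!: exI[of _ "\<lambda>_. 0"])

instantiation L0 :: (euclidean_space) real_vector
begin

lift_definition zero_L0 :: "'a L0" is "\<lambda>_. 0" by simp

lift_definition plus_L0 :: "'a L0 \<Rightarrow> 'a L0 \<Rightarrow> 'a L0" is "\<lambda>f g x. f x + g x" by auto

lift_definition uminus_L0 :: "'a L0 \<Rightarrow> 'a L0" is "\<lambda>f x. - f x" by auto

lift_definition minus_L0 :: "'a L0 \<Rightarrow> 'a L0 \<Rightarrow> 'a L0" is "\<lambda>f g x. f x - g x" by auto

lift_definition scaleR_L0 :: "real \<Rightarrow> 'a L0 \<Rightarrow> 'a L0" is "\<lambda>c f x. c * f x" by auto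

instance
  by standard (transfer; simp add: algebra_simps)+

end

lemma borel_measurable_rep_L0 [measurable]: "rep_L0 u \<in> borel_measurable borel"
  using Quotient3_rep_reflp[OF Quotient3_L0] by auto

lemma rep_abs_L0: "f \<in> borel_measurable borel \<Longrightarrow> AE x in lborel. rep_L0 (abs_L0 f) x = f x"
  using rep_abs_rsp_left[OF Quotient3_L0, of f f] by auto


section \<open>\<open>L\<^sup>2\<close> and \<open>H\<^sup>1\<close> on a domain\<close>

definition L2 :: "'a::euclidean_space set \<Rightarrow> 'a L0 set" where
  "L2 \<Omega> = {u. (AE x in lborel. x \<notin> \<Omega> \<longrightarrow> rep_L0 u x = 0) \<and>
              integrable lborel (\<lambda>x. (rep_L0 u x)\<^sup>2)}"

definition L2_norm :: "'a::euclidean_space L0 \<Rightarrow> real" where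
  "L2_norm u = sqrt (\<integral>x. (rep_L0 u x)\<^sup>2 \<partial>lborel)"

primrec C_k :: "nat \<Rightarrow> ('a::euclidean_space \<Rightarrow> real) \<Rightarrow> bool" where
  "C_k 0 f \<longleftrightarrow> continuous_on UNIV f"
| "C_k (Suc k) f \<longleftrightarrow> (\<forall>x. f differentiable (at x)) \<and>
      (\<forall>b\<in>Basis. C_k k (\<lambda>x. frechet_derivative f (at x) b))"

definition test_functions :: "'a::euclidean_space set \<Rightarrow> ('a \<Rightarrow> real) set" where
  "test_functions \<Omega> =
    {\<phi>. (\<forall>k. C_k k \<phi>) \<and> (\<exists>K. compact K \<and> K \<subseteq> \<Omega> \<and> (\<forall>x. x \<notin> K \<longrightarrow> \<phi> x = 0))}"

definition is_weak_deriv ::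
  "'a::euclidean_space set \<Rightarrow> 'a \<Rightarrow> 'a L0 \<Rightarrow> 'a L0 \<Rightarrow> bool" where
  "is_weak_deriv \<Omega> b u w \<longleftrightarrow>
    (\<forall>\<phi>\<in>test_functions \<Omega>.
      (\<integral>x. rep_L0 u x * frechet_derivative \<phi> (at x) b \<partial>lborel) =
      - (\<integral>x. rep_L0 w x * \<phi> x \<partial>lborel))"

definition H1 :: "'a::euclidean_space set \<Rightarrow> 'a L0 set" where
  "H1 \<Omega> = {u \<in> L2 \<Omega>. \<forall>b\<in>Basis. \<exists>w\<in>L2 \<Omega>. is_weak_deriv \<Omega> b u w}"

definition weak_deriv :: "'a::euclidean_space set \<Rightarrow> 'a \<Rightarrow> 'a L0 \<Rightarrow> 'a L0" where
  "weak_deriv \<Omega> b u = (THE w. w \<in> L2 \<Omega> \<and> is_weak_deriv \<Omega> b u w)"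

definition H1_norm :: "'a::euclidean_space set \<Rightarrow> 'a L0 \<Rightarrow> real" where
  "H1_norm \<Omega> u = sqrt ((L2_norm u)\<^sup>2 + (\<Sum>b\<in>Basis. (L2_norm (weak_deriv \<Omega> b u))\<^sup>2))"


section \<open>Tensors\<close>

definition prod_domain :: "('d::finite \<Rightarrow> real set) \<Rightarrow> (real^'d) set" where
  "prod_domain \<Omega> = {x. \<forall>j. x $ j \<in> \<Omega> j}"

definition elem_tensor :: "('d::finite \<Rightarrow> real L0) \<Rightarrow> (real^'d) L0" where
  "elem_tensor v = abs_L0 (\<lambda>x. \<Prod>j\<in>UNIV. rep_L0 (v j) (x $ j))"

definition alg_tensor :: "('d::finite \<Rightarrow> real L0 set) \<Rightarrow> (real^'d) L0 set" where
  "alg_tensor X = span {elem_tensor v | v. \<forall>j. v j \<in> X j}"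

text \<open>\<open>contract j g u\<close> is \<open>\<phi>(u)\<close> for \<open>\<phi> = \<Otimes>\<^sub>k \<phi>\<^sub>k\<close> with \<open>\<phi>\<^sub>j\<close> the identity and
  \<open>\<phi>\<^sub>k = \<langle>\<cdot>, g k\<rangle>\<close> for \<open>k \<noteq> j\<close>; the value \<open>g j\<close> is irrelevant.
  By the Riesz representation theorem these \<open>\<phi>\<^sub>k\<close> are all elements of the dual
  of \<open>L\<^sup>2\<close>.\<close>

definition contract :: "'d \<Rightarrow> ('d::finite \<Rightarrow> real L0) \<Rightarrow> (real^'d) L0 \<Rightarrow> real L0" where
  "contract j g u = abs_L0 (\<lambda>t.
     \<integral>y. rep_L0 u (\<chi> k. if k = j then t else y k) * (\<Prod>k\<in>- {j}. rep_L0 (g k) (y k))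
       \<partial>(\<Pi>\<^sub>M k\<in>- {j}. lborel))"

definition min_subspace :: "('d::finite \<Rightarrow> real set) \<Rightarrow> 'd \<Rightarrow> (real^'d) L0 \<Rightarrow> real L0 set" where
  "min_subspace \<Omega> j u = span {contract j g u | g. \<forall>k. k \<noteq> j \<longrightarrow> g k \<in> L2 (\<Omega> k)}"

text \<open>The library's \<open>dim\<close> is 0 on infinite-dimensional spaces, so finite-dimensionality
  has to be required separately.\<close>

definition dim_at_most :: "'v::real_vector set \<Rightarrow> nat \<Rightarrow> bool" where
  "dim_at_most U n \<longleftrightarrow> (\<exists>B. finite B \<and> U \<subseteq> span B) \<and> dim U \<le> n"

definition tucker :: "('d::finite \<Rightarrow> real set) \<Rightarrow> ('d \<Rightarrow> nat) \<Rightarrow> (real^'d) L0 set" where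
  "tucker \<Omega> r = {v \<in> alg_tensor (\<lambda>j. H1 (\<Omega> j)). \<forall>j. dim_at_most (min_subspace \<Omega> j v) (r j)}"

text \<open>The functions whose classes are taken above are indeed measurable.\<close>

lemma borel_measurable_elem_tensor:
  "(\<lambda>x::real^'d::finite. \<Prod>j\<in>UNIV. rep_L0 (v j) (x $ j)) \<in> borel_measurable borel"
  by measurable

lemma borel_measurable_contract:
  fixes u :: "(real^'d::finite) L0"
  shows "(\<lambda>t. \<integral>y. rep_L0 u (\<chi> k. if k = j then t else y k) * (\<Prod>k\<in>- {j}. rep_L0 (g k) (y k))
            \<partial>(\<Pi>\<^sub>M k\<in>- {j}. lborel)) \<in> borel_measurable borel"
proof -
  interpret product_sigma_finite "\<lambda>_::'d. lborel :: real measure" ..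
  interpret sigma_finite_measure "\<Pi>\<^sub>M k\<in>- {j}. (lborel :: real measure)"
    by (rule sigma_finite) simp
  have comp: "(\<lambda>p. if k = j then fst p else snd p k)
      \<in> borel_measurable (borel \<Otimes>\<^sub>M (\<Pi>\<^sub>M k\<in>- {j}. (lborel :: real measure)))" for k
    by (cases "k = j") (auto intro!: measurable_compose[OF measurable_snd]
        measurable_component_singleton[where M = "\<lambda>_. lborel", simplified])
  have vec: "(\<lambda>p. \<chi> k. if k = j then fst p else snd p k)
      \<in> borel_measurable (borel \<Otimes>\<^sub>M (\<Pi>\<^sub>M k\<in>- {j}. (lborel :: real measure)))"
    by (rule borel_measurable_euclidean_space[THEN iffD2])
      (auto simp: Basis_vec_def inner_axis comp)
  have "(\<lambda>p. rep_L0 u (\<chi> k. if k = j then fst p else snd p k))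
      \<in> borel_measurable (borel \<Otimes>\<^sub>M (\<Pi>\<^sub>M k\<in>- {j}. (lborel :: real measure)))"
    by (rule measurable_compose[OF vec borel_measurable_rep_L0])
  moreover have "(\<lambda>p. \<Prod>k\<in>- {j}. rep_L0 (g k) (snd p k))
      \<in> borel_measurable (borel \<Otimes>\<^sub>M (\<Pi>\<^sub>M k\<in>- {j}. (lborel :: real measure)))"
  proof (rule borel_measurable_prod)
    fix k assume "k \<in> - {j}"
    then have "k \<noteq> j" by simp
    with measurable_compose[OF comp[of k] borel_measurable_rep_L0[of "g k"]]
    show "(\<lambda>p. rep_L0 (g k) (snd p k))
        \<in> borel_measurable (borel \<Otimes>\<^sub>M (\<Pi>\<^sub>M k\<in>- {j}. (lborel :: real measure)))"
      by simp
  qed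
  ultimately show ?thesis
    by (intro borel_measurable_lebesgue_integral)
      (simp add: case_prod_beta borel_measurable_times)
qed

end

theory Submission
  imports Defs
begin

text \<open>The space \<open>H\<^sup>1(\<Omega>)\<close> is a Hilbert space, so its bounded sequences have weak cluster points, and a
  nonempty weakly closed set contains a best approximation to every point: a weak cluster point of a minimising
  sequence (\<open>weakly_closed_imp_proximinal\<close>). It remains to show that the set of tensors of bounded rank
  is weakly closed.

  The conditions on the rank are weakly closed in \<open>H\<^sup>1(\<Omega>)\<close>. The minimal subspace \<open>U\<^sup>j(v)\<close> is spanned by
  contractions of \<open>v\<close>, and the inner product of such a contraction with a function \<open>h\<close> is the inner product
  of \<open>v\<close> with an elementary tensor (\<open>L2_ip_contract\<close>), hence a weakly continuous function of \<open>v\<close>. If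
  \<open>U\<^sup>j(v)\<close> contains \<open>r\<^sub>j + 1\<close> independent contractions, then they can be tested against a dual system, and
  the matrix of the resulting inner products is the identity. It stays nearly so, and therefore
  invertible, on a weak neighbourhood of \<open>v\<close>; so \<open>dim U\<^sup>j > r\<^sub>j\<close> is a weakly open condition
  (\<open>weakly_open_dim_greater\<close>).

  A weak limit of algebraic tensors could a priori leave the algebraic tensor product. This does not
  happen, because a function \<open>v\<close> in \<open>H\<^sup>1(\<Omega>)\<close> with finite-dimensional minimal subspaces lies in their
  algebraic tensor product (\<open>in_alg_tensor_min_subspaces\<close>): the projection of \<open>v\<close> onto that tensor product
  has the same inner product with every elementary tensor as \<open>v\<close>. Moreover \<open>U\<^sup>j(v)\<close> consists of \<open>H\<^sup>1\<close>
  functions, since contracting the other variables commutes with the weak derivative in the variable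
  \<open>j\<close> (\<open>weak_deriv_contract\<close>). Conversely elementary tensors of \<open>H\<^sup>1\<close> functions belong to \<open>H\<^sup>1(\<Omega>)\<close>
  (\<open>elem_tensor_in_H1\<close>). Hence bounded rank is the only condition left (\<open>tucker_eq\<close>).

  The analytic foundations are the completeness of \<open>L\<^sup>2\<close> and the du Bois-Reymond lemma. The latter
  makes weak derivatives unique and shows that elementary tensors separate the points of \<open>L\<^sup>2(\<Omega>)\<close>.\<close>

section \<open>Hilbert spaces carried by a linear subspace\<close>

text \<open>The carrier is a linear subspace of a vector space type, since \<open>L\<^sup>2\<close> and \<open>H\<^sup>1\<close> of a domain are
  not types. Completeness is stated through the squared norm \<open>ip x x\<close>, which avoids square roots.\<close>

locale hilbert_subspace =
  fixes X :: "'v::real_vector set" and ip :: "'v \<Rightarrow> 'v \<Rightarrow> real"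
  assumes subspace_X: "subspace X"
    and ip_add_left: "\<And>x y z. x \<in> X \<Longrightarrow> y \<in> X \<Longrightarrow> z \<in> X \<Longrightarrow> ip (x + y) z = ip x z + ip y z"
    and ip_scaleR_left: "\<And>c x y. x \<in> X \<Longrightarrow> y \<in> X \<Longrightarrow> ip (c *\<^sub>R x) y = c * ip x y"
    and ip_commute: "\<And>x y. x \<in> X \<Longrightarrow> y \<in> X \<Longrightarrow> ip x y = ip y x"
    and ip_nonneg: "\<And>x. x \<in> X \<Longrightarrow> 0 \<le> ip x x"
    and ip_definite: "\<And>x. x \<in> X \<Longrightarrow> ip x x = 0 \<Longrightarrow> x = 0"
    and ip_complete: "\<And>s. (\<And>n. s n \<in> X) \<Longrightarrow>
      (\<And>e. e > 0 \<Longrightarrow> \<exists>N. \<forall>m\<ge>N. \<forall>n\<ge>N. ip (s m - s n) (s m - s n) < e) \<Longrightarrow>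
      \<exists>l\<in>X. (\<lambda>n. ip (s n - l) (s n - l)) \<longlonglongrightarrow> 0"
begin

lemmas carrier_closed [simp] =
  subspace_0[OF subspace_X] subspace_add[OF subspace_X] subspace_diff[OF subspace_X]
  subspace_mul[OF subspace_X]

lemma ip_add_right: "x \<in> X \<Longrightarrow> y \<in> X \<Longrightarrow> z \<in> X \<Longrightarrow> ip x (y + z) = ip x y + ip x z"
  by (metis carrier_closed(2) ip_add_left ip_commute)

lemma ip_scaleR_right: "x \<in> X \<Longrightarrow> y \<in> X \<Longrightarrow> ip x (c *\<^sub>R y) = c * ip x y"
  by (metis carrier_closed(4) ip_scaleR_left ip_commute)

lemma ip_diff_left: "x \<in> X \<Longrightarrow> y \<in> X \<Longrightarrow> z \<in> X \<Longrightarrow> ip (x - y) z = ip x z - ip y z"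
  using ip_add_left[of "x - y" y z] by simp

lemma ip_diff_right: "x \<in> X \<Longrightarrow> y \<in> X \<Longrightarrow> z \<in> X \<Longrightarrow> ip x (y - z) = ip x y - ip x z"
  using ip_add_right[of x "y - z" z] by simp

lemmas ip_simps = ip_add_left ip_add_right ip_diff_left ip_diff_right
  ip_scaleR_left ip_scaleR_right

lemma ip_zero_left [simp]: "x \<in> X \<Longrightarrow> ip 0 x = 0"
  using ip_scaleR_left[of x x 0] by simp

lemma ip_zero_right [simp]: "x \<in> X \<Longrightarrow> ip x 0 = 0"
  using ip_scaleR_right[of x x 0] by simp

lemma ip_sum_left: "(\<And>i. i \<in> I \<Longrightarrow> f i \<in> X) \<Longrightarrow> x \<in> X \<Longrightarrow> ip (\<Sum>i\<in>I. f i) x = (\<Sum>i\<in>I. ip (f i) x)"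
  by (induction I rule: infinite_finite_induct) (auto simp: ip_add_left subspace_sum[OF subspace_X])

lemma ip_orthogonal_span:
  assumes x: "x \<in> X" and B: "B \<subseteq> X" and orth: "\<And>b. b \<in> B \<Longrightarrow> ip b x = 0" and y: "y \<in> span B"
  shows "ip y x = 0"
proof -
  have "y \<in> X \<and> ip y x = 0"
    using y
  proof (induction rule: span_induct)
    case base
    then show ?case using x
      by (auto simp: subspace_def ip_simps)
  next
    case (step z)
    then show ?case using orth B by auto
  qed
  then show ?thesis ..
qed

lemma span_subset_X: "B \<subseteq> X \<Longrightarrow> span B \<subseteq> X"
  by (rule span_minimal[OF _ subspace_X])

lemma Cauchy_Schwarz:
  assumes [simp]: "x \<in> X" "y \<in> X"
  shows "(ip x y)\<^sup>2 \<le> ip x x * ip y y"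
proof (cases "ip y y = 0")
  case True
  then have "y = 0" using ip_definite by simp
  then show ?thesis by simp
next
  case False
  then have pos: "ip y y > 0" using ip_nonneg[of y] by simp
  let ?t = "ip x y / ip y y"
  have "0 \<le> ip (x - ?t *\<^sub>R y) (x - ?t *\<^sub>R y)" by (rule ip_nonneg) auto
  also have "\<dots> = ip x x - (ip x y)\<^sup>2 / ip y y"
    using pos by (simp add: ip_simps ip_commute[of y x] power2_eq_square field_simps)
  finally show ?thesis using pos by (simp add: field_simps)
qed

lemma abs_ip_le: "x \<in> X \<Longrightarrow> y \<in> X \<Longrightarrow> \<bar>ip x y\<bar> \<le> sqrt (ip x x) * sqrt (ip y y)"
  using real_sqrt_le_mono[OF Cauchy_Schwarz[of x y]] by (simp add: real_sqrt_mult)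

lemma tendsto_ip_left:
  assumes [simp]: "\<And>n. s n \<in> X" "l \<in> X" "y \<in> X" and lim: "((\<lambda>n. ip (s n - l) (s n - l)) \<longlongrightarrow> 0) F"
  shows "((\<lambda>n. ip (s n) y) \<longlongrightarrow> ip l y) F"
proof -
  have lim': "((\<lambda>n. sqrt (ip (s n - l) (s n - l)) * sqrt (ip y y)) \<longlongrightarrow> 0) F"
    using tendsto_mult_left_zero[OF tendsto_real_sqrt[OF lim, simplified]] by simp
  have "((\<lambda>n. ip (s n - l) y) \<longlongrightarrow> 0) F"
    by (rule Lim_null_comparison[OF _ lim']) (simp add: abs_ip_le)
  then show ?thesis
    by (simp add: ip_diff_left LIM_zero_iff)
qed

text \<open>The representing vector minimises \<open>J x = \<parallel>x\<parallel>\<^sup>2 - 2 f x\<close>. A minimiser exists by completeness, and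
  \<open>f y = \<langle>l, y\<rangle>\<close> says that the first variation of \<open>J\<close> at it vanishes.\<close>

lemma Riesz_representation:
  assumes f: "f \<in> continuous_dual X (\<lambda>x. sqrt (ip x x))"
  obtains l where "l \<in> X" "\<And>y. y \<in> X \<Longrightarrow> f y = ip l y"
proof -
  have fadd: "f (x + y) = f x + f y" if "x \<in> X" "y \<in> X" for x y
    using f that by (auto simp: continuous_dual_def)
  have fscale: "f (c *\<^sub>R x) = c * f x" if "x \<in> X" for c x
    using f that by (auto simp: continuous_dual_def)
  obtain C where C: "\<And>x. x \<in> X \<Longrightarrow> \<bar>f x\<bar> \<le> C * sqrt (ip x x)"
    using f unfolding continuous_dual_def by blast
  define J where "J x = ip x x - 2 * f x" for x
  have J_ge: "- (C\<^sup>2) \<le> J x" if "x \<in> X" for x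
  proof -
    have "ip x x = (sqrt (ip x x))\<^sup>2" using ip_nonneg that by simp
    moreover have "0 \<le> (sqrt (ip x x) - C)\<^sup>2" by simp
    ultimately show ?thesis using C[OF that] unfolding J_def power2_diff by (simp add: algebra_simps)
  qed
  define m where "m = (INF x\<in>X. J x)"
  have bdd: "bdd_below (J ` X)" using J_ge by (auto intro!: bdd_belowI)
  have m_le: "m \<le> J x" if "x \<in> X" for x
    unfolding m_def by (rule cINF_lower[OF bdd that])
  have "\<exists>x\<in>X. J x < m + 1 / real (Suc n)" for n
    using cINF_less_iff[OF _ bdd, of "m + 1 / real (Suc n)"] carrier_closed(1) unfolding m_def[symmetric] by fastforce
  then obtain s where sX [simp]: "\<And>n. s n \<in> X" and s: "\<And>n. J (s n) < m + 1 / real (Suc n)"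
    by metis
  \<comment> \<open>By the parallelogram law, a minimising sequence of \<open>J\<close> is a Cauchy sequence.\<close>
  have par: "ip (a - b) (a - b) \<le> 2 * (J a - m) + 2 * (J b - m)" if [simp]: "a \<in> X" "b \<in> X" for a b
  proof -
    have "m \<le> J ((1/2) *\<^sub>R (a + b))" by (rule m_le) auto
    moreover have "ip (a - b) (a - b) = 2 * J a + 2 * J b - 4 * J ((1/2) *\<^sub>R (a + b))"
      by (simp add: J_def ip_simps fadd fscale ip_commute[of b a] algebra_simps)
    ultimately show ?thesis by simp
  qed
  have "\<exists>l\<in>X. (\<lambda>n. ip (s n - l) (s n - l)) \<longlonglongrightarrow> 0"
  proof (rule ip_complete)
    fix e :: real assume "e > 0"
    then obtain N where N: "1 / real (Suc N) < e / 4"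
      using reals_Archimedean[of "e/4"] by (auto simp: inverse_eq_divide)
    have le: "1 / real (Suc n) \<le> 1 / real (Suc N)" if "n \<ge> N" for n
      using that by (auto simp: frac_le)
    have arith: "a \<le> 2 * (x - m) + 2 * (y - m) \<Longrightarrow> x < m + e/4 \<Longrightarrow> y < m + e/4 \<Longrightarrow> a < e" for a x y :: real
      by (simp add: field_simps)
    show "\<exists>N. \<forall>m\<ge>N. \<forall>n\<ge>N. ip (s m - s n) (s m - s n) < e"
    proof (intro exI allI impI)
      fix i k assume "i \<ge> N" "k \<ge> N"
      show "ip (s i - s k) (s i - s k) < e"
        using par[OF sX sX, of i k]
          less_trans[OF s add_strict_left_mono[OF le_less_trans[OF le[OF \<open>i \<ge> N\<close>] N]]]
          less_trans[OF s add_strict_left_mono[OF le_less_trans[OF le[OF \<open>k \<ge> N\<close>] N]]]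
        by (rule arith)
    qed
  qed simp
  then obtain l where lX [simp]: "l \<in> X" and l: "(\<lambda>n. ip (s n - l) (s n - l)) \<longlonglongrightarrow> 0" by blast
  have "f y = ip l y" if [simp]: "y \<in> X" for y
  proof -
    define D where "D = ip l y - f y"
    \<comment> \<open>The first variation of \<open>J\<close> at its minimiser vanishes.\<close>
    have var: "0 \<le> 2 * t * D + t\<^sup>2 * ip y y" for t
    proof (rule tendsto_lowerbound)
      show "(\<lambda>n. 1 / real (Suc n) + 2 * t * (ip (s n) y - f y) + t\<^sup>2 * ip y y)
          \<longlonglongrightarrow> 2 * t * D + t\<^sup>2 * ip y y"
      proof -
        have "(\<lambda>n. 1 / real (Suc n) + 2 * t * (ip (s n) y - f y) + t\<^sup>2 * ip y y)
            \<longlonglongrightarrow> 0 + 2 * t * (ip l y - f y) + t\<^sup>2 * ip y y"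
          by (intro tendsto_intros LIMSEQ_Suc[OF lim_1_over_n] tendsto_ip_left l) simp_all
        then show ?thesis by (simp add: D_def)
      qed
      have "0 \<le> 1 / real (Suc n) + 2 * t * (ip (s n) y - f y) + t\<^sup>2 * ip y y" for n
        using m_le[of "s n + t *\<^sub>R y"] s[of n]
        by (simp add: J_def ip_simps fadd fscale ip_commute[of y "s n"] power2_eq_square algebra_simps)
      then show "\<forall>\<^sub>F n in sequentially. 0 \<le> 1 / real (Suc n) + 2 * t * (ip (s n) y - f y) + t\<^sup>2 * ip y y"
        by simp
    qed simp
    define q where "q = ip y y"
    have q: "q \<ge> 0" unfolding q_def by (rule ip_nonneg) simp
    \<comment> \<open>The optimal step length is \<open>- D / q\<close>; the summand 1 covers \<open>q = 0\<close>.\<close>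
    define r where "r = 1 / (q + 1)"
    have r: "r > 0" "r * q \<le> 1" using q by (simp_all add: r_def)
    have "0 \<le> 2 * (- D * r) * D + (- D * r)\<^sup>2 * q"
      using var[of "- D * r"] by (simp add: q_def)
    also have "\<dots> = D\<^sup>2 * r * (r * q - 2)"
      by (simp add: power2_eq_square algebra_simps)
    also have "\<dots> \<le> D\<^sup>2 * r * (- 1)" using r by (intro mult_left_mono) auto
    finally have "D\<^sup>2 * r \<le> 0" by simp
    then have "D = 0" using r(1) by (simp add: mult_le_0_iff)
    then show ?thesis by (simp add: D_def)
  qed
  then show thesis using that lX by blast
qed

text \<open>The functionals \<open>y \<mapsto> \<langle>s n, y\<rangle>\<close> lie in a product of compact intervals, which is compact by
  Tychonoff's theorem. A cluster point of them is linear and bounded, hence given by a vector \<open>m\<close>.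
  A filter \<open>G\<close> finer than \<open>sequentially\<close> takes the place of a convergent subsequence, because the
  cluster point comes from a compact space that need not be sequentially compact.\<close>

lemma bounded_sequence_weak_cluster_point:
  assumes sX [simp]: "\<And>n. s n \<in> X" and bound: "\<And>n. ip (s n) (s n) \<le> R"
  obtains m G where "m \<in> X" "G \<noteq> bot" "G \<le> sequentially"
    "\<And>y. y \<in> X \<Longrightarrow> ((\<lambda>n. ip (s n) y) \<longlongrightarrow> ip m y) G"
proof -
  define a where "a n y = (if y \<in> X then ip (s n) y else 0)" for n :: nat and y
  define c where "c y = (if y \<in> X then sqrt R * sqrt (ip y y) else 0)" for y
  have K: "compact (PiE UNIV (\<lambda>y. {- c y .. c y}))"
    unfolding compactin_euclidean_iff[symmetric] euclidean_product_topology[symmetric] compactin_PiE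
    by (auto simp: compactin_euclidean_iff)
  have "a n \<in> PiE UNIV (\<lambda>y. {- c y .. c y})" for n
  proof -
    have "\<bar>ip (s n) y\<bar> \<le> sqrt R * sqrt (ip y y)" if "y \<in> X" for y
    proof -
      have "sqrt (ip (s n) (s n)) * sqrt (ip y y) \<le> sqrt R * sqrt (ip y y)"
        using that ip_nonneg bound by (intro mult_right_mono) auto
      with abs_ip_le[of "s n" y] that show ?thesis by simp
    qed
    then show ?thesis by (auto simp: a_def c_def abs_le_iff minus_le_iff)
  qed
  then have "\<forall>\<^sub>F x in filtermap a sequentially. x \<in> PiE UNIV (\<lambda>y. {- c y .. c y})"
    by (simp add: eventually_filtermap)
  then obtain F where F: "inf (nhds F) (filtermap a sequentially) \<noteq> bot"
    using K unfolding compact_filter by (metis filtermap_bot_iff trivial_limit_sequentially)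
  define G where "G = inf sequentially (filtercomap a (nhds F))"
  have G: "G \<noteq> bot"
  proof
    assume "G = bot"
    then have "\<forall>\<^sub>F x in inf sequentially (filtercomap a (nhds F)). False"
      unfolding G_def by simp
    then obtain P Q where P: "eventually P sequentially" and Q: "eventually Q (filtercomap a (nhds F))"
      and PQ: "\<And>x. P x \<Longrightarrow> Q x \<Longrightarrow> False"
      unfolding eventually_inf by blast
    then obtain Q' where Q': "eventually Q' (nhds F)" "\<And>x. Q' (a x) \<Longrightarrow> Q x"
      unfolding eventually_filtercomap by blast
    have "eventually (\<lambda>x. \<not> Q' x) (filtermap a sequentially)"
      unfolding eventually_filtermap using P by eventually_elim (use PQ Q' in blast)
    then have "\<forall>\<^sub>F x in inf (nhds F) (filtermap a sequentially). False"
      unfolding eventually_inf using Q' by blast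
    then show False using F by (simp add: trivial_limit_def)
  qed
  have lim_F: "((\<lambda>n. a n y) \<longlongrightarrow> F y) G" for y
  proof -
    have "filterlim a (nhds F) G"
      unfolding G_def filterlim_def
      by (metis filtermap_filtercomap filtermap_mono inf_le2 order_trans)
    with continuous_on_product_coordinates[of y] show ?thesis
      by (rule continuous_on_tendsto_compose) auto
  qed
  then have lim: "((\<lambda>n. ip (s n) y) \<longlongrightarrow> F y) G" if "y \<in> X" for y
    using lim_F[of y] that by (simp add: a_def)
  have "F \<in> continuous_dual X (\<lambda>x. sqrt (ip x x))"
    unfolding continuous_dual_def
  proof (safe, goal_cases)
    case (1 x y)
    show ?case
      using 1 by (intro tendsto_unique[OF G lim[of "x + y"]])
        (auto simp: ip_add_right intro!: tendsto_add lim)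
  next
    case (2 c x)
    show ?case
      using 2 by (intro tendsto_unique[OF G lim[of "c *\<^sub>R x"]])
        (auto simp: ip_scaleR_right intro!: tendsto_mult lim)
  next
    case 3
    show ?case
    proof (intro exI[of _ "sqrt R"] ballI)
      fix x assume x: "x \<in> X"
      have "\<forall>\<^sub>F n in G. \<bar>ip (s n) x\<bar> \<le> sqrt R * sqrt (ip x x)"
      proof (intro always_eventually allI)
        fix n
        have "sqrt (ip (s n) (s n)) * sqrt (ip x x) \<le> sqrt R * sqrt (ip x x)"
          using x ip_nonneg bound by (intro mult_right_mono) auto
        with abs_ip_le[of "s n" x] x show "\<bar>ip (s n) x\<bar> \<le> sqrt R * sqrt (ip x x)" by simp
      qed
      then show "\<bar>F x\<bar> \<le> sqrt R * sqrt (ip x x)"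
        using tendsto_upperbound[OF tendsto_rabs[OF lim[OF x]] _ G] by blast
    qed
  qed
  then obtain m where "m \<in> X" "\<And>y. y \<in> X \<Longrightarrow> F y = ip m y"
    using Riesz_representation by blast
  then show thesis
    using that[of m G] G lim by (auto simp: G_def)
qed

text \<open>By the Riesz representation every subbasic weakly open set is a condition on a single
  \<open>\<langle>\<cdot>, l\<rangle>\<close>, so convergence of all inner products is convergence in the weak topology.\<close>

lemma eventually_in_weakly_open:
  assumes U: "openin (weak_topology X (\<lambda>x. sqrt (ip x x))) U" and m: "m \<in> U"
    and sX: "\<And>n. s n \<in> X" and lim: "\<And>y. y \<in> X \<Longrightarrow> ((\<lambda>n. ip (s n) y) \<longlongrightarrow> ip m y) G"
  shows "\<forall>\<^sub>F n in G. s n \<in> U"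
proof -
  let ?S = "{{x\<in>X. f x \<in> S} | f S. f \<in> continuous_dual X (\<lambda>x. sqrt (ip x x)) \<and> open (S::real set)}"
  have "generate_topology_on ?S U"
    using U unfolding weak_topology_def openin_topology_generated_by_iff .
  then show ?thesis using m
  proof (induction rule: generate_topology_on.induct)
    case (Basis V)
    then obtain f S where V: "V = {x\<in>X. f x \<in> S}" and "open S"
      and f: "f \<in> continuous_dual X (\<lambda>x. sqrt (ip x x))" by blast
    obtain l where l: "l \<in> X" "\<And>y. y \<in> X \<Longrightarrow> f y = ip l y"
      using Riesz_representation[OF f] by blast
    have mX: "m \<in> X" "f m \<in> S" using Basis V by auto
    have "((\<lambda>n. f (s n)) \<longlongrightarrow> f m) G"
      using lim[OF l(1)] l mX sX by (simp add: ip_commute)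
    then have "\<forall>\<^sub>F n in G. f (s n) \<in> S"
      using \<open>open S\<close> mX(2) by (rule topological_tendstoD)
    then show ?case using sX by (auto simp: V)
  next
    case (Int a b)
    then show ?case by (auto intro: eventually_conj)
  next
    case (UN K)
    then obtain k where k: "k \<in> K" "m \<in> k" by blast
    with UN.IH have "\<forall>\<^sub>F n in G. s n \<in> k" by blast
    then show ?case by eventually_elim (use k in blast)
  qed simp
qed

text \<open>A minimising sequence is bounded, so it has a weak cluster point, which stays in the weakly closed
  set \<open>M\<close>; the norm does not increase in the weak limit.\<close>

theorem weakly_closed_imp_proximinal:
  assumes closed: "weakly_closed_in X (\<lambda>x. sqrt (ip x x)) M" and ne: "M \<noteq> {}"
  shows "proximinal_in X (\<lambda>x. sqrt (ip x x)) M"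
proof -
  let ?n = "\<lambda>x. sqrt (ip x x)"
  have MX: "M \<subseteq> X" and op: "openin (weak_topology X ?n) (X - M)"
    using closed unfolding weakly_closed_in_def closedin_def topspace_weak_topology by auto
  have "\<exists>m\<in>M. ?n (x - m) = (INF m'\<in>M. ?n (x - m'))" if xX [simp]: "x \<in> X" for x
  proof -
    define I where "I = (INF m'\<in>M. ?n (x - m'))"
    have bdd: "bdd_below ((\<lambda>m'. ?n (x - m')) ` M)"
      using MX by (intro bdd_belowI[of _ 0]) (auto intro!: real_sqrt_ge_zero ip_nonneg)
    have I_le: "I \<le> ?n (x - m)" if "m \<in> M" for m
      unfolding I_def by (rule cINF_lower[OF bdd that])
    have I0: "I \<ge> 0"
      unfolding I_def using MX by (intro cINF_greatest[OF ne]) (auto intro!: real_sqrt_ge_zero ip_nonneg)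
    have "\<exists>m\<in>M. ?n (x - m) < I + 1 / real (Suc n)" for n
      using cINF_less_iff[OF ne bdd, of "I + 1 / real (Suc n)"] by (auto simp: I_def)
    then obtain s where sM: "\<And>n. s n \<in> M" and s: "\<And>n. ?n (x - s n) < I + 1 / real (Suc n)"
      by metis
    have sX [simp]: "s n \<in> X" for n using sM MX by auto
    have bound: "ip (x - s n) (x - s n) \<le> (I + 1)\<^sup>2" for n
    proof -
      have "1 / real (Suc n) \<le> 1" by simp
      then have "?n (x - s n) \<le> I + 1" using s[of n] by linarith
      then show ?thesis
        by (rule sqrt_le_D)
    qed
    \<comment> \<open>Weak compactness is applied to the bounded sequence of the errors \<open>x - s n\<close>.\<close>
    obtain e G where e [simp]: "e \<in> X" and G: "G \<noteq> bot" "G \<le> sequentially"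
      and lim: "\<And>y. y \<in> X \<Longrightarrow> ((\<lambda>n. ip (x - s n) y) \<longlongrightarrow> ip e y) G"
      using bounded_sequence_weak_cluster_point[of "\<lambda>n. x - s n", OF _ bound] by auto
    have lim': "((\<lambda>n. ip (s n) y) \<longlongrightarrow> ip (x - e) y) G" if "y \<in> X" for y
      using tendsto_diff[OF tendsto_const[of "ip x y"] lim[OF that]] that by (simp add: ip_simps)
    have mM: "x - e \<in> M"
    proof (rule ccontr)
      assume "x - e \<notin> M"
      then have "\<forall>\<^sub>F n in G. s n \<in> X - M"
        by (intro eventually_in_weakly_open[OF op _ sX lim']) auto
      then show False using sM G(1) by (simp add: trivial_limit_def)
    qed
    have "ip e e \<le> I * ?n e"
    proof (rule tendsto_le[OF G(1) _ lim[OF e]])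
      have "((\<lambda>n. (I + 1 / real (Suc n)) * ?n e) \<longlongrightarrow> (I + 0) * ?n e) sequentially"
        by (intro tendsto_intros LIMSEQ_Suc[OF lim_1_over_n])
      then show "((\<lambda>n. (I + 1 / real (Suc n)) * ?n e) \<longlongrightarrow> I * ?n e) G"
        unfolding add_0_right by (rule tendsto_mono[OF G(2)])
      show "\<forall>\<^sub>F n in G. ip (x - s n) e \<le> (I + 1 / real (Suc n)) * ?n e"
      proof (intro always_eventually allI)
        fix n
        have "ip (x - s n) e \<le> ?n (x - s n) * ?n e"
          using abs_ip_le[of "x - s n" e] by simp
        also have "\<dots> \<le> (I + 1 / real (Suc n)) * ?n e"
          using s[of n] by (intro mult_right_mono real_sqrt_ge_zero ip_nonneg) auto
        finally show "ip (x - s n) e \<le> (I + 1 / real (Suc n)) * ?n e" .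
      qed
    qed
    moreover have "ip e e = ?n e * ?n e" using ip_nonneg[OF e] by simp
    ultimately have "?n e * ?n e \<le> I * ?n e" by simp
    then have "?n e \<le> I"
      using I0 real_sqrt_ge_zero[OF ip_nonneg[OF e]]
      by (metis mult_le_cancel_right_pos order_le_less)
    then have "?n (x - (x - e)) = I" using I_le[OF mM] by simp
    with mM show ?thesis unfolding I_def by blast
  qed
  with MX show ?thesis unfolding proximinal_in_def by blast
qed

text \<open>Gram-Schmidt orthonormalisation, one vector at a time.\<close>

lemma finite_orthonormal_basis:
  assumes "finite B" "B \<subseteq> X"
  obtains E where "finite E" "span E = span B"
    "\<And>e e'. e \<in> E \<Longrightarrow> e' \<in> E \<Longrightarrow> ip e e' = (if e = e' then 1 else 0)"
proof -
  have "\<exists>E. finite E \<and> span E = span B \<and> (\<forall>e\<in>E. \<forall>e'\<in>E. ip e e' = (if e = e' then 1 else 0))"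
    using assms
  proof (induction B rule: finite_induct)
    case empty
    then show ?case by (intro exI[of _ "{}"]) simp
  next
    case (insert b B)
    then obtain E where E: "finite E" "span E = span B"
      and on: "\<And>e e'. e \<in> E \<Longrightarrow> e' \<in> E \<Longrightarrow> ip e e' = (if e = e' then 1 else 0)" by auto
    have EX: "E \<subseteq> X" using span_subset_X[of B] insert.prems E(2) span_superset[of E] by auto
    have bX [simp]: "b \<in> X" using insert.prems by simp
    define p where "p = (\<Sum>e\<in>E. ip b e *\<^sub>R e)"
    have pE: "p \<in> span E" unfolding p_def by (intro span_sum span_scale span_base)
    have pX [simp]: "p \<in> X" using pE span_subset_X[OF EX] by auto
    define c where "c = b - p"
    have cX [simp]: "c \<in> X" unfolding c_def by auto
    have orth: "ip c e = 0" if "e \<in> E" for e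
    proof -
      have "ip p e = (\<Sum>e'\<in>E. ip b e' * ip e' e)"
        unfolding p_def using EX that by (subst ip_sum_left) (auto simp: ip_scaleR_left subset_iff)
      also have "\<dots> = (\<Sum>e'\<in>E. if e = e' then ip b e' else 0)"
        using on that by (intro sum.cong) auto
      also have "\<dots> = ip b e" using E that by simp
      finally show ?thesis using EX that by (auto simp: c_def ip_simps)
    qed
    show ?case
    proof (cases "c = 0")
      case True
      then have "b \<in> span B" using pE E(2) by (simp add: c_def)
      then show ?thesis using E on by (intro exI[of _ E]) (simp add: span_redundant)
    next
      case False
      then have pos: "ip c c > 0" using ip_nonneg[OF cX] ip_definite[OF cX] by fastforce
      define e where "e = (1 / sqrt (ip c c)) *\<^sub>R c"
      have [simp]: "e \<in> X" unfolding e_def by auto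
      have ee: "ip e e = 1" using pos unfolding e_def by (simp add: ip_simps)
      have eE: "ip e e' = 0 \<and> ip e' e = 0" if "e' \<in> E" for e'
        using orth[OF that] EX that ip_commute[of e' c]
        unfolding e_def by (auto simp: ip_simps subset_iff)
      have "span (insert e E) = span (insert b B)"
      proof
        have sub: "span E \<subseteq> span (insert b B)"
          using E(2) span_mono[of B "insert b B"] by auto
        have "c \<in> span (insert b B)"
          unfolding c_def using pE sub by (meson insertI1 span_base span_diff subsetD)
        then have "e \<in> span (insert b B)" unfolding e_def by (rule span_scale)
        then show "span (insert e E) \<subseteq> span (insert b B)"
          using sub span_superset[of E] by (intro span_minimal) auto
        have c: "c = sqrt (ip c c) *\<^sub>R e" using pos unfolding e_def by simp
        have "c \<in> span (insert e E)"
          by (subst c) (intro span_scale span_base, simp)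
        moreover have sub': "span E \<subseteq> span (insert e E)" by (rule span_mono) auto
        ultimately have "c + p \<in> span (insert e E)" using pE by (intro span_add) auto
        then show "span (insert b B) \<subseteq> span (insert e E)"
          using sub' E(2) span_superset[of B] by (intro span_minimal) (auto simp: c_def)
      qed
      moreover have "e \<notin> E" using ee eE by fastforce
      ultimately show ?thesis using E on ee eE
        by (intro exI[of _ "insert e E"]) auto
    qed
  qed
  then show thesis using that by blast
qed

text \<open>Against vectors of the span of \<open>E\<close>, a vector may be replaced by its orthogonal projection onto that
  span.\<close>

lemma orthonormal_expansion:
  assumes E: "finite E" "E \<subseteq> X"
    and on: "\<And>e e'. e \<in> E \<Longrightarrow> e' \<in> E \<Longrightarrow> ip e e' = (if e = e' then 1 else 0)"
    and xX [simp]: "x \<in> X" and y: "y \<in> span E"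
  shows "ip y (\<Sum>e\<in>E. ip x e *\<^sub>R e) = ip y x"
proof -
  define p where "p = (\<Sum>e\<in>E. ip x e *\<^sub>R e)"
  have pX [simp]: "p \<in> X" unfolding p_def using E by (intro subspace_sum[OF subspace_X]) auto
  have yX [simp]: "y \<in> X" using y span_subset_X[OF E(2)] by auto
  have "ip y (x - p) = 0"
  proof (rule ip_orthogonal_span[OF _ E(2) _ y])
    fix e assume e: "e \<in> E"
    then have eX [simp]: "e \<in> X" using E by auto
    have "ip p e = (\<Sum>e'\<in>E. ip x e' * ip e' e)"
      unfolding p_def using E(2) e by (subst ip_sum_left) (auto simp: ip_scaleR_left subset_iff)
    also have "\<dots> = (\<Sum>e'\<in>E. if e = e' then ip x e' else 0)"
      using on e by (intro sum.cong) auto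
    also have "\<dots> = ip x e" using E e by simp
    finally show "ip e (x - p) = 0" by (simp add: ip_simps ip_commute[of e])
  qed auto
  then show ?thesis unfolding p_def[symmetric] by (simp add: ip_simps)
qed

text \<open>The vector dual to \<open>c\<close> is the normalised component of \<open>c\<close> orthogonal to the other elements of \<open>B\<close>;
  this component is nonzero by independence.\<close>

lemma biorthogonal_system:
  assumes B: "finite B" "B \<subseteq> X" "independent B"
  obtains h where "\<And>b. b \<in> B \<Longrightarrow> h b \<in> X"
    "\<And>b c. b \<in> B \<Longrightarrow> c \<in> B \<Longrightarrow> ip b (h c) = (if b = c then 1 else 0)"
proof -
  have "\<exists>h\<in>X. \<forall>b\<in>B. ip b h = (if b = c then 1 else 0)" if c: "c \<in> B" for c
  proof -
    have cX [simp]: "c \<in> X" using c B by auto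
    obtain E where E: "finite E" "span E = span (B - {c})"
      and on: "\<And>e e'. e \<in> E \<Longrightarrow> e' \<in> E \<Longrightarrow> ip e e' = (if e = e' then 1 else 0)"
      using finite_orthonormal_basis[of "B - {c}"] B by auto
    have EX: "E \<subseteq> X" using span_subset_X[of "B - {c}"] E(2) span_superset[of E] B by auto
    define p where "p = (\<Sum>e\<in>E. ip c e *\<^sub>R e)"
    have pE: "p \<in> span E" unfolding p_def by (intro span_sum span_scale span_base)
    have pX [simp]: "p \<in> X" using pE span_subset_X[OF EX] by auto
    have orth: "ip y (c - p) = 0" if "y \<in> span E" for y
      using orthonormal_expansion[OF E(1) EX on cX that] that span_subset_X[OF EX]
      unfolding p_def[symmetric] by (auto simp: ip_simps subset_iff)
    have "c \<notin> span E" using B(3) c E(2) unfolding dependent_def by auto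
    then have "c - p \<noteq> 0" using pE by auto
    then have nz: "ip (c - p) (c - p) \<noteq> 0" using ip_definite[of "c - p"] by auto
    have cc: "ip c (c - p) = ip (c - p) (c - p)"
      using orth[OF pE] by (simp add: ip_diff_left)
    show ?thesis
    proof (intro bexI[of _ "(1 / ip (c - p) (c - p)) *\<^sub>R (c - p)"] ballI)
      fix b assume b: "b \<in> B"
      then have bX: "b \<in> X" using B by auto
      show "ip b ((1 / ip (c - p) (c - p)) *\<^sub>R (c - p)) = (if b = c then 1 else 0)"
      proof (cases "b = c")
        case True
        then show ?thesis using nz cc by (simp add: ip_scaleR_right)
      next
        case False
        then have "b \<in> span E" using b E(2) by (auto intro: span_base)
        then show ?thesis using False orth bX by (simp add: ip_scaleR_right)
      qed
    qed auto
  qed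
  then show thesis using that by metis
qed

text \<open>The matrix of the \<open>\<langle>w i, h k\<rangle>\<close> is close to the identity matrix, hence strictly diagonally dominant,
  so no linear relation between the \<open>w i\<close> can hold. This is how lower bounds on a dimension survive
  small perturbations.\<close>

lemma independent_if_almost_biorthogonal:
  assumes I: "finite I" and w: "\<And>i. i \<in> I \<Longrightarrow> w i \<in> X" and h: "\<And>i. i \<in> I \<Longrightarrow> h i \<in> X"
    and close: "\<And>i k. i \<in> I \<Longrightarrow> k \<in> I \<Longrightarrow>
      \<bar>ip (w i) (h k) - (if i = k then 1 else 0)\<bar> < 1 / (real (card I) + 1)"
  shows "inj_on w I" "independent (w ` I)"
proof -
  let ?e = "1 / (real (card I) + 1)"
  show inj: "inj_on w I"
  proof (rule inj_onI, rule ccontr)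
    fix i k assume i: "i \<in> I" and k: "k \<in> I" and eq: "w i = w k" and ne: "i \<noteq> k"
    have "card I > 0" using I i by (auto simp: card_gt_0_iff)
    then have "?e \<le> 1/2" by (simp add: field_simps)
    moreover have "\<bar>ip (w i) (h i) - 1\<bar> < ?e" "\<bar>ip (w i) (h i)\<bar> < ?e"
      using close[OF i i] close[OF k i] ne eq by auto
    ultimately show False by linarith
  qed
  show "independent (w ` I)"
  proof
    assume "dependent (w ` I)"
    then obtain u where u: "\<exists>v\<in>w ` I. u v \<noteq> 0" and sum0: "(\<Sum>v\<in>w ` I. u v *\<^sub>R v) = 0"
      unfolding dependent_finite[OF finite_imageI[OF I]] by blast
    define c where "c i = u (w i)" for i
    have sumc: "(\<Sum>i\<in>I. c i *\<^sub>R w i) = 0"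
      using sum0 unfolding sum.reindex[OF inj] c_def by simp
    have ne: "I \<noteq> {}" using u by auto
    \<comment> \<open>The equation tested with \<open>h k\<close> fails for an index \<open>k\<close> of a largest coefficient.\<close>
    define C where "C = Max ((\<lambda>i. \<bar>c i\<bar>) ` I)"
    have "C \<in> (\<lambda>i. \<bar>c i\<bar>) ` I" unfolding C_def using I ne by (intro Max_in) auto
    then obtain k where k: "k \<in> I" and Ck: "C = \<bar>c k\<bar>" by blast
    have kmax: "\<bar>c i\<bar> \<le> \<bar>c k\<bar>" if "i \<in> I" for i
      unfolding Ck[symmetric] C_def using I that by (intro Max_ge) auto
    have ck: "\<bar>c k\<bar> > 0" using u kmax unfolding c_def by fastforce
    define D where "D i = ip (w i) (h k) - (if i = k then 1 else 0)" for i
    have "0 = ip (\<Sum>i\<in>I. c i *\<^sub>R w i) (h k)" using sumc h k by simp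
    also have "\<dots> = (\<Sum>i\<in>I. c i * ip (w i) (h k))"
      using w h k by (subst ip_sum_left) (auto simp: ip_scaleR_left)
    also have "\<dots> = (\<Sum>i\<in>I. c i * D i + (if k = i then c i else 0))"
      unfolding D_def by (intro sum.cong) (auto simp: algebra_simps)
    also have "\<dots> = (\<Sum>i\<in>I. c i * D i) + c k" using I k by (simp add: sum.distrib)
    finally have "\<bar>c k\<bar> = \<bar>\<Sum>i\<in>I. c i * D i\<bar>" by simp
    also have "\<dots> \<le> (\<Sum>i\<in>I. \<bar>c i * D i\<bar>)" by (rule sum_abs)
    also have "\<dots> \<le> (\<Sum>i\<in>I. \<bar>c k\<bar> * ?e)"
      using kmax close[OF _ k] unfolding abs_mult D_def by (intro sum_mono mult_mono) (auto simp: less_imp_le)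
    also have "\<dots> = \<bar>c k\<bar> * (real (card I) * ?e)" by simp
    also have "\<dots> < \<bar>c k\<bar> * 1" using ck by (intro mult_strict_left_mono) (auto simp: field_simps)
    finally show False by simp
  qed
qed

end

section \<open>The Hilbert space of square-integrable functions\<close>

lemma L0_eq_iff: "u = v \<longleftrightarrow> (AE x in lborel. rep_L0 u x = rep_L0 v x)"
  using Quotient3_rel_rep[OF Quotient3_L0, of u v] by auto

lemma abs_L0_eq_iff:
  assumes "f \<in> borel_measurable borel" "g \<in> borel_measurable borel"
  shows "abs_L0 f = abs_L0 g \<longleftrightarrow> (AE x in lborel. f x = g x)"
  using Quotient3_rel[OF Quotient3_L0, of f g] assms by auto

lemma abs_L0_eqI: "f \<in> borel_measurable borel \<Longrightarrow> (AE x in lborel. f x = rep_L0 u x) \<Longrightarrow> abs_L0 f = u"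
  using rep_abs_L0[of f] by (auto simp: L0_eq_iff)

lemma rep_zero: "AE x in lborel. rep_L0 0 x = 0"
  unfolding zero_L0_def by (rule rep_abs_L0) simp

lemma rep_plus: "AE x in lborel. rep_L0 (u + v) x = rep_L0 u x + rep_L0 v x"
  unfolding plus_L0_def map_fun_def by (simp add: comp_def) (rule rep_abs_L0, simp)

lemma rep_minus: "AE x in lborel. rep_L0 (u - v) x = rep_L0 u x - rep_L0 v x"
  unfolding minus_L0_def map_fun_def by (simp add: comp_def) (rule rep_abs_L0, simp)

lemma rep_scaleR: "AE x in lborel. rep_L0 (c *\<^sub>R u) x = c * rep_L0 u x"
  unfolding scaleR_L0_def map_fun_def by (simp add: comp_def) (rule rep_abs_L0, simp)

lemma rep_sum: "AE x in lborel. rep_L0 (\<Sum>i\<in>I. f i) x = (\<Sum>i\<in>I. rep_L0 (f i) x)"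
proof (induction I rule: infinite_finite_induct)
  case (insert i I)
  show ?case
    using insert.IH rep_plus[of "f i" "sum f I"] by eventually_elim (use insert.hyps in simp)
qed (use rep_zero in simp_all)

definition L2_ip :: "'a::euclidean_space L0 \<Rightarrow> 'a L0 \<Rightarrow> real" where
  "L2_ip u v = (\<integral>x. rep_L0 u x * rep_L0 v x \<partial>lborel)"

lemma L2_norm_eq: "L2_norm u = sqrt (L2_ip u u)"
  by (simp add: L2_norm_def L2_ip_def power2_eq_square)

lemma L2_square_integrable: "u \<in> L2 \<Omega> \<Longrightarrow> integrable lborel (\<lambda>x. (rep_L0 u x)\<^sup>2)"
  by (simp add: L2_def)

lemma L2_support: "u \<in> L2 \<Omega> \<Longrightarrow> AE x in lborel. x \<notin> \<Omega> \<longrightarrow> rep_L0 u x = 0"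
  by (simp add: L2_def)

lemma integrable_mult_of_squares:
  fixes f g :: "'a \<Rightarrow> real"
  assumes [measurable]: "f \<in> borel_measurable M" "g \<in> borel_measurable M"
    and sq: "integrable M (\<lambda>x. (f x)\<^sup>2)" "integrable M (\<lambda>x. (g x)\<^sup>2)"
  shows "integrable M (\<lambda>x. f x * g x)"
proof (rule Bochner_Integration.integrable_bound[OF Bochner_Integration.integrable_add[OF sq]])
  have "\<bar>f x * g x\<bar> \<le> (f x)\<^sup>2 + (g x)\<^sup>2" for x
    using sum_squares_bound[of "\<bar>f x\<bar>" "\<bar>g x\<bar>"] mult_nonneg_nonneg[of "\<bar>f x\<bar>" "\<bar>g x\<bar>"]
    unfolding abs_mult by (simp only: power2_abs) linarith
  then show "AE x in M. norm (f x * g x) \<le> norm ((f x)\<^sup>2 + (g x)\<^sup>2)" by simp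
qed simp

lemma L2_integrable_mult:
  assumes "u \<in> L2 \<Omega>" "v \<in> L2 \<Omega>'"
  shows "integrable lborel (\<lambda>x. rep_L0 u x * rep_L0 v x)"
  by (rule integrable_mult_of_squares) (use assms L2_square_integrable in auto)

lemma abs_L0_in_L2:
  assumes [measurable]: "f \<in> borel_measurable borel" and supp: "AE x in lborel. x \<notin> \<Omega> \<longrightarrow> f x = 0"
    and int: "integrable lborel (\<lambda>x. (f x)\<^sup>2)"
  shows "abs_L0 f \<in> L2 \<Omega>"
proof -
  note ae = rep_abs_L0[of f, simplified]
  have "AE x in lborel. x \<notin> \<Omega> \<longrightarrow> rep_L0 (abs_L0 f) x = 0"
    using ae supp by eventually_elim auto
  moreover have "integrable lborel (\<lambda>x. (rep_L0 (abs_L0 f) x)\<^sup>2)"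
    using int by (rule integrable_cong_AE_imp) (use ae in auto)
  ultimately show ?thesis by (simp add: L2_def)
qed

lemma L2_ip_abs_right:
  assumes [measurable]: "f \<in> borel_measurable borel"
  shows "L2_ip u (abs_L0 f) = (\<integral>x. rep_L0 u x * f x \<partial>lborel)"
  unfolding L2_ip_def by (rule integral_cong_AE) (use rep_abs_L0[of f] in auto)

lemma L2_cong_AE:
  assumes u: "AE x in lborel. rep_L0 u x = f x" and f: "f \<in> borel_measurable borel"
    and "AE x in lborel. x \<notin> \<Omega> \<longrightarrow> f x = 0" "integrable lborel (\<lambda>x. (f x)\<^sup>2)"
  shows "u \<in> L2 \<Omega>"
  using abs_L0_eqI[OF f, of u] abs_L0_in_L2[OF f assms(3,4)] u by (simp add: eq_commute)

lemma subspace_L2: "subspace (L2 \<Omega>)"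
proof (rule subspaceI)
  show "0 \<in> L2 \<Omega>"
    by (rule L2_cong_AE[OF rep_zero]) auto
next
  fix u v :: "'a L0" assume uv: "u \<in> L2 \<Omega>" "v \<in> L2 \<Omega>"
  show "u + v \<in> L2 \<Omega>"
  proof (rule L2_cong_AE[OF rep_plus])
    show "AE x in lborel. x \<notin> \<Omega> \<longrightarrow> rep_L0 u x + rep_L0 v x = 0"
      using uv[THEN L2_support] by eventually_elim auto
    show "integrable lborel (\<lambda>x. (rep_L0 u x + rep_L0 v x)\<^sup>2)"
      using uv by (auto simp: power2_sum mult.assoc intro!: Bochner_Integration.integrable_add
          L2_square_integrable integrable_mult_right L2_integrable_mult)
  qed auto
next
  fix u :: "'a L0" and c assume u: "u \<in> L2 \<Omega>"
  show "c *\<^sub>R u \<in> L2 \<Omega>"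
  proof (rule L2_cong_AE[OF rep_scaleR])
    show "AE x in lborel. x \<notin> \<Omega> \<longrightarrow> c * rep_L0 u x = 0"
      using u[THEN L2_support] by eventually_elim auto
    show "integrable lborel (\<lambda>x. (c * rep_L0 u x)\<^sup>2)"
      using u by (auto simp: power_mult_distrib intro!: L2_square_integrable integrable_mult_right)
  qed auto
qed

lemma L2_ip_commute: "L2_ip u v = L2_ip v u"
  by (simp add: L2_ip_def mult.commute)

lemma L2_ip_add_left:
  assumes "u \<in> L2 \<Omega>" "v \<in> L2 \<Omega>" "w \<in> L2 \<Omega>'"
  shows "L2_ip (u + v) w = L2_ip u w + L2_ip v w"
proof -
  have "L2_ip (u + v) w = (\<integral>x. rep_L0 u x * rep_L0 w x + rep_L0 v x * rep_L0 w x \<partial>lborel)"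
    unfolding L2_ip_def
    by (rule integral_cong_AE) (use rep_plus[of u v] in \<open>auto simp: algebra_simps\<close>)
  also have "\<dots> = L2_ip u w + L2_ip v w"
    unfolding L2_ip_def
    by (intro Bochner_Integration.integral_add L2_integrable_mult[OF assms(1,3)] L2_integrable_mult[OF assms(2,3)])
  finally show ?thesis .
qed

lemma L2_ip_scaleR_left: "L2_ip (c *\<^sub>R u) w = c * L2_ip u w"
proof -
  have "L2_ip (c *\<^sub>R u) w = (\<integral>x. c * (rep_L0 u x * rep_L0 w x) \<partial>lborel)"
    unfolding L2_ip_def
    by (rule integral_cong_AE) (use rep_scaleR[of c u] in \<open>auto simp: algebra_simps\<close>)
  then show ?thesis unfolding L2_ip_def by simp
qed

lemma L2_ip_nonneg: "0 \<le> L2_ip u u"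
  unfolding L2_ip_def by simp

lemma L2_ip_definite:
  assumes "u \<in> L2 \<Omega>" "L2_ip u u = 0"
  shows "u = 0"
proof -
  have "AE x in lborel. (rep_L0 u x)\<^sup>2 = 0"
    using assms integral_nonneg_eq_0_iff_AE[OF L2_square_integrable[OF assms(1)]]
    by (simp add: L2_ip_def power2_eq_square)
  then show ?thesis
    unfolding L0_eq_iff using rep_zero by eventually_elim simp
qed

lemma nn_integral_square_diff_L2:
  assumes "u \<in> L2 \<Omega>" "v \<in> L2 \<Omega>"
  shows "(\<integral>\<^sup>+x. ennreal ((rep_L0 u x - rep_L0 v x)\<^sup>2) \<partial>lborel) = ennreal (L2_ip (u - v) (u - v))"
proof -
  have "(\<integral>\<^sup>+x. ennreal ((rep_L0 u x - rep_L0 v x)\<^sup>2) \<partial>lborel)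
      = (\<integral>\<^sup>+x. ennreal ((rep_L0 (u - v) x)\<^sup>2) \<partial>lborel)"
    by (rule nn_integral_cong_AE) (use rep_minus[of u v] in auto)
  also have "\<dots> = ennreal (\<integral>x. (rep_L0 (u - v) x)\<^sup>2 \<partial>lborel)"
    using assms by (intro nn_integral_eq_integral L2_square_integrable[of _ \<Omega>] subspace_diff[OF subspace_L2]) auto
  finally show ?thesis by (simp add: L2_ip_def power2_eq_square)
qed

text \<open>The integrals of \<open>4\<^sup>n |s (n+1) - s n|\<^sup>2\<close> are summable, hence \<open>\<Sum>n. 4\<^sup>n |s (n+1) - s n|\<^sup>2\<close> is finite
  almost everywhere, and there the increments are bounded by a multiple of \<open>2\<^sup>-\<^sup>n\<close>.\<close>

lemma AE_Cauchy_if_fast_Cauchy_L2: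
  fixes s :: "nat \<Rightarrow> 'a::euclidean_space L0"
  assumes s: "\<And>n. s n \<in> L2 \<Omega>"
    and fast: "\<And>n. L2_ip (s (Suc n) - s n) (s (Suc n) - s n) \<le> (1/8)^n"
  shows "AE x in lborel. Cauchy (\<lambda>n. rep_L0 (s n) x)"
proof -
  define d where "d n x = rep_L0 (s (Suc n)) x - rep_L0 (s n) x" for n x
  have [measurable]: "d n \<in> borel_measurable borel" for n unfolding d_def by measurable
  have "(\<integral>\<^sup>+x. (\<Sum>n. ennreal (4^n * (d n x)\<^sup>2)) \<partial>lborel) = (\<Sum>n. \<integral>\<^sup>+x. ennreal (4^n * (d n x)\<^sup>2) \<partial>lborel)"
    by (rule nn_integral_suminf) simp
  also have "\<dots> \<le> (\<Sum>n. ennreal ((1/2)^n))"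
  proof (rule suminf_le)
    fix n
    have "(\<integral>\<^sup>+x. ennreal (4^n * (d n x)\<^sup>2) \<partial>lborel) = ennreal (4^n) * (\<integral>\<^sup>+x. ennreal ((d n x)\<^sup>2) \<partial>lborel)"
      by (subst nn_integral_cmult[symmetric]) (auto simp: ennreal_mult)
    also have "\<dots> = ennreal (4^n * L2_ip (s (Suc n) - s n) (s (Suc n) - s n))"
      unfolding d_def nn_integral_square_diff_L2[OF s s] by (simp add: ennreal_mult L2_ip_nonneg)
    also have "\<dots> \<le> ennreal (4^n * (1/8)^n)"
      using fast[of n] by (intro ennreal_leI mult_left_mono) auto
    also have "4^n * (1/8)^n = (1/2::real)^n"
      by (simp flip: power_mult_distrib)
    finally show "(\<integral>\<^sup>+x. ennreal (4^n * (d n x)\<^sup>2) \<partial>lborel) \<le> ennreal ((1/2)^n)" .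
  qed auto
  also have "\<dots> = ennreal (\<Sum>n. (1/2)^n)"
    by (rule suminf_ennreal2) (auto intro: summable_geometric)
  finally have "(\<integral>\<^sup>+x. (\<Sum>n. ennreal (4^n * (d n x)\<^sup>2)) \<partial>lborel) \<noteq> \<infinity>"
    by (auto simp: top_unique)
  then have "AE x in lborel. (\<Sum>n. ennreal (4^n * (d n x)\<^sup>2)) \<noteq> \<infinity>"
    by (rule nn_integral_PInf_AE[rotated]) simp
  then show ?thesis
  proof eventually_elim
    case (elim x)
    have "summable (\<lambda>n. 4^n * (d n x)\<^sup>2)"
      using elim by (intro summable_suminf_not_top) auto
    then have "Bseq (\<lambda>n. 4^n * (d n x)\<^sup>2)"
      by (intro convergent_imp_Bseq) (auto dest!: summable_LIMSEQ_zero simp: convergent_def)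
    then obtain K where K: "K > 0" "\<And>n. \<bar>4^n * (d n x)\<^sup>2\<bar> \<le> K"
      by (auto elim!: BseqE)
    have "\<bar>d n x\<bar> \<le> sqrt K * (1/2)^n" for n
    proof -
      have sq: "(2^n)\<^sup>2 = (4::real)^n"
        by (simp add: power2_eq_square flip: power_mult_distrib)
      have "(2^n * \<bar>d n x\<bar>)\<^sup>2 \<le> K"
        using K(2)[of n] sq by (simp add: power_mult_distrib)
      then have "2^n * \<bar>d n x\<bar> \<le> sqrt K"
        by (rule real_le_rsqrt)
      then show ?thesis by (simp add: field_simps)
    qed
    moreover have "summable (\<lambda>n. sqrt K * (1/2)^n)"
      by (intro summable_mult summable_geometric) simp
    ultimately have "summable (\<lambda>n. d n x)"
      by (intro summable_comparison_test'[of "\<lambda>n. sqrt K * (1/2)^n" 0 "\<lambda>n. d n x"]) auto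
    then have "convergent (\<lambda>n. \<Sum>i<n. d i x)"
      by (auto simp: summable_iff_convergent)
    moreover have "(\<Sum>i<n. d i x) = rep_L0 (s n) x - rep_L0 (s 0) x" for n
      unfolding d_def by (rule sum_lessThan_telescope)
    ultimately have "convergent (\<lambda>n. (rep_L0 (s n) x - rep_L0 (s 0) x) + rep_L0 (s 0) x)"
      by (intro convergent_add convergent_const) simp
    then show ?case by (simp add: Cauchy_convergent_iff)
  qed
qed

text \<open>The Riesz-Fischer theorem: a fast Cauchy subsequence converges almost everywhere, and its pointwise
  limit is the limit in \<open>L\<^sup>2\<close> by Fatou's lemma.\<close>

lemma L2_complete:
  fixes s :: "nat \<Rightarrow> 'a::euclidean_space L0"
  assumes s: "\<And>n. s n \<in> L2 \<Omega>"
    and Cauchy: "\<And>e. e > 0 \<Longrightarrow> \<exists>N. \<forall>m\<ge>N. \<forall>n\<ge>N. L2_ip (s m - s n) (s m - s n) < e"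
  shows "\<exists>l\<in>L2 \<Omega>. (\<lambda>n. L2_ip (s n - l) (s n - l)) \<longlonglongrightarrow> 0"
proof -
  have "\<exists>r. strict_mono r \<and> (\<forall>n. \<forall>k\<ge>r n. L2_ip (s k - s (r n)) (s k - s (r n)) < (1/8)^n)"
  proof -
    have "\<forall>n. \<exists>N. \<forall>i\<ge>N. \<forall>k\<ge>N. L2_ip (s i - s k) (s i - s k) < (1/8)^n"
      by (intro allI Cauchy) simp
    then obtain N where N: "\<And>n i k. i \<ge> N n \<Longrightarrow> k \<ge> N n \<Longrightarrow> L2_ip (s i - s k) (s i - s k) < (1/8)^n"
      by metis
    define r where "r n = (\<Sum>i\<le>n. N i) + n" for n
    have "strict_mono r" unfolding strict_mono_Suc_iff r_def by simp
    moreover have "N n \<le> r n" for n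
      unfolding r_def using member_le_sum[of n "{..n}" N] by simp
    ultimately show ?thesis
      by (intro exI[of _ r] conjI allI impI N) (auto intro: order_trans)
  qed
  then obtain r where r: "strict_mono r"
    and r_fast: "\<And>n k. k \<ge> r n \<Longrightarrow> L2_ip (s k - s (r n)) (s k - s (r n)) < (1/8)^n" by blast
  have "AE x in lborel. Cauchy (\<lambda>n. rep_L0 (s (r n)) x)"
    using s r_fast r by (intro AE_Cauchy_if_fast_Cauchy_L2[of "\<lambda>n. s (r n)" \<Omega>])
      (auto simp: strict_mono_less_eq intro!: less_imp_le)
  then have conv: "AE x in lborel. (\<lambda>n. rep_L0 (s (r n)) x) \<longlonglongrightarrow> lim (\<lambda>n. rep_L0 (s (r n)) x)"
    by eventually_elim (simp add: Cauchy_convergent_iff convergent_LIMSEQ_iff)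
  define f where "f x = lim (\<lambda>n. rep_L0 (s (r n)) x)" for x
  have [measurable]: "f \<in> borel_measurable borel" unfolding f_def by measurable
  define l where "l = abs_L0 f"
  have l_eq: "AE x in lborel. rep_L0 l x = f x" unfolding l_def by (rule rep_abs_L0) simp
  \<comment> \<open>Fatou's lemma turns the Cauchy condition into a bound on the distance to the limit.\<close>
  have fatou: "(\<integral>\<^sup>+x. ennreal ((rep_L0 (s k) x - rep_L0 l x)\<^sup>2) \<partial>lborel) \<le> ennreal e"
    if N: "\<And>i. i \<ge> N \<Longrightarrow> L2_ip (s k - s i) (s k - s i) \<le> e" for k N e
  proof -
    have "(\<integral>\<^sup>+x. ennreal ((rep_L0 (s k) x - rep_L0 l x)\<^sup>2) \<partial>lborel)
        = (\<integral>\<^sup>+x. liminf (\<lambda>n. ennreal ((rep_L0 (s k) x - rep_L0 (s (r n)) x)\<^sup>2)) \<partial>lborel)"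
    proof (rule nn_integral_cong_AE)
      show "AE x in lborel. ennreal ((rep_L0 (s k) x - rep_L0 l x)\<^sup>2)
          = liminf (\<lambda>n. ennreal ((rep_L0 (s k) x - rep_L0 (s (r n)) x)\<^sup>2))"
        using conv l_eq
      proof eventually_elim
        case (elim x)
        then have "(\<lambda>n. rep_L0 (s (r n)) x) \<longlonglongrightarrow> rep_L0 l x" by (simp add: f_def)
        then have "(\<lambda>n. ennreal ((rep_L0 (s k) x - rep_L0 (s (r n)) x)\<^sup>2))
            \<longlonglongrightarrow> ennreal ((rep_L0 (s k) x - rep_L0 l x)\<^sup>2)"
          by (intro tendsto_intros)
        then show ?case by (rule lim_imp_Liminf[OF trivial_limit_sequentially, symmetric])
      qed
    qed
    also have "\<dots> \<le> liminf (\<lambda>n. \<integral>\<^sup>+x. ennreal ((rep_L0 (s k) x - rep_L0 (s (r n)) x)\<^sup>2) \<partial>lborel)"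
      by (rule nn_integral_liminf) simp
    also have "\<dots> \<le> liminf (\<lambda>n. ennreal e)"
    proof (rule Liminf_mono)
      show "\<forall>\<^sub>F n in sequentially. (\<integral>\<^sup>+x. ennreal ((rep_L0 (s k) x - rep_L0 (s (r n)) x)\<^sup>2) \<partial>lborel) \<le> ennreal e"
        unfolding nn_integral_square_diff_L2[OF s s] eventually_sequentially
        using N seq_suble[OF r] by (intro exI[of _ N] allI impI ennreal_leI) (meson order_trans)
    qed
    also have "\<dots> = ennreal e" by (simp add: Liminf_const)
    finally show ?thesis .
  qed
  have close: "l \<in> L2 \<Omega> \<and> L2_ip (s k - l) (s k - l) \<le> e"
    if N: "\<And>i. i \<ge> N \<Longrightarrow> L2_ip (s k - s i) (s k - s i) \<le> e" and e: "e \<ge> 0" for k N e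
  proof -
    have int: "integrable lborel (\<lambda>x. (rep_L0 (s k) x - rep_L0 l x)\<^sup>2)"
      using fatou[OF N] by (intro integrableI_nonneg) (auto simp: top_unique less_top[symmetric])
    have supp: "AE x in lborel. x \<notin> \<Omega> \<longrightarrow> rep_L0 (s i) x = 0" for i by (rule L2_support[OF s])
    then have "AE x in lborel. \<forall>i. x \<notin> \<Omega> \<longrightarrow> rep_L0 (s i) x = 0"
      unfolding AE_all_countable by blast
    then have "AE x in lborel. x \<notin> \<Omega> \<longrightarrow> rep_L0 (s k) x = 0 \<and> rep_L0 l x = 0"
      using l_eq
    proof eventually_elim
      case (elim x)
      then show ?case by (auto simp: f_def lim_const)
    qed
    then have supp: "AE x in lborel. x \<notin> \<Omega> \<longrightarrow> rep_L0 (s k) x - rep_L0 l x = 0"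
      by eventually_elim simp
    have mem: "s k - l \<in> L2 \<Omega>"
      by (rule L2_cong_AE[OF rep_minus _ supp int]) simp
    have "s k - (s k - l) \<in> L2 \<Omega>" by (rule subspace_diff[OF subspace_L2 s mem])
    then have l: "l \<in> L2 \<Omega>" by simp
    with fatou[OF N] nn_integral_square_diff_L2[OF s l, of k] e show ?thesis by simp
  qed
  have Nex: "\<exists>N. \<forall>k\<ge>N. \<forall>i\<ge>N. L2_ip (s k - s i) (s k - s i) \<le> e" if "e > 0" for e
    using Cauchy[OF that] by (meson less_imp_le)
  have "l \<in> L2 \<Omega>"
    using Nex[of 1] close[of _ _ 1] by (meson order_refl zero_le_one zero_less_one)
  moreover have "(\<lambda>n. L2_ip (s n - l) (s n - l)) \<longlonglongrightarrow> 0"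
  proof (rule LIMSEQ_I)
    fix e :: real assume e: "e > 0"
    then obtain N where N: "\<forall>k\<ge>N. \<forall>i\<ge>N. L2_ip (s k - s i) (s k - s i) \<le> e/2"
      using Nex[of "e/2"] by auto
    have "L2_ip (s k - l) (s k - l) < e" if "k \<ge> N" for k
      using close[of N k "e/2"] N that e by auto
    then show "\<exists>N. \<forall>k\<ge>N. norm (L2_ip (s k - l) (s k - l) - 0) < e"
      by (intro exI[of _ N]) (simp add: abs_of_nonneg[OF L2_ip_nonneg])
  qed
  ultimately show ?thesis by blast
qed

lemma hilbert_subspace_L2: "hilbert_subspace (L2 \<Omega>) L2_ip"
proof
  show "\<And>s. (\<And>n. s n \<in> L2 \<Omega>) \<Longrightarrow>
      (\<And>e. 0 < e \<Longrightarrow> \<exists>N. \<forall>m\<ge>N. \<forall>n\<ge>N. L2_ip (s m - s n) (s m - s n) < e) \<Longrightarrow>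
      \<exists>l\<in>L2 \<Omega>. (\<lambda>n. L2_ip (s n - l) (s n - l)) \<longlonglongrightarrow> 0"
    by (rule L2_complete)
qed (use subspace_L2 in \<open>auto simp: L2_ip_scaleR_left L2_ip_nonneg
      intro: L2_ip_commute L2_ip_add_left L2_ip_definite\<close>)

interpretation L2: hilbert_subspace "L2 \<Omega>" L2_ip for \<Omega> :: "'a::euclidean_space set"
  by (rule hilbert_subspace_L2)

section \<open>Smooth functions and test functions\<close>

lemma C_k_imp_continuous: "C_k k f \<Longrightarrow> continuous_on UNIV f"
  by (cases k) (auto simp: continuous_on_eq_continuous_at intro: differentiable_imp_continuous_within)

lemma C_k_Suc_imp: "C_k (Suc k) f \<Longrightarrow> C_k k f"
proof (induction k arbitrary: f)
  case 0
  then show ?case by (metis C_k.simps(1) C_k_imp_continuous)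
next
  case (Suc k)
  have "C_k (Suc k) (\<lambda>x. frechet_derivative f (at x) b)" if "b \<in> Basis" for b
    using Suc.prems that by simp
  with Suc.IH show ?case using Suc.prems by simp
qed

lemma C_k_SucI:
  assumes "\<And>x. (f has_derivative f' x) (at x)" "\<And>b. b \<in> Basis \<Longrightarrow> C_k k (\<lambda>x. f' x b)"
  shows "C_k (Suc k) f"
proof -
  have "frechet_derivative f (at x) = f' x" for x
    using frechet_derivative_at[OF assms(1)] by simp
  then show ?thesis using assms by (auto simp: differentiable_def)
qed

lemma C_k_SucD:
  assumes "C_k (Suc k) f"
  shows "(f has_derivative frechet_derivative f (at x)) (at x)"
    "b \<in> Basis \<Longrightarrow> C_k k (\<lambda>x. frechet_derivative f (at x) b)"
  using assms frechet_derivative_works by auto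

lemma C_k_const: "C_k k (\<lambda>x. c)"
  by (induction k arbitrary: c) auto

lemma C_k_add: "C_k k f \<Longrightarrow> C_k k g \<Longrightarrow> C_k k (\<lambda>x. f x + g x)"
proof (induction k arbitrary: f g)
  case 0
  then show ?case by (auto intro: continuous_on_add)
next
  case (Suc k)
  note f = C_k_SucD[OF Suc.prems(1)] and g = C_k_SucD[OF Suc.prems(2)]
  show ?case
    by (rule C_k_SucI[OF has_derivative_add[OF f(1) g(1)]]) (rule Suc.IH[OF f(2) g(2)])
qed

lemma C_k_sum: "(\<And>i. i \<in> I \<Longrightarrow> C_k k (f i)) \<Longrightarrow> C_k k (\<lambda>x. \<Sum>i\<in>I. f i x)"
  by (induction I rule: infinite_finite_induct) (auto intro: C_k_const C_k_add)

lemma C_k_mult: "C_k k f \<Longrightarrow> C_k k g \<Longrightarrow> C_k k (\<lambda>x. f x * g x)"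
proof (induction k arbitrary: f g)
  case 0
  then show ?case by (auto intro: continuous_on_mult)
next
  case (Suc k)
  note f = C_k_SucD[OF Suc.prems(1)] and g = C_k_SucD[OF Suc.prems(2)]
  show ?case
    by (rule C_k_SucI[OF has_derivative_mult[OF f(1) g(1)]])
      (intro C_k_add Suc.IH f(2) g(2) Suc.prems[THEN C_k_Suc_imp])
qed

lemma C_k_prod: "(\<And>i. i \<in> I \<Longrightarrow> C_k k (f i)) \<Longrightarrow> C_k k (\<lambda>x. \<Prod>i\<in>I. f i x)"
  by (induction I rule: infinite_finite_induct) (auto intro: C_k_const C_k_mult)

text \<open>Covers dilations of the line, coordinate projections and the embeddings of coordinate lines.\<close>

lemma C_k_compose_affine:
  fixes L :: "'b::euclidean_space \<Rightarrow> 'a::euclidean_space"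
  assumes L: "linear L"
  shows "C_k k f \<Longrightarrow> C_k k (\<lambda>x. f (L x + c))"
proof (induction k arbitrary: f)
  case 0
  have "continuous_on UNIV (\<lambda>x. L x + c)"
    by (intro continuous_on_add linear_continuous_on continuous_on_const)
      (simp add: L linear_conv_bounded_linear[symmetric])
  with 0 show ?case
    by (simp add: continuous_on_compose2[of UNIV f UNIV "\<lambda>x. L x + c"])
next
  case (Suc k)
  note f = C_k_SucD[OF Suc.prems]
  have L': "((\<lambda>x. L x + c) has_derivative L) (at x)" for x
    using has_derivative_add[OF linear_imp_has_derivative[OF L] has_derivative_const[of c]] by simp
  have "((\<lambda>x. f (L x + c)) has_derivative (\<lambda>h. frechet_derivative f (at (L x + c)) (L h))) (at x)" for x
    by (rule has_derivative_compose[OF L' f(1)])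
  then show ?case
  proof (rule C_k_SucI)
    fix b :: 'b
    have "frechet_derivative f (at y) (L b) = (\<Sum>i\<in>Basis. (L b \<bullet> i) * frechet_derivative f (at y) i)" for y
    proof -
      interpret linear "frechet_derivative f (at y)"
        by (rule has_derivative_linear[OF f(1)])
      have "frechet_derivative f (at y) (L b) = frechet_derivative f (at y) (\<Sum>i\<in>Basis. (L b \<bullet> i) *\<^sub>R i)"
        by (simp add: euclidean_representation)
      then show ?thesis by (simp add: sum scaleR)
    qed
    then show "C_k k (\<lambda>x. frechet_derivative f (at (L x + c)) (L b))"
      by (auto intro!: C_k_sum C_k_mult C_k_const Suc.IH f(2))
  qed
qed

text \<open>The standard smooth function that vanishes to infinite order at 0.\<close>

definition flat_exp :: "real \<Rightarrow> real" where
  "flat_exp x = (if x > 0 then exp (- 1 / x) else 0)"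

lemma poly_mult_exp_minus_tendsto_0: "((\<lambda>y. poly p y * exp (- y)) \<longlongrightarrow> (0::real)) at_top"
proof -
  have "((\<lambda>y. \<Sum>i\<le>degree p. coeff p i * (y ^ i / exp y)) \<longlongrightarrow> (\<Sum>i\<le>degree p. coeff p i * 0)) at_top"
    by (intro tendsto_sum tendsto_mult tendsto_const tendsto_power_div_exp_0)
  then show ?thesis
    by (simp add: poly_altdef sum_distrib_right exp_minus divide_inverse mult.assoc)
qed

text \<open>The functions \<open>p(1/x) exp(-1/x)\<close>, extended by 0 to the left half-line, are closed under
  differentiation; this yields the smoothness of \<open>flat_exp\<close> by induction on the order of
  differentiation, for all polynomials \<open>p\<close> at once.\<close>

lemma flat_poly_has_derivative:
  "((\<lambda>x. poly p (1 / x) * flat_exp x) has_real_derivative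
     poly ([:0, 0, 1:] * (p - pderiv p)) (1 / x) * flat_exp x) (at x)"
proof (cases x "0::real" rule: linorder_cases)
  case less
  have "((\<lambda>_. 0) has_real_derivative 0) (at x)" by simp
  then have "((\<lambda>x. poly p (1 / x) * flat_exp x) has_real_derivative 0) (at x)"
    by (rule has_field_derivative_transform_within_open[of _ _ _ "{..<0}"])
      (use less in \<open>auto simp: flat_exp_def\<close>)
  then show ?thesis using less by (simp add: flat_exp_def)
next
  case greater
  have "((\<lambda>x. poly p (1 / x) * exp (- 1 / x)) has_real_derivative
      poly p (1 / x) * (exp (- 1 / x) * (1 / x^2)) + (poly (pderiv p) (1 / x) * (- 1 / x^2)) * exp (- 1 / x)) (at x)"
    using greater by (auto intro!: derivative_eq_intros simp: power2_eq_square)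
  also have "poly p (1 / x) * (exp (- 1 / x) * (1 / x^2)) + (poly (pderiv p) (1 / x) * (- 1 / x^2)) * exp (- 1 / x)
      = poly ([:0, 0, 1:] * (p - pderiv p)) (1 / x) * flat_exp x"
    using greater by (simp add: flat_exp_def field_simps power2_eq_square)
  finally show ?thesis
    by (rule has_field_derivative_transform_within_open[of _ _ _ "{0<..}"])
      (use greater in \<open>auto simp: flat_exp_def\<close>)
next
  case equal
  have "((\<lambda>y. y * poly p y * exp (- y)) \<longlongrightarrow> (0::real)) at_top"
    using poly_mult_exp_minus_tendsto_0[of "pCons 0 p"] by simp
  then have "((\<lambda>h. inverse h * poly p (inverse h) * exp (- inverse h)) \<longlongrightarrow> (0::real)) (at_right 0)"
    by (rule filterlim_compose[OF _ filterlim_inverse_at_top_right])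
  then have "((\<lambda>h. poly p (1 / h) * flat_exp h / h) \<longlongrightarrow> (0::real)) (at_right 0)"
    by (rule Lim_transform_eventually)
      (auto simp: flat_exp_def eventually_at_right_field field_simps intro!: exI[of _ 1])
  moreover have "((\<lambda>h. poly p (1 / h) * flat_exp h / h) \<longlongrightarrow> (0::real)) (at_left 0)"
    by (rule Lim_transform_eventually[OF tendsto_const])
      (auto simp: flat_exp_def eventually_at_left_field intro!: exI[of _ "-1"])
  ultimately have "((\<lambda>h. poly p (1 / h) * flat_exp h / h) \<longlongrightarrow> (0::real)) (at 0)"
    by (simp add: filterlim_split_at)
  moreover have "flat_exp 0 = 0" by (simp add: flat_exp_def)
  ultimately show ?thesis using equal by (simp add: DERIV_def)
qed

lemma C_k_flat_poly: "C_k k (\<lambda>x. poly p (1 / x) * flat_exp x)"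
proof (induction k arbitrary: p)
  case 0
  show ?case
    using flat_poly_has_derivative DERIV_isCont by (simp add: continuous_on_eq_continuous_at) blast
next
  case (Suc k)
  show ?case
  proof (rule C_k_SucI)
    show "((\<lambda>x. poly p (1 / x) * flat_exp x) has_derivative
        (\<lambda>h. (poly ([:0, 0, 1:] * (p - pderiv p)) (1 / x) * flat_exp x) * h)) (at x)" for x
      using flat_poly_has_derivative[of p x] unfolding has_field_derivative_def .
    fix b :: real assume "b \<in> Basis"
    then have "b = 1" by simp
    then show "C_k k (\<lambda>x. (poly ([:0, 0, 1:] * (p - pderiv p)) (1 / x) * flat_exp x) * b)"
      using Suc.IH[of "[:0, 0, 1:] * (p - pderiv p)"] by simp
  qed
qed

lemma C_k_flat_exp: "C_k k flat_exp"
  using C_k_flat_poly[of k 1] by simp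

lemma flat_exp_nonneg: "0 \<le> flat_exp x" and flat_exp_le_1: "flat_exp x \<le> 1"
  by (auto simp: flat_exp_def)

lemma flat_exp_dilation_tendsto:
  "(\<lambda>n. flat_exp (real (Suc n) * x)) \<longlonglongrightarrow> (if x > 0 then 1 else 0)"
proof (cases "x > 0")
  case True
  have "(\<lambda>n. exp (- (1 / real (Suc n)) * (1 / x))) \<longlonglongrightarrow> exp (- 0 * (1 / x))"
    by (intro tendsto_intros LIMSEQ_Suc[OF lim_1_over_n])
  moreover have "flat_exp (real (Suc n) * x) = exp (- (1 / real (Suc n)) * (1 / x))" for n
    using True by (simp add: flat_exp_def zero_less_mult_iff)
  ultimately show ?thesis using True by simp
next
  case False
  then show ?thesis by (simp add: flat_exp_def zero_less_mult_iff)
qed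

text \<open>The dilation by \<open>n + 1\<close> makes these smooth functions, all positive exactly on the open interval from
  \<open>a\<close> to \<open>b\<close>, converge to its indicator function.\<close>

definition bump1 :: "nat \<Rightarrow> real \<Rightarrow> real \<Rightarrow> real \<Rightarrow> real" where
  "bump1 n a b t = flat_exp (real (Suc n) * (t - a)) * flat_exp (real (Suc n) * (b - t))"

definition box_bump :: "nat \<Rightarrow> 'a \<Rightarrow> 'a \<Rightarrow> 'a::euclidean_space \<Rightarrow> real" where
  "box_bump n a b x = (\<Prod>i\<in>Basis. bump1 n (a \<bullet> i) (b \<bullet> i) (x \<bullet> i))"

lemma bump1_nonneg: "0 \<le> bump1 n a b t" and bump1_le_1: "bump1 n a b t \<le> 1"
  by (auto simp: bump1_def flat_exp_nonneg flat_exp_le_1 intro: mult_le_one)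

lemma bump1_zero: "t \<notin> {a<..<b} \<Longrightarrow> bump1 n a b t = 0"
  by (auto simp: bump1_def flat_exp_def zero_less_mult_iff)

lemma bump1_tendsto: "(\<lambda>n. bump1 n a b t) \<longlonglongrightarrow> indicator {a<..<b} t"
proof -
  have "(\<lambda>n. bump1 n a b t) \<longlonglongrightarrow> (if t - a > 0 then 1 else 0) * (if b - t > 0 then 1 else 0)"
    unfolding bump1_def by (intro tendsto_mult flat_exp_dilation_tendsto)
  also have "(if t - a > 0 then 1 else 0) * (if b - t > 0 then 1 else 0) = (indicator {a<..<b} t :: real)"
    by (auto simp: indicator_def)
  finally show ?thesis .
qed

lemma C_k_bump1: "C_k k (bump1 n a b)"
proof -
  have "C_k k (\<lambda>t. flat_exp (real (Suc n) * t + (- real (Suc n) * a)))"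
    by (rule C_k_compose_affine[OF _ C_k_flat_exp]) (rule linear_times)
  moreover have "C_k k (\<lambda>t. flat_exp (- real (Suc n) * t + (real (Suc n) * b)))"
    by (rule C_k_compose_affine[OF _ C_k_flat_exp]) (rule linear_times)
  ultimately have "C_k k (\<lambda>t. flat_exp (real (Suc n) * t + (- real (Suc n) * a)) * flat_exp (- real (Suc n) * t + (real (Suc n) * b)))"
    by (rule C_k_mult)
  then show ?thesis unfolding bump1_def by (simp add: algebra_simps)
qed

lemma C_k_coordinate: "C_k k f \<Longrightarrow> C_k k (\<lambda>x::'a::euclidean_space. f (x \<bullet> i))"
  using C_k_compose_affine[of "\<lambda>x. x \<bullet> i" k f 0] by (simp add: bounded_linear.linear bounded_linear_inner_left)

lemma C_k_box_bump: "C_k k (box_bump n a b)"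
  unfolding box_bump_def by (intro C_k_prod C_k_coordinate[of k "bump1 n _ _"] C_k_bump1)

lemma box_bump_zero: "x \<notin> box a b \<Longrightarrow> box_bump n a b x = 0"
  unfolding box_bump_def by (rule prod_zero) (auto simp: mem_box intro!: bump1_zero)

lemma box_bump_nonneg: "0 \<le> box_bump n a b x" and box_bump_le_1: "box_bump n a b x \<le> 1"
  by (auto simp: box_bump_def bump1_nonneg bump1_le_1 intro!: prod_nonneg prod_le_1)

lemma box_bump_tendsto: "(\<lambda>n. box_bump n a b x) \<longlonglongrightarrow> indicator (box a b) x"
proof -
  have "(\<lambda>n. box_bump n a b x) \<longlonglongrightarrow> (\<Prod>i\<in>Basis. indicator {a \<bullet> i<..<b \<bullet> i} (x \<bullet> i))"
    unfolding box_bump_def by (intro tendsto_prod bump1_tendsto)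
  also have "(\<Prod>i\<in>Basis. indicator {a \<bullet> i<..<b \<bullet> i} (x \<bullet> i)) = (indicator (box a b) x :: real)"
  proof (cases "x \<in> box a b")
    case False
    then show ?thesis by (auto simp: mem_box indicator_def intro!: prod_zero)
  qed (auto simp: mem_box indicator_def)
  finally show ?thesis .
qed

lemma test_functions_box_bump: "cbox a b \<subseteq> \<Omega> \<Longrightarrow> box_bump n a b \<in> test_functions \<Omega>"
  unfolding test_functions_def
  by (auto simp: C_k_box_bump intro!: exI[of _ "cbox a b"] box_bump_zero
      dest: subsetD[OF box_subset_cbox(1)])

lemma test_function_continuous: "\<phi> \<in> test_functions \<Omega> \<Longrightarrow> continuous_on UNIV \<phi>"
  unfolding test_functions_def using C_k_imp_continuous by blast

lemma test_function_measurable: "\<phi> \<in> test_functions \<Omega> \<Longrightarrow> \<phi> \<in> borel_measurable borel"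
  by (rule borel_measurable_continuous_onI[OF test_function_continuous])

lemma test_function_C_k: "\<phi> \<in> test_functions \<Omega> \<Longrightarrow> C_k k \<phi>"
  unfolding test_functions_def by blast

lemma test_function_has_derivative:
  "\<phi> \<in> test_functions \<Omega> \<Longrightarrow> (\<phi> has_derivative frechet_derivative \<phi> (at x)) (at x)"
  by (rule C_k_SucD(1)[OF test_function_C_k])

lemma test_functions_derivative:
  assumes \<phi>: "\<phi> \<in> test_functions \<Omega>" and b: "b \<in> Basis"
  shows "(\<lambda>x. frechet_derivative \<phi> (at x) b) \<in> test_functions \<Omega>"
proof -
  obtain K where K: "compact K" "K \<subseteq> \<Omega>" and \<phi>0: "\<And>x. x \<notin> K \<Longrightarrow> \<phi> x = 0"
    using \<phi> unfolding test_functions_def by blast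
  have "frechet_derivative \<phi> (at x) = (\<lambda>_. 0)" if "x \<notin> K" for x
  proof -
    have "open (- K)" using compact_imp_closed[OF K(1)] by (simp add: open_Compl)
    then have "(\<phi> has_derivative (\<lambda>_. 0)) (at x)"
      using that \<phi>0 by (intro has_derivative_transform_within_open[OF has_derivative_const[of 0]]) auto
    then show ?thesis by (rule frechet_derivative_at[symmetric])
  qed
  moreover have "C_k k (\<lambda>x. frechet_derivative \<phi> (at x) b)" for k
    by (rule C_k_SucD(2)[OF test_function_C_k[OF \<phi>] b])
  ultimately show ?thesis
    unfolding test_functions_def using K by (auto intro!: exI[of _ K])
qed

lemma test_function_in_L2: "\<phi> \<in> test_functions \<Omega> \<Longrightarrow> abs_L0 \<phi> \<in> L2 \<Omega>"
proof (rule abs_L0_in_L2)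
  assume \<phi>: "\<phi> \<in> test_functions \<Omega>"
  then obtain K where K: "compact K" "K \<subseteq> \<Omega>" and \<phi>0: "\<And>x. x \<notin> K \<Longrightarrow> \<phi> x = 0"
    unfolding test_functions_def by blast
  show "\<phi> \<in> borel_measurable borel" by (rule test_function_measurable[OF \<phi>])
  show "AE x in lborel. x \<notin> \<Omega> \<longrightarrow> \<phi> x = 0" using K \<phi>0 by auto
  have "continuous_on K (\<lambda>x. (\<phi> x)\<^sup>2)"
    using continuous_on_subset[OF test_function_continuous[OF \<phi>]] by (auto intro: continuous_on_power)
  from borel_integrable_compact[OF K(1) this]
  show "integrable lborel (\<lambda>x. (\<phi> x)\<^sup>2)"
    by (rule Bochner_Integration.integrable_cong[THEN iffD1, rotated -1]) (auto simp: indicator_def \<phi>0)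
qed

section \<open>The du Bois-Reymond lemma\<close>

lemma is_weak_deriv_iff:
  assumes b: "b \<in> Basis"
  shows "is_weak_deriv \<Omega> b u w \<longleftrightarrow> (\<forall>\<phi>\<in>test_functions \<Omega>.
    L2_ip u (abs_L0 (\<lambda>x. frechet_derivative \<phi> (at x) b)) = - L2_ip w (abs_L0 \<phi>))"
  unfolding is_weak_deriv_def
  by (rule ball_cong[OF refl])
    (simp add: L2_ip_abs_right test_function_measurable[of _ \<Omega>]
      test_function_measurable[OF test_functions_derivative[OF _ b], of _ \<Omega>])

text \<open>The sets over which \<open>f\<close> integrates to 0 form a Dynkin system, because the total integral is 0, and the open boxes are an
  intersection-stable generator of the Borel sets.\<close>

lemma AE_zero_if_box_integrals_zero:
  fixes f :: "'a::euclidean_space \<Rightarrow> real"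
  assumes int: "integrable lborel f" and tot: "(\<integral>x. f x \<partial>lborel) = 0"
    and box: "\<And>a b. (\<integral>x. indicator (box a b) x * f x \<partial>lborel) = 0"
  shows "AE x in lborel. f x = 0"
proof (rule sigma_finite_measure.density_zero[OF lborel.sigma_finite_measure_axioms int])
  fix A :: "'a set" assume "A \<in> sets lborel"
  then have A: "A \<in> sigma_sets UNIV (range (\<lambda>(a, b). box a b))"
    unfolding sets_lborel borel_eq_box by simp
  have "Int_stable (range (\<lambda>(a, b). box a b :: 'a set))"
    by (auto simp: Int_stable_def box_Int_box)
  moreover have "range (\<lambda>(a, b). box a b :: 'a set) \<subseteq> Pow UNIV" by auto
  ultimately show "set_lebesgue_integral lborel A f = 0"
    using A
  proof (induction rule: sigma_sets_induct_disjoint)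
    case (basic A)
    then show ?case using box by (auto simp: set_lebesgue_integral_def)
  next
    case empty
    then show ?case by (simp add: set_lebesgue_integral_def)
  next
    case (compl A)
    then have [measurable]: "A \<in> sets borel" by (simp add: borel_eq_box)
    have intA: "integrable lborel (\<lambda>x. indicator A x *\<^sub>R f x)"
      by (rule integrable_mult_indicator[OF _ int]) simp
    have "set_lebesgue_integral lborel (UNIV - A) f = (\<integral>x. f x - indicator A x *\<^sub>R f x \<partial>lborel)"
      unfolding set_lebesgue_integral_def by (rule Bochner_Integration.integral_cong) (auto simp: indicator_def)
    also have "\<dots> = 0"
      using compl.IH int intA tot unfolding set_lebesgue_integral_def by simp
    finally show ?case .
  next
    case (union A)
    then have [measurable]: "A i \<in> sets borel" for i by (auto simp: borel_eq_box)
    have "set_integrable lborel (\<Union>i. A i) f"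
      unfolding set_integrable_def by (rule integrable_mult_indicator[OF _ int]) simp
    then have "set_lebesgue_integral lborel (\<Union>i. A i) f = (\<Sum>i. set_lebesgue_integral lborel (A i) f)"
      using union.hyps(1) by (intro lebesgue_integral_countable_add) (auto simp: disjoint_family_on_def)
    also have "\<dots> = 0" using union.IH by simp
    finally show ?case .
  qed
qed

lemma open_covered_by_countable_boxes:
  fixes \<Omega> :: "'a::euclidean_space set"
  assumes "open \<Omega>"
  obtains D where "countable D" "D \<subseteq> {(a, b). cbox a b \<subseteq> \<Omega>}" "\<Omega> \<subseteq> (\<Union>(a, b)\<in>D. box a b)"
proof -
  define F where "F = {box a b | a b. cbox a b \<subseteq> \<Omega>}"
  obtain F' where F': "F' \<subseteq> F" "countable F'" "\<Union>F' = \<Union>F"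
    using Lindelof[of F] by (auto simp: F_def)
  have "\<Omega> \<subseteq> \<Union>F"
  proof
    fix x assume "x \<in> \<Omega>"
    then obtain e where e: "e > 0" "cball x e \<subseteq> \<Omega>"
      using assms open_contains_cball by blast
    obtain a b where ab: "x \<in> box a b" "box a b \<subseteq> ball x e"
      using rational_boxes[OF e(1), of x] by blast
    have "cbox a b = closure (box a b)" using ab(1) by (auto intro!: closure_box[symmetric])
    also have "\<dots> \<subseteq> cball x e" using ab(2) ball_subset_cball by (intro closure_minimal) auto
    finally show "x \<in> \<Union>F" using e(2) ab(1) unfolding F_def by blast
  qed
  moreover have "\<forall>S\<in>F'. \<exists>p. S = (case p of (a, b) \<Rightarrow> box a b) \<and> p \<in> {(a, b). cbox a b \<subseteq> \<Omega>}"
    using F'(1) unfolding F_def by fastforce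
  then obtain p where p: "\<And>S. S \<in> F' \<Longrightarrow> S = (case p S of (a, b) \<Rightarrow> box a b) \<and> p S \<in> {(a, b). cbox a b \<subseteq> \<Omega>}"
    by metis
  moreover have "\<Union>F' \<subseteq> (\<Union>(a, b)\<in>p ` F'. box a b)" using p by fastforce
  ultimately have "\<Omega> \<subseteq> (\<Union>(a, b)\<in>p ` F'. box a b)" using F'(3) by simp
  moreover have "p ` F' \<subseteq> {(a, b). cbox a b \<subseteq> \<Omega>}" 
    by (rule image_subsetI) (rule p[THEN conjunct2])
  ultimately show thesis using F'(2) by (intro that[of "p ` F'"]) auto
qed

text \<open>Only the functions \<open>box_bump\<close> are used for testing. They converge boundedly to the indicators of
  boxes, so the integrals of \<open>w\<close> over the boxes whose closure lies in \<open>\<Omega>\<close> vanish. Being products of functions of one coordinate,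
  they also serve as elementary tensors below.\<close>

lemma du_Bois_Reymond:
  fixes w :: "'a::euclidean_space L0"
  assumes \<Omega>: "open \<Omega>" and w: "w \<in> L2 \<Omega>"
    and test: "\<And>a b n. cbox a b \<subseteq> \<Omega> \<Longrightarrow> L2_ip w (abs_L0 (box_bump n a b)) = 0"
  shows "w = 0"
proof -
  have ind_L2: "abs_L0 (indicator (box a b)) \<in> L2 UNIV" for a b :: 'a
    by (rule abs_L0_in_L2)
      (use emeasure_lborel_box_finite[of a b] in \<open>auto simp: power2_eq_square simp flip: indicator_inter_arith
        intro!: integrable_real_indicator\<close>)
  have int: "integrable lborel (\<lambda>x. indicator (box a b) x * rep_L0 w x)" for a b
    by (rule integrable_cong_AE_imp[OF L2_integrable_mult[OF ind_L2[of a b] w]])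
      (use rep_abs_L0[of "indicator (box a b)"] in auto)
  have box0: "(\<integral>x. indicator (box a b) x * rep_L0 w x \<partial>lborel) = 0" if ab: "cbox a b \<subseteq> \<Omega>" for a b
  proof -
    have meas: "box_bump n a b \<in> borel_measurable borel" for n
      by (rule borel_measurable_continuous_onI[OF C_k_imp_continuous[OF C_k_box_bump[of 0]]])
    have "(\<lambda>n. \<integral>x. rep_L0 w x * box_bump n a b x \<partial>lborel) \<longlonglongrightarrow> (\<integral>x. indicator (box a b) x * rep_L0 w x \<partial>lborel)"
    proof (rule integral_dominated_convergence)
      show "integrable lborel (\<lambda>x. \<bar>indicator (box a b) x * rep_L0 w x\<bar>)" using int by simp
      show "AE x in lborel. (\<lambda>n. rep_L0 w x * box_bump n a b x) \<longlonglongrightarrow> indicator (box a b) x * rep_L0 w x"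
        by (intro always_eventually allI) (subst mult.commute, intro tendsto_mult box_bump_tendsto tendsto_const)
      show "AE x in lborel. norm (rep_L0 w x * box_bump n a b x) \<le> \<bar>indicator (box a b) x * rep_L0 w x\<bar>" for n
      proof (intro always_eventually allI)
        fix x show "norm (rep_L0 w x * box_bump n a b x) \<le> \<bar>indicator (box a b) x * rep_L0 w x\<bar>"
          using box_bump_nonneg[of n a b x] box_bump_le_1[of n a b x] box_bump_zero[of x a b n]
          by (cases "x \<in> box a b") (auto simp: abs_mult intro!: mult_left_le)
      qed
    qed (use meas in auto)
    moreover have "(\<integral>x. rep_L0 w x * box_bump n a b x \<partial>lborel) = 0" for n
      using test[OF ab, of n] by (simp add: L2_ip_abs_right meas)
    ultimately show ?thesis by (simp add: LIMSEQ_const_iff)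
  qed
  have zero: "AE x in lborel. x \<in> box a b \<longrightarrow> rep_L0 w x = 0" if ab: "cbox a b \<subseteq> \<Omega>" for a b
  proof -
    have "AE x in lborel. indicator (box a b) x * rep_L0 w x = 0"
    proof (rule AE_zero_if_box_integrals_zero[OF int box0[OF ab]])
      fix c d :: 'a
      let ?l = "\<Sum>i\<in>Basis. max (c \<bullet> i) (a \<bullet> i) *\<^sub>R i" and ?u = "\<Sum>i\<in>Basis. min (d \<bullet> i) (b \<bullet> i) *\<^sub>R i"
      have "cbox ?l ?u \<subseteq> cbox a b" by (auto simp: mem_box)
      then have "(\<integral>x. indicator (box ?l ?u) x * rep_L0 w x \<partial>lborel) = 0" using ab by (intro box0) auto
      then show "(\<integral>x. indicator (box c d) x * (indicator (box a b) x * rep_L0 w x) \<partial>lborel) = 0"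
        by (simp add: box_Int_box[symmetric] indicator_inter_arith mult.assoc)
    qed
    then show ?thesis by eventually_elim (auto simp: indicator_def)
  qed
  obtain D where D: "countable D" "D \<subseteq> {(a, b). cbox a b \<subseteq> \<Omega>}" "\<Omega> \<subseteq> (\<Union>(a, b)\<in>D. box a b)"
    using open_covered_by_countable_boxes[OF \<Omega>] by blast
  have "AE x in lborel. \<forall>p\<in>D. x \<in> box (fst p) (snd p) \<longrightarrow> rep_L0 w x = 0"
    unfolding AE_ball_countable[OF D(1)] using D(2) zero by auto
  then show ?thesis
    unfolding L0_eq_iff using L2_support[OF w] rep_zero
  proof eventually_elim
    case (elim x)
    then show ?case using D(3) by (cases "x \<in> \<Omega>") force+
  qed
qed

section \<open>The Hilbert space of weakly differentiable functions\<close>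

lemma is_weak_deriv_add:
  assumes b: "b \<in> Basis" and "u \<in> L2 \<Omega>" "v \<in> L2 \<Omega>" "u' \<in> L2 \<Omega>" "v' \<in> L2 \<Omega>"
    and "is_weak_deriv \<Omega> b u u'" "is_weak_deriv \<Omega> b v v'"
  shows "is_weak_deriv \<Omega> b (u + v) (u' + v')"
  using assms
  by (simp add: is_weak_deriv_iff L2.ip_add_left[of _ \<Omega>] test_function_in_L2 test_functions_derivative)

lemma is_weak_deriv_scaleR:
  assumes b: "b \<in> Basis" and "is_weak_deriv \<Omega> b u u'"
  shows "is_weak_deriv \<Omega> b (c *\<^sub>R u) (c *\<^sub>R u')"
  using assms by (simp add: is_weak_deriv_iff L2_ip_scaleR_left)

lemma weak_deriv_unique:
  assumes \<Omega>: "open \<Omega>" and b: "b \<in> Basis" and w: "w \<in> L2 \<Omega>" "w' \<in> L2 \<Omega>"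
    and "is_weak_deriv \<Omega> b u w" "is_weak_deriv \<Omega> b u w'"
  shows "w = w'"
proof -
  have eq: "L2_ip w (abs_L0 \<phi>) = L2_ip w' (abs_L0 \<phi>)" if "\<phi> \<in> test_functions \<Omega>" for \<phi>
    using assms(5,6) that unfolding is_weak_deriv_iff[OF b] by (metis add.inverse_inverse)
  have "w - w' = 0"
  proof (rule du_Bois_Reymond[OF \<Omega>])
    show "w - w' \<in> L2 \<Omega>" using w by simp
    fix a c :: 'a and n assume "cbox a c \<subseteq> \<Omega>"
    then have "box_bump n a c \<in> test_functions \<Omega>" by (rule test_functions_box_bump)
    then show "L2_ip (w - w') (abs_L0 (box_bump n a c)) = 0"
      using eq w by (simp add: L2.ip_diff_left[of _ \<Omega>] test_function_in_L2)
  qed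
  then show ?thesis by simp
qed

lemma H1_imp_L2: "u \<in> H1 \<Omega> \<Longrightarrow> u \<in> L2 \<Omega>"
  by (simp add: H1_def)

lemma weak_deriv_eqI:
  assumes "open \<Omega>" "b \<in> Basis" "w \<in> L2 \<Omega>" "is_weak_deriv \<Omega> b u w"
  shows "weak_deriv \<Omega> b u = w"
  unfolding weak_deriv_def
  by (rule the_equality) (use assms weak_deriv_unique in blast)+

lemma weak_deriv_props:
  assumes "open \<Omega>" "b \<in> Basis" "u \<in> H1 \<Omega>"
  shows "weak_deriv \<Omega> b u \<in> L2 \<Omega>" "is_weak_deriv \<Omega> b u (weak_deriv \<Omega> b u)"
proof -
  obtain w where w: "w \<in> L2 \<Omega>" "is_weak_deriv \<Omega> b u w"
    using assms(2,3) unfolding H1_def by blast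
  with weak_deriv_eqI[OF assms(1,2) w] show "weak_deriv \<Omega> b u \<in> L2 \<Omega>"
    "is_weak_deriv \<Omega> b u (weak_deriv \<Omega> b u)" by simp_all
qed

lemma H1_I:
  assumes "u \<in> L2 \<Omega>" "\<And>b. b \<in> Basis \<Longrightarrow> f b \<in> L2 \<Omega>" "\<And>b. b \<in> Basis \<Longrightarrow> is_weak_deriv \<Omega> b u (f b)"
  shows "u \<in> H1 \<Omega>"
  using assms unfolding H1_def by blast

lemma H1_add:
  assumes \<Omega>: "open \<Omega>" and u: "u \<in> H1 \<Omega>" and v: "v \<in> H1 \<Omega>"
  shows "u + v \<in> H1 \<Omega>"
    "b \<in> Basis \<Longrightarrow> weak_deriv \<Omega> b (u + v) = weak_deriv \<Omega> b u + weak_deriv \<Omega> b v"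
proof -
  note wu = weak_deriv_props[OF \<Omega> _ u] and wv = weak_deriv_props[OF \<Omega> _ v]
  have wd: "is_weak_deriv \<Omega> b (u + v) (weak_deriv \<Omega> b u + weak_deriv \<Omega> b v)" if "b \<in> Basis" for b
    using that u v by (intro is_weak_deriv_add wu wv H1_imp_L2)
  have mem: "weak_deriv \<Omega> b u + weak_deriv \<Omega> b v \<in> L2 \<Omega>" if "b \<in> Basis" for b
    using wu wv that by simp
  show "u + v \<in> H1 \<Omega>"
    by (rule H1_I[OF _ mem wd]) (use u v in \<open>simp_all add: H1_imp_L2\<close>)
  show "b \<in> Basis \<Longrightarrow> weak_deriv \<Omega> b (u + v) = weak_deriv \<Omega> b u + weak_deriv \<Omega> b v"
    by (rule weak_deriv_eqI[OF \<Omega> _ mem wd])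
qed

lemma H1_scaleR:
  assumes \<Omega>: "open \<Omega>" and u: "u \<in> H1 \<Omega>"
  shows "c *\<^sub>R u \<in> H1 \<Omega>" "b \<in> Basis \<Longrightarrow> weak_deriv \<Omega> b (c *\<^sub>R u) = c *\<^sub>R weak_deriv \<Omega> b u"
proof -
  note wu = weak_deriv_props[OF \<Omega> _ u]
  have wd: "is_weak_deriv \<Omega> b (c *\<^sub>R u) (c *\<^sub>R weak_deriv \<Omega> b u)" if "b \<in> Basis" for b
    using that by (intro is_weak_deriv_scaleR wu)
  have mem: "c *\<^sub>R weak_deriv \<Omega> b u \<in> L2 \<Omega>" if "b \<in> Basis" for b
    using wu that by simp
  show "c *\<^sub>R u \<in> H1 \<Omega>"
    by (rule H1_I[OF _ mem wd]) (use u in \<open>simp_all add: H1_imp_L2\<close>)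
  show "b \<in> Basis \<Longrightarrow> weak_deriv \<Omega> b (c *\<^sub>R u) = c *\<^sub>R weak_deriv \<Omega> b u"
    by (rule weak_deriv_eqI[OF \<Omega> _ mem wd])
qed

lemma subspace_H1:
  assumes \<Omega>: "open \<Omega>"
  shows "subspace (H1 \<Omega>)"
proof (rule subspaceI)
  show "0 \<in> H1 \<Omega>"
    by (rule H1_I[of _ _ "\<lambda>_. 0"]) (auto simp: is_weak_deriv_iff test_function_in_L2[of _ \<Omega>]
        test_functions_derivative L2.ip_zero_left[of _ \<Omega>])
qed (use H1_add(1)[OF \<Omega>] H1_scaleR(1)[OF \<Omega>] in auto)

definition H1_ip :: "'a::euclidean_space set \<Rightarrow> 'a L0 \<Rightarrow> 'a L0 \<Rightarrow> real" where
  "H1_ip \<Omega> u v = L2_ip u v + (\<Sum>b\<in>Basis. L2_ip (weak_deriv \<Omega> b u) (weak_deriv \<Omega> b v))"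

lemma H1_norm_eq: "H1_norm \<Omega> u = sqrt (H1_ip \<Omega> u u)"
  by (simp add: H1_norm_def H1_ip_def L2_norm_eq L2_ip_nonneg)

lemma L2_ip_le_H1_ip: "L2_ip u u \<le> H1_ip \<Omega> u u"
  unfolding H1_ip_def by (simp add: sum_nonneg L2_ip_nonneg)

lemma L2_ip_weak_deriv_le_H1_ip:
  "b \<in> Basis \<Longrightarrow> L2_ip (weak_deriv \<Omega> b u) (weak_deriv \<Omega> b u) \<le> H1_ip \<Omega> u u"
  unfolding H1_ip_def
  by (rule add_increasing[OF L2_ip_nonneg member_le_sum]) (auto simp: L2_ip_nonneg)

lemma H1_diff:
  assumes \<Omega>: "open \<Omega>" and u: "u \<in> H1 \<Omega>" and v: "v \<in> H1 \<Omega>" and b: "b \<in> Basis"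
  shows "weak_deriv \<Omega> b (u - v) = weak_deriv \<Omega> b u - weak_deriv \<Omega> b v"
  using H1_add(2)[OF \<Omega> subspace_diff[OF subspace_H1[OF \<Omega>] u v] v b] by (simp add: algebra_simps)

text \<open>A Cauchy sequence converges in \<open>L\<^sup>2\<close> together with its weak derivatives, and the identity that defines
  the weak derivative passes to the limit, since both of its sides are \<open>L\<^sup>2\<close> inner products.\<close>

lemma H1_complete:
  fixes s :: "nat \<Rightarrow> 'a::euclidean_space L0"
  assumes \<Omega>: "open \<Omega>" and s: "\<And>n. s n \<in> H1 \<Omega>"
    and Cauchy: "\<And>e. e > 0 \<Longrightarrow> \<exists>N. \<forall>m\<ge>N. \<forall>n\<ge>N. H1_ip \<Omega> (s m - s n) (s m - s n) < e"
  shows "\<exists>l\<in>H1 \<Omega>. (\<lambda>n. H1_ip \<Omega> (s n - l) (s n - l)) \<longlonglongrightarrow> 0"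
proof -
  let ?d = "weak_deriv \<Omega>"
  note wd = weak_deriv_props[OF \<Omega> _ s]
  have "\<exists>l\<in>L2 \<Omega>. (\<lambda>n. L2_ip (s n - l) (s n - l)) \<longlonglongrightarrow> 0"
    using Cauchy by (intro L2_complete H1_imp_L2 s) (meson L2_ip_le_H1_ip le_less_trans)
  then obtain l where l: "l \<in> L2 \<Omega>" "(\<lambda>n. L2_ip (s n - l) (s n - l)) \<longlonglongrightarrow> 0" by blast
  have "\<exists>w\<in>L2 \<Omega>. (\<lambda>n. L2_ip (?d b (s n) - w) (?d b (s n) - w)) \<longlonglongrightarrow> 0" if b: "b \<in> Basis" for b
  proof (rule L2_complete)
    fix e :: real assume "e > 0"
    then obtain N where N: "\<forall>m\<ge>N. \<forall>n\<ge>N. H1_ip \<Omega> (s m - s n) (s m - s n) < e" using Cauchy by blast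
    show "\<exists>N. \<forall>m\<ge>N. \<forall>n\<ge>N. L2_ip (?d b (s m) - ?d b (s n)) (?d b (s m) - ?d b (s n)) < e"
      using N L2_ip_weak_deriv_le_H1_ip[OF b, of \<Omega>]
      by (intro exI[of _ N]) (metis H1_diff[OF \<Omega> s s b] le_less_trans)
  qed (rule wd(1)[OF b])
  then obtain w where w: "\<And>b. b \<in> Basis \<Longrightarrow> w b \<in> L2 \<Omega>"
    "\<And>b. b \<in> Basis \<Longrightarrow> (\<lambda>n. L2_ip (?d b (s n) - w b) (?d b (s n) - w b)) \<longlonglongrightarrow> 0"
    by metis
  have wdl: "is_weak_deriv \<Omega> b l (w b)" if b: "b \<in> Basis" for b
    unfolding is_weak_deriv_iff[OF b]
  proof
    fix \<phi> assume \<phi>: "\<phi> \<in> test_functions \<Omega>"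
    let ?\<phi>' = "abs_L0 (\<lambda>x. frechet_derivative \<phi> (at x) b)"
    have "(\<lambda>n. L2_ip (s n) ?\<phi>') \<longlonglongrightarrow> L2_ip l ?\<phi>'"
      using l(2) by (rule L2.tendsto_ip_left[of _ \<Omega>, rotated -1])
        (use s l(1) \<phi> b in \<open>auto intro: H1_imp_L2 test_function_in_L2 test_functions_derivative\<close>)
    moreover have "(\<lambda>n. - L2_ip (?d b (s n)) (abs_L0 \<phi>)) \<longlonglongrightarrow> - L2_ip (w b) (abs_L0 \<phi>)"
      using wd w \<phi> b by (intro tendsto_minus L2.tendsto_ip_left[of _ \<Omega>] test_function_in_L2)
    moreover have "L2_ip (s n) ?\<phi>' = - L2_ip (?d b (s n)) (abs_L0 \<phi>)" for n
      using wd(2)[OF b, of n] \<phi> unfolding is_weak_deriv_iff[OF b] by blast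
    ultimately show "L2_ip l ?\<phi>' = - L2_ip (w b) (abs_L0 \<phi>)"
      by (simp add: LIMSEQ_unique)
  qed
  have lH: "l \<in> H1 \<Omega>" by (rule H1_I[OF l(1) w(1) wdl])
  have "?d b (s n - l) = ?d b (s n) - w b" if "b \<in> Basis" for b n
    using H1_diff[OF \<Omega> s lH that] weak_deriv_eqI[OF \<Omega> that w(1) wdl] that by simp
  then have "(\<lambda>n. H1_ip \<Omega> (s n - l) (s n - l))
      = (\<lambda>n. L2_ip (s n - l) (s n - l) + (\<Sum>b\<in>Basis. L2_ip (?d b (s n) - w b) (?d b (s n) - w b)))"
    unfolding H1_ip_def by (intro ext arg_cong2[of _ _ _ _ "(+)"] sum.cong refl) auto
  also have "\<dots> \<longlonglongrightarrow> 0 + (\<Sum>b\<in>(Basis::'a set). 0)"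
    by (intro tendsto_add tendsto_sum l w)
  finally show ?thesis using lH by auto
qed

lemma hilbert_subspace_H1:
  assumes \<Omega>: "open \<Omega>"
  shows "hilbert_subspace (H1 \<Omega>) (H1_ip \<Omega>)"
proof
  show "subspace (H1 \<Omega>)" by (rule subspace_H1[OF \<Omega>])
next
  fix u v w assume "u \<in> H1 \<Omega>" "v \<in> H1 \<Omega>" "w \<in> H1 \<Omega>"
  then show "H1_ip \<Omega> (u + v) w = H1_ip \<Omega> u w + H1_ip \<Omega> v w"
    by (simp add: H1_ip_def H1_add(2)[OF \<Omega>] weak_deriv_props[OF \<Omega>] H1_imp_L2
        L2.ip_add_left[of _ \<Omega>] sum.distrib)
next
  fix c u v assume "u \<in> H1 \<Omega>" "v \<in> H1 \<Omega>"
  then show "H1_ip \<Omega> (c *\<^sub>R u) v = c * H1_ip \<Omega> u v"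
    by (simp add: H1_ip_def H1_scaleR(2)[OF \<Omega>] L2_ip_scaleR_left sum_distrib_left distrib_left)
next
  show "H1_ip \<Omega> u v = H1_ip \<Omega> v u" for u v by (simp add: H1_ip_def L2_ip_commute)
  show "0 \<le> H1_ip \<Omega> u u" for u by (simp add: H1_ip_def L2_ip_nonneg sum_nonneg)
next
  fix u assume "u \<in> H1 \<Omega>" "H1_ip \<Omega> u u = 0"
  then show "u = 0"
    using L2_ip_le_H1_ip[of u \<Omega>] L2_ip_nonneg[of u] by (intro L2_ip_definite[of u \<Omega>] H1_imp_L2) auto
next
  fix s :: "nat \<Rightarrow> 'a L0"
  assume "\<And>n. s n \<in> H1 \<Omega>"
    "\<And>e. 0 < e \<Longrightarrow> \<exists>N. \<forall>m\<ge>N. \<forall>n\<ge>N. H1_ip \<Omega> (s m - s n) (s m - s n) < e"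
  then show "\<exists>l\<in>H1 \<Omega>. (\<lambda>n. H1_ip \<Omega> (s n - l) (s n - l)) \<longlonglongrightarrow> 0"
    by (rule H1_complete[OF \<Omega>])
qed

text \<open>These are the weakly continuous functionals by which the rank is controlled.\<close>

lemma L2_functional_in_H1_dual:
  assumes \<Omega>: "open \<Omega>" and g: "g \<in> L2 \<Omega>"
  shows "(\<lambda>u. L2_ip u g) \<in> continuous_dual (H1 \<Omega>) (H1_norm \<Omega>)"
  unfolding continuous_dual_def
proof (safe, goal_cases)
  case 3
  show ?case
  proof (intro exI[of _ "sqrt (L2_ip g g)"] ballI)
    fix u assume u: "u \<in> H1 \<Omega>"
    have "\<bar>L2_ip u g\<bar> \<le> sqrt (L2_ip u u) * sqrt (L2_ip g g)"
      by (rule L2.abs_ip_le[OF H1_imp_L2[OF u] g])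
    also have "\<dots> \<le> H1_norm \<Omega> u * sqrt (L2_ip g g)"
      unfolding H1_norm_eq by (intro mult_right_mono real_sqrt_le_mono L2_ip_le_H1_ip) (simp add: L2_ip_nonneg)
    finally show "\<bar>L2_ip u g\<bar> \<le> sqrt (L2_ip g g) * H1_norm \<Omega> u" by (simp add: mult.commute)
  qed
qed (use g in \<open>simp_all add: L2.ip_add_left[of _ \<Omega>] L2_ip_scaleR_left H1_imp_L2\<close>)

section \<open>Lebesgue measure on a product and Fubini in one coordinate\<close>

definition insert_coord :: "'d \<Rightarrow> real \<Rightarrow> ('d \<Rightarrow> real) \<Rightarrow> real^'d::finite" where
  "insert_coord j t y = (\<chi> k. if k = j then t else y k)"

lemma insert_coord_nth [simp]: "insert_coord j t y $ k = (if k = j then t else y k)"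
  by (simp add: insert_coord_def)

abbreviation other_coords :: "'d::finite \<Rightarrow> ('d \<Rightarrow> real) measure" where
  "other_coords j \<equiv> \<Pi>\<^sub>M k\<in>- {j}. (lborel :: real measure)"

interpretation lborel_prod: product_sigma_finite "\<lambda>_::'d. lborel :: real measure" ..

lemma pair_sigma_finite_other_coords: "pair_sigma_finite (lborel :: real measure) (other_coords j)"
proof -
  have "sigma_finite_measure (other_coords j)" by (rule lborel_prod.sigma_finite) simp
  then show ?thesis by (simp add: pair_sigma_finite_def lborel.sigma_finite_measure_axioms)
qed

lemma measurable_component_other_coords:
  "k \<noteq> j \<Longrightarrow> (\<lambda>y. y k) \<in> borel_measurable (other_coords j)"
  using measurable_component_singleton[of k "- {j}" "\<lambda>_. lborel :: real measure"] by simp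

lemma measurable_insert_coord [measurable]:
  fixes j :: "'d::finite"
  shows "(\<lambda>p. insert_coord j (fst p) (snd p)) \<in> borel_measurable (lborel \<Otimes>\<^sub>M other_coords j)"
proof (rule borel_measurable_euclidean_space[THEN iffD2], rule ballI)
  fix i :: "real^'d" assume "i \<in> Basis"
  then obtain k where i: "i = axis k 1" by (auto simp: Basis_vec_def)
  have "(\<lambda>p. if k = j then fst p else snd p k) \<in> borel_measurable (lborel \<Otimes>\<^sub>M other_coords j)"
    by (cases "k = j") (auto intro!: measurable_compose[OF measurable_snd] measurable_component_other_coords)
  then show "(\<lambda>p. insert_coord j (fst p) (snd p) \<bullet> i) \<in> borel_measurable (lborel \<Otimes>\<^sub>M other_coords j)"
    by (simp add: i inner_axis)
qed

lemma prod_Basis_vec: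
  fixes f :: "real^'d::finite \<Rightarrow> 'b::comm_monoid_mult"
  shows "(\<Prod>b\<in>Basis. f b) = (\<Prod>k\<in>UNIV. f (axis k 1))"
proof -
  have B: "Basis = range (\<lambda>k::'d. axis k (1::real))" by (auto simp: Basis_vec_def)
  have inj: "inj (\<lambda>k::'d. axis k (1::real))" by (auto simp: inj_def axis_eq_axis)
  show ?thesis unfolding B prod.reindex[OF inj] comp_def ..
qed

lemma box_vec: "box l u = {x::real^'d::finite. \<forall>k. l $ k < x $ k \<and> x $ k < u $ k}"
  by (auto simp: mem_box_cart)

lemma lborel_vec_eq_distr_PiM:
  "(lborel :: (real^'d::finite) measure) = distr (\<Pi>\<^sub>M k\<in>UNIV. lborel) borel vec_lambda"
proof (rule lborel_eqI)
  fix l u :: "real^'d" assume lu: "\<And>b. b \<in> Basis \<Longrightarrow> l \<bullet> b \<le> u \<bullet> b"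
  have le: "l $ k \<le> u $ k" for k
    using lu[of "axis k 1"] by (auto simp: inner_axis Basis_vec_def)
  have "vec_lambda \<in> borel_measurable (\<Pi>\<^sub>M k\<in>(UNIV::'d set). (lborel :: real measure))"
    by (rule borel_measurable_euclidean_space[THEN iffD2])
      (auto simp: Basis_vec_def inner_axis intro!: measurable_component_singleton[where M="\<lambda>_. lborel", simplified])
  then have "emeasure (distr (\<Pi>\<^sub>M k\<in>(UNIV::'d set). lborel) borel vec_lambda) (box l u)
     = emeasure (\<Pi>\<^sub>M k\<in>(UNIV::'d set). lborel) (PiE UNIV (\<lambda>k. {l $ k<..<u $ k}))"
    by (subst emeasure_distr) (auto simp: box_vec space_PiM PiE_def extensional_def intro!: arg_cong2[where f=emeasure])
  also have "\<dots> = (\<Prod>k\<in>UNIV. emeasure lborel {l $ k<..<u $ k})"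
    by (rule lborel_prod.emeasure_PiM) auto
  also have "\<dots> = (\<Prod>b\<in>Basis. (u - l) \<bullet> b)"
    using le by (simp add: prod_Basis_vec inner_axis prod_ennreal)
  finally show "emeasure (distr (\<Pi>\<^sub>M k\<in>(UNIV::'d set). lborel) borel vec_lambda) (box l u)
     = (\<Prod>b\<in>Basis. (u - l) \<bullet> b)" .
qed simp

lemma lborel_vec_eq_distr_pair:
  "(lborel :: (real^'d::finite) measure) =
    distr (lborel \<Otimes>\<^sub>M other_coords j) borel (\<lambda>p. insert_coord j (fst p) (snd p))"
proof (rule lborel_eqI)
  interpret pair_sigma_finite "lborel :: real measure" "other_coords j"
    by (rule pair_sigma_finite_other_coords)
  fix l u :: "real^'d" assume lu: "\<And>b. b \<in> Basis \<Longrightarrow> l \<bullet> b \<le> u \<bullet> b"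
  have le: "l $ k \<le> u $ k" for k
    using lu[of "axis k 1"] by (auto simp: inner_axis Basis_vec_def)
  let ?f = "\<lambda>p. insert_coord j (fst p) (snd p)"
  have sets: "PiE (- {j}) (\<lambda>k. {l $ k<..<u $ k}) \<in> sets (other_coords j)"
    by (intro sets_PiM_I_finite) auto
  have "?f -` box l u \<inter> space (lborel \<Otimes>\<^sub>M other_coords j)
      = {l $ j<..<u $ j} \<times> PiE (- {j}) (\<lambda>k. {l $ k<..<u $ k})"
    by (auto simp: box_vec space_pair_measure space_PiM PiE_def Pi_def split: if_splits)
  then have "emeasure (distr (lborel \<Otimes>\<^sub>M other_coords j) borel ?f) (box l u)
     = emeasure (lborel \<Otimes>\<^sub>M other_coords j) ({l $ j<..<u $ j} \<times> PiE (- {j}) (\<lambda>k. {l $ k<..<u $ k}))"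
    by (subst emeasure_distr) auto
  also have "\<dots> = emeasure lborel {l $ j<..<u $ j} * emeasure (other_coords j) (PiE (- {j}) (\<lambda>k. {l $ k<..<u $ k}))"
    using sets by (intro M2.emeasure_pair_measure_Times) auto
  also have "emeasure (other_coords j) (PiE (- {j}) (\<lambda>k. {l $ k<..<u $ k}))
      = (\<Prod>k\<in>- {j}. emeasure lborel {l $ k<..<u $ k})"
    by (rule lborel_prod.emeasure_PiM) auto
  also have "emeasure lborel {l $ j<..<u $ j} * (\<Prod>k\<in>- {j}. emeasure lborel {l $ k<..<u $ k})
      = (\<Prod>k\<in>UNIV. emeasure lborel {l $ k<..<u $ k})"
    by (subst prod.remove[of UNIV j]) (auto simp: Compl_eq_Diff_UNIV)
  also have "\<dots> = (\<Prod>b\<in>Basis. (u - l) \<bullet> b)"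
    using le by (simp add: prod_Basis_vec inner_axis prod_ennreal)
  finally show "emeasure (distr (lborel \<Otimes>\<^sub>M other_coords j) borel ?f) (box l u)
     = (\<Prod>b\<in>Basis. (u - l) \<bullet> b)" .
qed simp

lemma AE_insert_coord:
  assumes "AE x in lborel. P (x :: real^'d::finite)"
  shows "AE t in lborel. AE y in other_coords j. P (insert_coord j t y)"
proof -
  interpret pair_sigma_finite "lborel :: real measure" "other_coords j"
    by (rule pair_sigma_finite_other_coords)
  have "AE p in lborel \<Otimes>\<^sub>M other_coords j. P (insert_coord j (fst p) (snd p))"
    using assms unfolding lborel_vec_eq_distr_pair[of j] by (rule AE_distrD[rotated]) simp
  from AE_pair[OF this] show ?thesis by simp
qed

lemma integrable_insert_coord:
  fixes f :: "real^'d::finite \<Rightarrow> real"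
  assumes "integrable lborel f"
  shows "integrable (lborel \<Otimes>\<^sub>M other_coords j) (\<lambda>p. f (insert_coord j (fst p) (snd p)))"
proof -
  have [measurable]: "f \<in> borel_measurable borel" using borel_measurable_integrable[OF assms] by simp
  show ?thesis
    using assms unfolding lborel_vec_eq_distr_pair[of j] by (subst (asm) integrable_distr_eq) auto
qed

lemma Fubini_insert_coord:
  fixes f :: "real^'d::finite \<Rightarrow> real"
  assumes f: "integrable lborel f"
  shows "(\<integral>x. f x \<partial>lborel) = (\<integral>t. \<integral>y. f (insert_coord j t y) \<partial>other_coords j \<partial>lborel)"
    and "(\<integral>x. f x \<partial>lborel) = (\<integral>y. \<integral>t. f (insert_coord j t y) \<partial>lborel \<partial>other_coords j)"
proof -
  interpret pair_sigma_finite "lborel :: real measure" "other_coords j"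
    by (rule pair_sigma_finite_other_coords)
  have [measurable]: "f \<in> borel_measurable borel" using borel_measurable_integrable[OF f] by simp
  note int = integrable_insert_coord[OF f, of j]
  have "(\<integral>x. f x \<partial>lborel) = (\<integral>p. f (insert_coord j (fst p) (snd p)) \<partial>(lborel \<Otimes>\<^sub>M other_coords j))"
    unfolding lborel_vec_eq_distr_pair[of j] by (subst integral_distr) auto
  moreover have "integrable (lborel \<Otimes>\<^sub>M other_coords j) (\<lambda>(t, y). f (insert_coord j t y))"
    using int by (simp add: case_prod_beta')
  from integral_snd[OF this]
  have "(\<integral>y. \<integral>t. f (insert_coord j t y) \<partial>lborel \<partial>other_coords j)
      = (\<integral>p. f (insert_coord j (fst p) (snd p)) \<partial>(lborel \<Otimes>\<^sub>M other_coords j))"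
    by (simp add: case_prod_beta')
  ultimately
  show "(\<integral>x. f x \<partial>lborel) = (\<integral>t. \<integral>y. f (insert_coord j t y) \<partial>other_coords j \<partial>lborel)"
    "(\<integral>x. f x \<partial>lborel) = (\<integral>y. \<integral>t. f (insert_coord j t y) \<partial>lborel \<partial>other_coords j)"
    using integral_fst'[OF int] by simp_all
qed

lemma AE_coordinate:
  assumes "AE t in lborel. P (t :: real)"
  shows "AE x in lborel. P ((x :: real^'d::finite) $ j)"
proof -
  obtain N where N: "{t. \<not> P t} \<subseteq> N" "N \<in> sets lborel" "emeasure lborel N = 0"
    using AE_E[OF assms] by (auto simp: space_lborel)
  have m: "(\<lambda>x :: real^'d. x $ j) -` N \<in> sets borel"
    using measurable_sets[of "\<lambda>x :: real^'d. x $ j" borel borel N] N(2) by simp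
  interpret pair_sigma_finite "lborel :: real measure" "other_coords j"
    by (rule pair_sigma_finite_other_coords)
  have "emeasure lborel ((\<lambda>x :: real^'d. x $ j) -` N)
      = emeasure (lborel \<Otimes>\<^sub>M other_coords j) (N \<times> space (other_coords j))"
    unfolding lborel_vec_eq_distr_pair[of j]
    by (subst emeasure_distr) (auto simp: m space_pair_measure intro!: arg_cong2[where f=emeasure])
  also have "\<dots> = 0"
    using N by (subst M2.emeasure_pair_measure_Times) auto
  finally have "emeasure lborel ((\<lambda>x :: real^'d. x $ j) -` N) = 0" .
  then show ?thesis
    using N(1) m by (intro AE_I[of _ _ "(\<lambda>x :: real^'d. x $ j) -` N"]) auto
qed

lemma integrable_prod_coordinates:
  fixes f :: "'d::finite \<Rightarrow> real \<Rightarrow> real"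
  assumes "\<And>k. integrable lborel (f k)"
  shows "integrable lborel (\<lambda>x::real^'d. \<Prod>k\<in>UNIV. f k (x $ k))"
    and "(\<integral>x. (\<Prod>k\<in>UNIV. f k ((x::real^'d) $ k)) \<partial>lborel) = (\<Prod>k\<in>UNIV. \<integral>t. f k t \<partial>lborel)"
proof -
  have [measurable]: "f k \<in> borel_measurable borel" for k
    using borel_measurable_integrable[OF assms[of k]] by simp
  have m: "vec_lambda \<in> borel_measurable (\<Pi>\<^sub>M k\<in>(UNIV::'d set). (lborel :: real measure))"
    by (rule borel_measurable_euclidean_space[THEN iffD2])
      (auto simp: Basis_vec_def inner_axis intro!: measurable_component_singleton[where M="\<lambda>_. lborel", simplified])
  have m': "(\<lambda>x::real^'d. \<Prod>k\<in>UNIV. f k (x $ k)) \<in> borel_measurable borel" by measurable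
  show "integrable lborel (\<lambda>x::real^'d. \<Prod>k\<in>UNIV. f k (x $ k))"
    unfolding lborel_vec_eq_distr_PiM
    by (subst integrable_distr_eq[OF m m']) (use lborel_prod.product_integrable_prod[of UNIV f] assms in simp)
  show "(\<integral>x. (\<Prod>k\<in>UNIV. f k ((x::real^'d) $ k)) \<partial>lborel) = (\<Prod>k\<in>UNIV. \<integral>t. f k t \<partial>lborel)"
    unfolding lborel_vec_eq_distr_PiM
    by (subst integral_distr[OF m m']) (use lborel_prod.product_integral_prod[of UNIV f] assms in simp)
qed

section \<open>Elementary tensors and contractions\<close>

lemma rep_elem_tensor:
  "AE x in lborel. rep_L0 (elem_tensor v) (x::real^'d::finite) = (\<Prod>k\<in>UNIV. rep_L0 (v k) (x $ k))"
  unfolding elem_tensor_def by (rule rep_abs_L0[OF borel_measurable_elem_tensor])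

lemma elem_tensor_in_L2:
  fixes v :: "'d::finite \<Rightarrow> real L0"
  assumes v: "\<And>k. v k \<in> L2 (\<Omega> k)"
  shows "elem_tensor v \<in> L2 (prod_domain \<Omega>)"
proof (rule L2_cong_AE[OF rep_elem_tensor borel_measurable_elem_tensor])
  have "AE x in lborel. (x::real^'d) $ k \<notin> \<Omega> k \<longrightarrow> rep_L0 (v k) (x $ k) = 0" for k
    by (rule AE_coordinate[OF L2_support[OF v]])
  then have "AE x in lborel. \<forall>k\<in>UNIV. (x::real^'d) $ k \<notin> \<Omega> k \<longrightarrow> rep_L0 (v k) (x $ k) = 0"
    by (intro AE_finite_allI) auto
  then show "AE x in lborel. (x::real^'d) \<notin> prod_domain \<Omega> \<longrightarrow> (\<Prod>k\<in>UNIV. rep_L0 (v k) (x $ k)) = 0"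
    by eventually_elim (auto simp: prod_domain_def)
  show "integrable lborel (\<lambda>x::real^'d. (\<Prod>k\<in>UNIV. rep_L0 (v k) (x $ k))\<^sup>2)"
    unfolding prod_power_distrib
    by (rule integrable_prod_coordinates) (rule L2_square_integrable[OF v])
qed

lemma L2_ip_elem_tensor:
  fixes v w :: "'d::finite \<Rightarrow> real L0"
  assumes "\<And>k. v k \<in> L2 (\<Omega> k)" "\<And>k. w k \<in> L2 (\<Omega> k)"
  shows "L2_ip (elem_tensor v) (elem_tensor w) = (\<Prod>k\<in>UNIV. L2_ip (v k) (w k))"
proof -
  have "L2_ip (elem_tensor v) (elem_tensor w)
      = (\<integral>x. (\<Prod>k\<in>UNIV. rep_L0 (v k) ((x::real^'d) $ k) * rep_L0 (w k) (x $ k)) \<partial>lborel)"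
    unfolding L2_ip_def prod.distrib
    by (rule integral_cong_AE)
      (use rep_elem_tensor[of v] rep_elem_tensor[of w] borel_measurable_elem_tensor in auto)
  also have "\<dots> = (\<Prod>k\<in>UNIV. L2_ip (v k) (w k))"
    unfolding L2_ip_def
    by (rule integrable_prod_coordinates(2)) (rule L2_integrable_mult[OF assms])
  finally show ?thesis .
qed

text \<open>Multilinearity of the tensor product, expanded over all choices of one summand in each factor.\<close>

lemma elem_tensor_sum:
  fixes E :: "'d::finite \<Rightarrow> real L0 set"
  assumes fin: "\<And>k. finite (E k)"
  shows "elem_tensor (\<lambda>k. \<Sum>e\<in>E k. c k e *\<^sub>R e)
    = (\<Sum>\<beta>\<in>PiE UNIV E. (\<Prod>k\<in>UNIV. c k (\<beta> k)) *\<^sub>R elem_tensor \<beta>)"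
proof -
  have "AE t in lborel. rep_L0 (\<Sum>e\<in>E k. c k e *\<^sub>R e) t = (\<Sum>e\<in>E k. c k e * rep_L0 e t)" for k
  proof -
    have "AE t in lborel. \<forall>e\<in>E k. rep_L0 (c k e *\<^sub>R e) t = c k e * rep_L0 e t"
      using fin rep_scaleR by (intro AE_finite_allI) auto
    with rep_sum[of "\<lambda>e. c k e *\<^sub>R e" "E k"] show ?thesis by eventually_elim simp
  qed
  then have "AE x in lborel. \<forall>k\<in>UNIV. rep_L0 (\<Sum>e\<in>E k. c k e *\<^sub>R e) ((x::real^'d) $ k)
      = (\<Sum>e\<in>E k. c k e * rep_L0 e (x $ k))"
    by (intro AE_finite_allI AE_coordinate) auto
  moreover have "AE x in lborel. \<forall>\<beta>\<in>PiE UNIV E.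
      rep_L0 ((\<Prod>k\<in>UNIV. c k (\<beta> k)) *\<^sub>R elem_tensor \<beta>) x
      = (\<Prod>k\<in>UNIV. c k (\<beta> k)) * (\<Prod>k\<in>UNIV. rep_L0 (\<beta> k) ((x::real^'d) $ k))"
  proof (rule AE_finite_allI)
    show "finite (PiE UNIV E)" using fin by (intro finite_PiE) auto
    show "AE x in lborel. rep_L0 ((\<Prod>k\<in>UNIV. c k (\<beta> k)) *\<^sub>R elem_tensor \<beta>) x
      = (\<Prod>k\<in>UNIV. c k (\<beta> k)) * (\<Prod>k\<in>UNIV. rep_L0 (\<beta> k) ((x::real^'d) $ k))" for \<beta>
      using rep_scaleR[of "\<Prod>k\<in>UNIV. c k (\<beta> k)" "elem_tensor \<beta>"] rep_elem_tensor[of \<beta>]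
      by eventually_elim simp
  qed
  ultimately show ?thesis
    unfolding L0_eq_iff
    using rep_sum[of "\<lambda>\<beta>. (\<Prod>k\<in>UNIV. c k (\<beta> k)) *\<^sub>R elem_tensor \<beta>" "PiE UNIV E"]
      rep_elem_tensor[of "\<lambda>k. \<Sum>e\<in>E k. c k e *\<^sub>R e"]
  proof eventually_elim
    case (elim x)
    have "rep_L0 (elem_tensor (\<lambda>k. \<Sum>e\<in>E k. c k e *\<^sub>R e)) x
        = (\<Prod>k\<in>UNIV. \<Sum>e\<in>E k. c k e * rep_L0 e (x $ k))"
      using elim by simp
    also have "\<dots> = (\<Sum>\<beta>\<in>PiE UNIV E. \<Prod>k\<in>UNIV. c k (\<beta> k) * rep_L0 (\<beta> k) (x $ k))"
      using fin by (intro prod_sum_PiE) auto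
    also have "\<dots> = (\<Sum>\<beta>\<in>PiE UNIV E. rep_L0 ((\<Prod>k\<in>UNIV. c k (\<beta> k)) *\<^sub>R elem_tensor \<beta>) x)"
      using elim by (intro sum.cong) (auto simp: prod.distrib)
    finally show ?case using elim by simp
  qed
qed

text \<open>A Cauchy-Schwarz inequality with a constant that is good enough for square integrability of
  contractions.\<close>

lemma integral_mult_square_le:
  fixes f g :: "'a \<Rightarrow> real"
  assumes [measurable]: "f \<in> borel_measurable M" "g \<in> borel_measurable M"
    and f: "integrable M (\<lambda>x. (f x)\<^sup>2)" and g: "integrable M (\<lambda>x. (g x)\<^sup>2)"
  shows "(\<integral>x. f x * g x \<partial>M)\<^sup>2 \<le> ((\<integral>x. (g x)\<^sup>2 \<partial>M) + 1) * (\<integral>x. (f x)\<^sup>2 \<partial>M)"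
proof -
  define A where "A = (\<integral>x. (f x)\<^sup>2 \<partial>M)"
  define B where "B = (\<integral>x. f x * g x \<partial>M)"
  define C where "C = (\<integral>x. (g x)\<^sup>2 \<partial>M)"
  have fg: "integrable M (\<lambda>x. f x * g x)" by (rule integrable_mult_of_squares) (use f g in auto)
  have C: "C \<ge> 0" unfolding C_def by simp
  \<comment> \<open>The summand 1 spares the case distinction whether \<open>g\<close> vanishes almost everywhere.\<close>
  have "0 \<le> (\<integral>x. ((C + 1) * f x - B * g x)\<^sup>2 \<partial>M)" by simp
  also have "\<dots> = (\<integral>x. (C + 1)\<^sup>2 * (f x)\<^sup>2 - 2 * (C + 1) * B * (f x * g x) + B\<^sup>2 * (g x)\<^sup>2 \<partial>M)"
    by (rule Bochner_Integration.integral_cong) (auto simp: power2_eq_square algebra_simps)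
  also have "\<dots> = (C + 1)\<^sup>2 * A - 2 * (C + 1) * B * B + B\<^sup>2 * C"
    unfolding A_def B_def C_def using f g fg by simp
  also have "\<dots> = (C + 1) * ((C + 1) * A - B\<^sup>2) - B\<^sup>2"
    by (simp add: power2_eq_square algebra_simps)
  finally have "0 \<le> (C + 1) * ((C + 1) * A - B\<^sup>2)" using zero_le_power2[of B] by linarith
  then have "B\<^sup>2 \<le> (C + 1) * A" using C by (simp add: zero_le_mult_iff)
  then show ?thesis by (simp add: A_def B_def C_def)
qed

definition other_factors :: "'d \<Rightarrow> ('d::finite \<Rightarrow> real L0) \<Rightarrow> ('d \<Rightarrow> real) \<Rightarrow> real" where
  "other_factors j g y = (\<Prod>k\<in>- {j}. rep_L0 (g k) (y k))"

lemma measurable_other_factors [measurable]: "other_factors j g \<in> borel_measurable (other_coords j)"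
  unfolding other_factors_def
  by (intro borel_measurable_prod measurable_compose[OF measurable_component_other_coords borel_measurable_rep_L0]) simp

lemma square_integrable_other_factors:
  assumes "\<And>k. k \<noteq> j \<Longrightarrow> g k \<in> L2 (\<Omega> k)"
  shows "integrable (other_coords j) (\<lambda>y. (other_factors j g y)\<^sup>2)"
  unfolding other_factors_def prod_power_distrib
  by (rule lborel_prod.product_integrable_prod) (use assms L2_square_integrable in auto)

lemma prod_insert_coord:
  fixes f :: "'d::finite \<Rightarrow> real \<Rightarrow> real"
  shows "(\<Prod>k\<in>UNIV. f k (insert_coord j t y $ k)) = f j t * (\<Prod>k\<in>- {j}. f k (y k))"
  by (subst prod.remove[of UNIV j]) (auto simp: Compl_eq_Diff_UNIV intro!: prod.cong)

lemma contract_alt: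
  "contract j g u = abs_L0 (\<lambda>t. \<integral>y. rep_L0 u (insert_coord j t y) * other_factors j g y \<partial>other_coords j)"
  unfolding contract_def insert_coord_def other_factors_def ..

lemma measurable_contract [measurable]:
  "(\<lambda>t. \<integral>y. rep_L0 u (insert_coord j t y) * other_factors j g y \<partial>other_coords j) \<in> borel_measurable borel"
  using borel_measurable_contract[where u=u and j=j and g=g] unfolding insert_coord_def other_factors_def .

lemma rep_contract:
  "AE t in lborel. rep_L0 (contract j g u) t = (\<integral>y. rep_L0 u (insert_coord j t y) * other_factors j g y \<partial>other_coords j)"
  unfolding contract_alt by (rule rep_abs_L0) simp

text \<open>Cauchy-Schwarz on almost every slice, where the slices of \<open>u\<^sup>2\<close> have integrable integrals by Fubini.\<close>

lemma contract_in_L2: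
  fixes u :: "(real^'d::finite) L0"
  assumes u: "u \<in> L2 (prod_domain \<Omega>)" and g: "\<And>k. k \<noteq> j \<Longrightarrow> g k \<in> L2 (\<Omega> k)"
  shows "contract j g u \<in> L2 (\<Omega> j)"
proof (rule L2_cong_AE[OF rep_contract])
  interpret pair_sigma_finite "lborel :: real measure" "other_coords j"
    by (rule pair_sigma_finite_other_coords)
  let ?c = "\<lambda>t. \<integral>y. rep_L0 u (insert_coord j t y) * other_factors j g y \<partial>other_coords j"
  have "AE t in lborel. AE y in other_coords j. insert_coord j t y \<notin> prod_domain \<Omega> \<longrightarrow> rep_L0 u (insert_coord j t y) = 0"
    by (rule AE_insert_coord[OF L2_support[OF u]])
  then show "AE t in lborel. t \<notin> \<Omega> j \<longrightarrow> ?c t = 0"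
  proof eventually_elim
    case (elim t)
    show ?case
    proof
      assume t: "t \<notin> \<Omega> j"
      have "insert_coord j t y \<notin> prod_domain \<Omega>" for y
        using t by (auto simp: prod_domain_def intro!: exI[of _ j])
      with elim have "AE y in other_coords j. rep_L0 u (insert_coord j t y) * other_factors j g y = 0"
        by auto
      then show "?c t = 0" by (rule integral_eq_zero_AE)
    qed
  qed
  define C where "C = (\<integral>y. (other_factors j g y)\<^sup>2 \<partial>other_coords j) + 1"
  have int: "integrable (lborel \<Otimes>\<^sub>M other_coords j) (\<lambda>p. (rep_L0 u (insert_coord j (fst p) (snd p)))\<^sup>2)"
    by (rule integrable_insert_coord[OF L2_square_integrable[OF u]])
  show "integrable lborel (\<lambda>t. (?c t)\<^sup>2)"
  proof (rule Bochner_Integration.integrable_bound)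
    show "integrable lborel (\<lambda>t. C * (\<integral>y. (rep_L0 u (insert_coord j t y))\<^sup>2 \<partial>other_coords j))"
      using integrable_fst'[OF int] by (intro integrable_mult_right) simp
    have "AE t in lborel. integrable (other_coords j) (\<lambda>y. (rep_L0 u (insert_coord j t y))\<^sup>2)"
      using AE_integrable_fst'[OF int] by simp
    then show "AE t in lborel. norm ((?c t)\<^sup>2) \<le> norm (C * (\<integral>y. (rep_L0 u (insert_coord j t y))\<^sup>2 \<partial>other_coords j))"
    proof eventually_elim
      case (elim t)
      have [measurable]: "(\<lambda>y. rep_L0 u (insert_coord j t y)) \<in> borel_measurable (other_coords j)"
        using measurable_Pair2[OF measurable_compose[OF measurable_insert_coord[of j] borel_measurable_rep_L0[of u]], of t]
        by simp
      have "(?c t)\<^sup>2 \<le> C * (\<integral>y. (rep_L0 u (insert_coord j t y))\<^sup>2 \<partial>other_coords j)"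
        unfolding C_def
        by (rule integral_mult_square_le) (use elim square_integrable_other_factors[of j g \<Omega>] g in auto)
      then show ?case by simp
    qed
  qed simp
qed simp

text \<open>Contraction is adjoint to forming the elementary tensor. This identity turns questions about the
  rank into questions about inner products with elementary tensors.\<close>

lemma L2_ip_contract:
  fixes u :: "(real^'d::finite) L0"
  assumes u: "u \<in> L2 (prod_domain \<Omega>)" and g: "\<And>k. g k \<in> L2 (\<Omega> k)"
  shows "L2_ip (contract j g u) (g j) = L2_ip u (elem_tensor g)"
proof -
  let ?f = "\<lambda>x. rep_L0 u x * (\<Prod>k\<in>UNIV. rep_L0 (g k) (x $ k))"
  note m = borel_measurable_elem_tensor[of g]
  have "integrable lborel ?f"
    by (rule integrable_cong_AE_imp[OF L2_integrable_mult[OF u elem_tensor_in_L2[OF g]]])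
      (use m rep_elem_tensor[of g] in auto)
  then have "(\<integral>x. ?f x \<partial>lborel) = (\<integral>t. \<integral>y. ?f (insert_coord j t y) \<partial>other_coords j \<partial>lborel)"
    by (rule Fubini_insert_coord)
  also have "\<dots> = (\<integral>t. (\<integral>y. rep_L0 u (insert_coord j t y) * other_factors j g y \<partial>other_coords j) * rep_L0 (g j) t \<partial>lborel)"
    unfolding prod_insert_coord[of "\<lambda>k. rep_L0 (g k)"] other_factors_def[symmetric]
    by (simp add: mult.left_commute mult.commute[of _ "rep_L0 (g j) _"])
  also have "\<dots> = L2_ip (contract j g u) (g j)"
    unfolding L2_ip_def by (rule integral_cong_AE) (use rep_contract[of j g u] in auto)
  also have "(\<integral>x. ?f x \<partial>lborel) = L2_ip u (elem_tensor g)"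
    unfolding L2_ip_def by (rule integral_cong_AE) (use m rep_elem_tensor[of g] in auto)
  finally show ?thesis ..
qed

lemma contract_cong:
  assumes "\<And>k. k \<noteq> j \<Longrightarrow> g k = g' k"
  shows "contract j g u = contract j g' u"
proof -
  have "(\<Prod>k\<in>- {j}. rep_L0 (g k) (y k)) = (\<Prod>k\<in>- {j}. rep_L0 (g' k) (y k))" for y
    by (rule prod.cong) (auto simp: assms)
  then show ?thesis unfolding contract_def by simp
qed

section \<open>Elementary tensors and weak derivatives\<close>

lemma C_k_vec_nth: "C_k k f \<Longrightarrow> C_k k (\<lambda>x::real^'d::finite. f (x $ i))"
  using C_k_coordinate[of k f "axis i 1 :: real^'d"] by (simp add: inner_axis inner_real_def)

lemma test_functions_tensor:
  fixes \<psi> :: "'d::finite \<Rightarrow> real \<Rightarrow> real"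
  assumes \<psi>: "\<And>k. \<psi> k \<in> test_functions (\<Omega> k)"
  shows "(\<lambda>x::real^'d. \<Prod>k\<in>UNIV. \<psi> k (x $ k)) \<in> test_functions (prod_domain \<Omega>)"
proof -
  have "\<exists>K. compact K \<and> K \<subseteq> \<Omega> k \<and> (\<forall>t. t \<notin> K \<longrightarrow> \<psi> k t = 0)" for k
    using \<psi>[of k] unfolding test_functions_def by blast
  then obtain K where K: "\<And>k. compact (K k)" "\<And>k. K k \<subseteq> \<Omega> k" "\<And>k t. t \<notin> K k \<Longrightarrow> \<psi> k t = 0"
    by metis
  have "\<exists>a b. K k \<subseteq> {a..b}" for k
    by (rule bounded_subset_cbox_symmetric[OF compact_imp_bounded[OF K(1)[of k]]]) (auto simp: cbox_interval)
  then obtain a b where ab: "\<And>k. K k \<subseteq> {a k..b k}" by metis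
  then have ab': "t \<in> K k \<Longrightarrow> a k \<le> t \<and> t \<le> b k" for k t by fastforce
  have "closed {x::real^'d. \<forall>k. x $ k \<in> K k}"
    unfolding Collect_all_eq
    by (intro closed_INT ballI closed_vimage[of "K _" "\<lambda>x. x $ _", unfolded vimage_def]
        compact_imp_closed K continuous_intros)
  then have "compact ({x::real^'d. \<forall>k. x $ k \<in> K k} \<inter> cbox (\<chi> k. a k) (\<chi> k. b k))"
    by (rule closed_Int_compact) (rule compact_cbox)
  also have "{x::real^'d. \<forall>k. x $ k \<in> K k} \<inter> cbox (\<chi> k. a k) (\<chi> k. b k) = {x. \<forall>k. x $ k \<in> K k}"
    using ab' by (auto simp: mem_box_cart)
  finally have "compact {x::real^'d. \<forall>k. x $ k \<in> K k}" .
  moreover have "{x::real^'d. \<forall>k. x $ k \<in> K k} \<subseteq> prod_domain \<Omega>"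
    using K(2) by (auto simp: prod_domain_def)
  moreover have "C_k n (\<lambda>x::real^'d. \<Prod>k\<in>UNIV. \<psi> k (x $ k))" for n
    by (intro C_k_prod C_k_vec_nth test_function_C_k[OF \<psi>])
  moreover have "(\<Prod>k\<in>UNIV. \<psi> k (x $ k)) = 0" if "x \<notin> {x::real^'d. \<forall>k. x $ k \<in> K k}" for x
    using that K(3) by (auto intro!: prod_zero)
  ultimately show ?thesis unfolding test_functions_def by blast
qed

lemma elem_tensor_test_functions:
  fixes \<psi> :: "'d::finite \<Rightarrow> real \<Rightarrow> real"
  assumes m: "\<And>k. \<psi> k \<in> borel_measurable borel"
  shows "elem_tensor (\<lambda>k. abs_L0 (\<psi> k)) = abs_L0 (\<lambda>x. \<Prod>k\<in>UNIV. \<psi> k (x $ k))"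
proof -
  note [measurable] = m
  have "AE x in lborel. \<forall>k\<in>UNIV. rep_L0 (abs_L0 (\<psi> k)) ((x::real^'d) $ k) = \<psi> k (x $ k)"
    by (intro AE_finite_allI AE_coordinate rep_abs_L0 m) simp
  then have "AE x in lborel. (\<Prod>k\<in>UNIV. rep_L0 (abs_L0 (\<psi> k)) ((x::real^'d) $ k)) = (\<Prod>k\<in>UNIV. \<psi> k (x $ k))"
    by eventually_elim simp
  moreover have "(\<lambda>x::real^'d. \<Prod>k\<in>UNIV. \<psi> k (x $ k)) \<in> borel_measurable borel" by measurable
  ultimately show ?thesis
    unfolding elem_tensor_def by (subst abs_L0_eq_iff[OF borel_measurable_elem_tensor])
qed

lemma frechet_derivative_tensor:
  fixes \<psi> :: "'d::finite \<Rightarrow> real \<Rightarrow> real"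
  assumes \<psi>: "\<And>k. \<psi> k \<in> test_functions (\<Omega> k)"
  shows "frechet_derivative (\<lambda>x. \<Prod>k\<in>UNIV. \<psi> k (x $ k)) (at x) (axis j 1)
    = (\<Prod>k\<in>UNIV. (\<psi>(j := \<lambda>t. frechet_derivative (\<psi> j) (at t) 1)) k (x $ k))"
proof -
  let ?d = "\<lambda>k t. frechet_derivative (\<psi> k) (at t)"
  have "((\<lambda>x. \<psi> k (x $ k)) has_derivative (\<lambda>h. ?d k (x $ k) (h $ k))) (at x)" for k
    by (rule has_derivative_compose[OF bounded_linear_imp_has_derivative[OF bounded_linear_vec_nth]
          test_function_has_derivative[OF \<psi>]])
  then have "((\<lambda>x. \<Prod>k\<in>UNIV. \<psi> k (x $ k)) has_derivative
      (\<lambda>h. \<Sum>i\<in>UNIV. ?d i (x $ i) (h $ i) * (\<Prod>k\<in>UNIV - {i}. \<psi> k (x $ k)))) (at x)"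
    by (rule has_derivative_prod)
  from frechet_derivative_at[OF this, symmetric]
  have "frechet_derivative (\<lambda>x. \<Prod>k\<in>UNIV. \<psi> k (x $ k)) (at x) (axis j 1)
      = (\<Sum>i\<in>UNIV. ?d i (x $ i) (axis j 1 $ i) * (\<Prod>k\<in>UNIV - {i}. \<psi> k (x $ k)))"
    by simp
  also have "\<dots> = (\<Sum>i\<in>UNIV. if i = j then ?d j (x $ j) 1 * (\<Prod>k\<in>UNIV - {j}. \<psi> k (x $ k)) else 0)"
  proof (rule sum.cong[OF refl])
    fix i
    have "?d i (x $ i) 0 = 0"
      using has_derivative_linear[OF test_function_has_derivative[OF \<psi>[of i]]] by (rule linear_0)
    then show "?d i (x $ i) (axis j 1 $ i) * (\<Prod>k\<in>UNIV - {i}. \<psi> k (x $ k))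
        = (if i = j then ?d j (x $ j) 1 * (\<Prod>k\<in>UNIV - {j}. \<psi> k (x $ k)) else 0)"
      by (auto simp: axis_def)
  qed
  also have "\<dots> = ?d j (x $ j) 1 * (\<Prod>k\<in>UNIV - {j}. \<psi> k (x $ k))" by simp
  also have "(\<Prod>k\<in>UNIV - {j}. \<psi> k (x $ k)) = (\<Prod>k\<in>UNIV - {j}. (\<psi>(j := \<lambda>t. ?d j t 1)) k (x $ k))"
    by (rule prod.cong) auto
  also have "?d j (x $ j) 1 * \<dots> = (\<Prod>k\<in>UNIV. (\<psi>(j := \<lambda>t. ?d j t 1)) k (x $ k))"
    using prod.remove[of UNIV j "\<lambda>k. (\<psi>(j := \<lambda>t. ?d j t 1)) k (x $ k)"] by simp
  finally show ?thesis .
qed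

lemma open_prod_domain: "(\<And>k. open (\<Omega> k)) \<Longrightarrow> open (prod_domain \<Omega>)"
  unfolding prod_domain_def by (rule open_vector_box) simp

lemma box_bump_vec:
  "box_bump n a b = (\<lambda>x::real^'d::finite. \<Prod>k\<in>UNIV. bump1 n (a $ k) (b $ k) (x $ k))"
  unfolding box_bump_def prod_Basis_vec by (simp add: inner_axis)

lemma bump1_test_function: "{a..b} \<subseteq> S \<Longrightarrow> bump1 n a b \<in> test_functions S"
  using test_functions_box_bump[of a b S n]
  by (simp add: box_bump_def[abs_def] cbox_interval)

text \<open>The functions \<open>box_bump\<close> of the du Bois-Reymond lemma are elementary tensors.\<close>

lemma elem_tensors_separate_L2:
  fixes w :: "(real^'d::finite) L0"
  assumes \<Omega>: "\<And>k. open (\<Omega> k)" and w: "w \<in> L2 (prod_domain \<Omega>)"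
    and zero: "\<And>h. (\<And>k. h k \<in> L2 (\<Omega> k)) \<Longrightarrow> L2_ip w (elem_tensor h) = 0"
  shows "w = 0"
proof (rule du_Bois_Reymond[OF open_prod_domain[OF \<Omega>] w])
  fix a b :: "real^'d" and n assume ab: "cbox a b \<subseteq> prod_domain \<Omega>"
  show "L2_ip w (abs_L0 (box_bump n a b)) = 0"
  \<comment> \<open>If the box is empty, its sides need not be contained in the domains \<open>\<Omega> k\<close>.\<close>
  proof (cases "box a b = {}")
    case True
    then have "box_bump n a b = (\<lambda>_. 0)" by (auto intro!: box_bump_zero)
    then show ?thesis by (simp add: L2_ip_abs_right)
  next
    case False
    then obtain z where z: "z \<in> box a b" by blast
    have sub: "{a $ k..b $ k} \<subseteq> \<Omega> k" for k
    proof
      fix t assume "t \<in> {a $ k..b $ k}"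
      then have "(\<chi> i. if i = k then t else z $ i) \<in> cbox a b"
        using z by (auto simp: mem_box_cart less_imp_le)
      with ab have "(\<chi> i. if i = k then t else z $ i) \<in> prod_domain \<Omega>" by blast
      then show "t \<in> \<Omega> k" by (auto simp: prod_domain_def dest: spec[of _ k])
    qed
    have test: "bump1 n (a $ k) (b $ k) \<in> test_functions (\<Omega> k)" for k
      by (rule bump1_test_function[OF sub])
    have "abs_L0 (box_bump n a b) = elem_tensor (\<lambda>k. abs_L0 (bump1 n (a $ k) (b $ k)))"
      unfolding box_bump_vec by (rule elem_tensor_test_functions[symmetric]) (rule test_function_measurable[OF test])
    then show ?thesis
      using zero[of "\<lambda>k. abs_L0 (bump1 n (a $ k) (b $ k))"] test_function_in_L2[OF test] by simp
  qed
qed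

lemma test_function_slice:
  fixes \<phi> :: "real^'d::finite \<Rightarrow> real"
  assumes \<phi>: "\<phi> \<in> test_functions (prod_domain \<Omega>)"
  shows "(\<lambda>t. \<phi> (insert_coord j t y)) \<in> test_functions (\<Omega> j)"
    and "frechet_derivative (\<lambda>t. \<phi> (insert_coord j t y)) (at t) 1
      = frechet_derivative \<phi> (at (insert_coord j t y)) (axis j 1)"
proof -
  define c where "c = insert_coord j 0 y"
  have ins: "insert_coord j t y = t *\<^sub>R axis j 1 + c" for t
    by (auto simp: vec_eq_iff axis_def c_def)
  have L: "linear (\<lambda>t::real. t *\<^sub>R (axis j 1 :: real^'d))"
    by (intro linearI) (auto simp: scaleR_left_distrib)
  obtain K where K: "compact K" "K \<subseteq> prod_domain \<Omega>" "\<And>x. x \<notin> K \<Longrightarrow> \<phi> x = 0"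
    using \<phi> unfolding test_functions_def by blast
  have "compact ((\<lambda>x. x $ j) ` K)"
    by (intro compact_continuous_image continuous_intros K)
  moreover have "(\<lambda>x. x $ j) ` K \<subseteq> \<Omega> j" using K(2) by (auto simp: prod_domain_def)
  moreover have "\<phi> (insert_coord j t y) = 0" if "t \<notin> (\<lambda>x. x $ j) ` K" for t
    using that by (intro K(3)) (auto simp: image_iff)
  moreover have "C_k k (\<lambda>t. \<phi> (insert_coord j t y))" for k
    unfolding ins by (rule C_k_compose_affine[OF L test_function_C_k[OF \<phi>]])
  ultimately show "(\<lambda>t. \<phi> (insert_coord j t y)) \<in> test_functions (\<Omega> j)"
    unfolding test_functions_def by blast
  have "((\<lambda>t. t *\<^sub>R axis j 1 + c) has_derivative (\<lambda>t. t *\<^sub>R axis j 1)) (at t)"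
    using has_derivative_add[OF linear_imp_has_derivative[OF L] has_derivative_const[of c]]
    by simp
  then have "((\<lambda>t. \<phi> (insert_coord j t y)) has_derivative
      (\<lambda>h. frechet_derivative \<phi> (at (insert_coord j t y)) (h *\<^sub>R axis j 1))) (at t)"
    using has_derivative_compose[OF _ test_function_has_derivative[OF \<phi>]] unfolding ins by blast
  from frechet_derivative_at[OF this, symmetric]
  show "frechet_derivative (\<lambda>t. \<phi> (insert_coord j t y)) (at t) 1
      = frechet_derivative \<phi> (at (insert_coord j t y)) (axis j 1)" by simp
qed

text \<open>The derivative of an elementary tensor in direction \<open>j\<close> differentiates its \<open>j\<close>-th factor.\<close>

lemma elem_tensor_in_H1:
  fixes v :: "'d::finite \<Rightarrow> real L0"
  assumes \<Omega>: "\<And>k. open (\<Omega> k)" and v: "\<And>k. v k \<in> H1 (\<Omega> k)"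
  shows "elem_tensor v \<in> H1 (prod_domain \<Omega>)"
proof -
  define v' where "v' j = weak_deriv (\<Omega> j) 1 (v j)" for j
  have v': "v' j \<in> L2 (\<Omega> j)" "is_weak_deriv (\<Omega> j) 1 (v j) (v' j)" for j
    unfolding v'_def using weak_deriv_props[OF \<Omega> _ v] by auto
  have vL: "v k \<in> L2 (\<Omega> k)" for k by (rule H1_imp_L2[OF v])
  have wL: "(v(j := v' j)) k \<in> L2 (\<Omega> k)" for j k using v' vL by simp
  have wd: "is_weak_deriv (prod_domain \<Omega>) (axis j 1) (elem_tensor v) (elem_tensor (v(j := v' j)))" for j
    unfolding is_weak_deriv_def
  proof
    fix \<phi> :: "real^'d \<Rightarrow> real" assume \<phi>: "\<phi> \<in> test_functions (prod_domain \<Omega>)"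
    let ?d = "\<lambda>x. frechet_derivative \<phi> (at x) (axis j 1)"
    have dt: "?d \<in> test_functions (prod_domain \<Omega>)"
      by (rule test_functions_derivative[OF \<phi>]) (auto simp: Basis_vec_def)
    \<comment> \<open>Fubini separates the variable \<open>j\<close>, in which the slices of a test function are test functions.\<close>
    have fub: "(\<integral>x. rep_L0 (elem_tensor u) x * \<eta> x \<partial>lborel)
        = (\<integral>y. other_factors j u y * (\<integral>t. rep_L0 (u j) t * \<eta> (insert_coord j t y) \<partial>lborel) \<partial>other_coords j)"
      if u: "\<And>k. u k \<in> L2 (\<Omega> k)" and \<eta>: "\<eta> \<in> test_functions (prod_domain \<Omega>)" for u \<eta>
    proof -
      let ?T = "\<lambda>x::real^'d. \<Prod>k\<in>UNIV. rep_L0 (u k) (x $ k)"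
      note [measurable] = test_function_measurable[OF \<eta>] borel_measurable_elem_tensor[of u]
      have "integrable lborel (\<lambda>x. ?T x * \<eta> x)"
        by (rule integrable_cong_AE_imp[OF L2_integrable_mult[OF elem_tensor_in_L2[OF u] test_function_in_L2[OF \<eta>]]])
          (use rep_elem_tensor[of u] rep_abs_L0[OF test_function_measurable[OF \<eta>]] in auto)
      then have "(\<integral>x. ?T x * \<eta> x \<partial>lborel)
          = (\<integral>y. \<integral>t. ?T (insert_coord j t y) * \<eta> (insert_coord j t y) \<partial>lborel \<partial>other_coords j)"
        by (rule Fubini_insert_coord)
      also have "\<dots> = (\<integral>y. other_factors j u y * (\<integral>t. rep_L0 (u j) t * \<eta> (insert_coord j t y) \<partial>lborel) \<partial>other_coords j)"
        unfolding prod_insert_coord[of "\<lambda>k. rep_L0 (u k)"] other_factors_def[symmetric]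
        by (simp add: mult.commute[of _ "other_factors j u _"] mult.assoc)
      also have "(\<integral>x. ?T x * \<eta> x \<partial>lborel) = (\<integral>x. rep_L0 (elem_tensor u) x * \<eta> x \<partial>lborel)"
        by (rule integral_cong_AE) (use rep_elem_tensor[of u] in auto)
      finally show ?thesis .
    qed
    have slice: "(\<integral>t. rep_L0 (v j) t * ?d (insert_coord j t y) \<partial>lborel)
        = - (\<integral>t. rep_L0 (v' j) t * \<phi> (insert_coord j t y) \<partial>lborel)" for y
      using v'(2)[of j] test_function_slice[OF \<phi>, of j y] unfolding is_weak_deriv_def by auto
    have same: "other_factors j (v(j := v' j)) = other_factors j v"
      by (intro ext) (auto simp: other_factors_def intro!: prod.cong)
    show "(\<integral>x. rep_L0 (elem_tensor v) x * ?d x \<partial>lborel) =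
      - (\<integral>x. rep_L0 (elem_tensor (v(j := v' j))) x * \<phi> x \<partial>lborel)"
      unfolding fub[OF vL dt] fub[OF wL \<phi>] same slice by simp
  qed
  show ?thesis
    unfolding H1_def
  proof (intro CollectI conjI ballI)
    show "elem_tensor v \<in> L2 (prod_domain \<Omega>)" by (rule elem_tensor_in_L2[OF vL])
    fix b :: "real^'d" assume "b \<in> Basis"
    then obtain j where "b = axis j 1" by (auto simp: Basis_vec_def)
    then show "\<exists>w\<in>L2 (prod_domain \<Omega>). is_weak_deriv (prod_domain \<Omega>) b (elem_tensor v) w"
      using wd[of j] elem_tensor_in_L2[of "v(j := v' j)" \<Omega>, OF wL] by blast
  qed
qed

section \<open>Minimal subspaces\<close>

lemma L2_ip_contract_fun_upd:
  fixes u :: "(real^'d::finite) L0"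
  assumes u: "u \<in> L2 (prod_domain \<Omega>)" and g: "\<And>k. k \<noteq> j \<Longrightarrow> g k \<in> L2 (\<Omega> k)" and e: "e \<in> L2 (\<Omega> j)"
  shows "L2_ip (contract j g u) e = L2_ip u (elem_tensor (g(j := e)))"
proof -
  have L: "(g(j := e)) k \<in> L2 (\<Omega> k)" for k using g e by simp
  have c: "contract j (g(j := e)) u = contract j g u" by (rule contract_cong) simp
  show ?thesis using L2_ip_contract[where g = "g(j := e)" and j = j, OF u L] unfolding c by simp
qed

text \<open>Contraction commutes with the derivative in the remaining direction. If the other factors \<open>g k\<close> are
  test functions, then their product with a test function in the variable \<open>j\<close> is a test function on the
  product domain, and the claim is the definition of the weak derivative. For general \<open>g k\<close> the test
  functions are exchanged one at a time: with the other factors fixed, the defect of the identity is a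
  functional \<open>\<langle>z, \<cdot>\<rangle>\<close> with \<open>z\<close> in \<open>L\<^sup>2\<close>, which vanishes on test functions, so \<open>z = 0\<close> by the du
  Bois-Reymond lemma.\<close>

lemma weak_deriv_contract:
  fixes v :: "(real^'d::finite) L0"
  assumes \<Omega>: "\<And>k. open (\<Omega> k)" and v: "v \<in> L2 (prod_domain \<Omega>)" and w: "w \<in> L2 (prod_domain \<Omega>)"
    and vw: "is_weak_deriv (prod_domain \<Omega>) (axis j 1) v w"
    and g: "\<And>k. k \<noteq> j \<Longrightarrow> g k \<in> L2 (\<Omega> k)"
  shows "is_weak_deriv (\<Omega> j) 1 (contract j g v) (contract j g w)"
proof -
  have "L2_ip (contract j g v) (abs_L0 (\<lambda>t. frechet_derivative \<psi> (at t) 1))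
      = - L2_ip (contract j g w) (abs_L0 \<psi>)" if \<psi>: "\<psi> \<in> test_functions (\<Omega> j)" for \<psi>
  proof -
    define \<psi>0 where "\<psi>0 = abs_L0 \<psi>"
    define \<psi>1 where "\<psi>1 = abs_L0 (\<lambda>t. frechet_derivative \<psi> (at t) 1)"
    have \<psi>1_test: "(\<lambda>t. frechet_derivative \<psi> (at t) 1) \<in> test_functions (\<Omega> j)"
      by (rule test_functions_derivative[OF \<psi>]) simp
    have \<psi>L: "\<psi>0 \<in> L2 (\<Omega> j)" "\<psi>1 \<in> L2 (\<Omega> j)"
      unfolding \<psi>0_def \<psi>1_def by (rule test_function_in_L2[OF \<psi>] test_function_in_L2[OF \<psi>1_test])+
    have goal: "L2_ip v (elem_tensor (h(j := \<psi>1))) + L2_ip w (elem_tensor (h(j := \<psi>0))) = 0"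
      if "finite S" "j \<notin> S" "\<And>k. k \<noteq> j \<Longrightarrow> h k \<in> L2 (\<Omega> k)"
        "\<And>k. k \<noteq> j \<Longrightarrow> k \<notin> S \<Longrightarrow> h k \<in> abs_L0 ` test_functions (\<Omega> k)" for S h
      using that
    proof (induction S arbitrary: h rule: finite_induct)
      case empty
      then have "\<exists>\<eta>. \<eta> \<in> test_functions (\<Omega> k) \<and> (k \<noteq> j \<longrightarrow> h k = abs_L0 \<eta>) \<and> (k = j \<longrightarrow> \<eta> = \<psi>)" for k
        using \<psi> by (cases "k = j") auto
      then obtain \<eta> where \<eta>: "\<And>k. \<eta> k \<in> test_functions (\<Omega> k)" "\<And>k. k \<noteq> j \<Longrightarrow> h k = abs_L0 (\<eta> k)" "\<eta> j = \<psi>"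
        by metis
      define \<Phi> where "\<Phi> = (\<lambda>x. \<Prod>k\<in>UNIV. \<eta> k ((x :: real^'d) $ k))"
      have \<Phi>: "\<Phi> \<in> test_functions (prod_domain \<Omega>)"
        unfolding \<Phi>_def by (rule test_functions_tensor[OF \<eta>(1)])
      have 0: "elem_tensor (h(j := \<psi>0)) = abs_L0 \<Phi>"
      proof -
        have "h(j := \<psi>0) = (\<lambda>k. abs_L0 (\<eta> k))" using \<eta> by (auto simp: \<psi>0_def)
        then show ?thesis
          unfolding \<Phi>_def using elem_tensor_test_functions[of \<eta>] test_function_measurable[OF \<eta>(1)] by simp
      qed
      have 1: "elem_tensor (h(j := \<psi>1)) = abs_L0 (\<lambda>x. frechet_derivative \<Phi> (at x) (axis j 1))"
      proof -
        let ?\<eta>' = "\<eta>(j := \<lambda>t. frechet_derivative (\<eta> j) (at t) 1)"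
        have "h(j := \<psi>1) = (\<lambda>k. abs_L0 (?\<eta>' k))" using \<eta> by (auto simp: \<psi>1_def)
        moreover have "?\<eta>' k \<in> borel_measurable borel" for k
          using test_function_measurable[OF \<eta>(1)] test_function_measurable[OF \<psi>1_test] \<eta>(3) by simp
        ultimately show ?thesis
          unfolding \<Phi>_def frechet_derivative_tensor[of \<eta> \<Omega>, OF \<eta>(1)] using elem_tensor_test_functions[of ?\<eta>'] by simp
      qed
      show ?case
        using vw \<Phi> unfolding 0 1 is_weak_deriv_iff[of "axis j 1 :: real^'d", simplified] by simp
    next
      case (insert k S)
      have kj: "k \<noteq> j" using insert.prems(1) by auto
      let ?h1 = "h(j := \<psi>1)" and ?h0 = "h(j := \<psi>0)"
      have L1: "?h1 i \<in> L2 (\<Omega> i)" and L0: "?h0 i \<in> L2 (\<Omega> i)" for i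
        using insert.prems(2) \<psi>L by auto
      let ?z = "contract k ?h1 v + contract k ?h0 w"
      have z1: "contract k ?h1 v \<in> L2 (\<Omega> k)" by (rule contract_in_L2[OF v L1])
      have z0: "contract k ?h0 w \<in> L2 (\<Omega> k)" by (rule contract_in_L2[OF w L0])
      have ipz: "L2_ip ?z e = L2_ip v (elem_tensor ((h(k := e))(j := \<psi>1))) + L2_ip w (elem_tensor ((h(k := e))(j := \<psi>0)))"
        if e: "e \<in> L2 (\<Omega> k)" for e
      proof -
        have "L2_ip ?z e = L2_ip (contract k ?h1 v) e + L2_ip (contract k ?h0 w) e"
          by (rule L2.ip_add_left[OF z1 z0 e])
        also have "\<dots> = L2_ip v (elem_tensor (?h1(k := e))) + L2_ip w (elem_tensor (?h0(k := e)))"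
          unfolding L2_ip_contract_fun_upd[where g = ?h1 and j = k, OF v L1 e]
            L2_ip_contract_fun_upd[where g = ?h0 and j = k, OF w L0 e] ..
        finally show ?thesis by (simp only: fun_upd_twist[OF kj])
      qed
      have "?z = 0"
      proof (rule du_Bois_Reymond[OF \<Omega>[of k]])
        show "?z \<in> L2 (\<Omega> k)" using z1 z0 by simp
        fix a b :: real and n assume "cbox a b \<subseteq> \<Omega> k"
        then have t: "box_bump n a b \<in> test_functions (\<Omega> k)" by (rule test_functions_box_bump)
        show "L2_ip ?z (abs_L0 (box_bump n a b)) = 0"
          unfolding ipz[OF test_function_in_L2[OF t]]
          by (rule insert.IH) (use insert.prems t test_function_in_L2[OF t] in auto)
      qed
      then have zero: "L2_ip ?z (h k) = 0" using insert.prems(2)[OF kj] by simp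
      show ?case
        by (rule trans[OF ipz[OF insert.prems(2)[OF kj], symmetric, unfolded fun_upd_triv] zero])
    qed
    have "L2_ip v (elem_tensor (g(j := \<psi>1))) + L2_ip w (elem_tensor (g(j := \<psi>0))) = 0"
      by (rule goal[of "- {j}"]) (use g in auto)
    moreover have "L2_ip (contract j g v) \<psi>1 = L2_ip v (elem_tensor (g(j := \<psi>1)))"
      by (rule L2_ip_contract_fun_upd[OF v _ \<psi>L(2)]) (rule g)
    moreover have "L2_ip (contract j g w) \<psi>0 = L2_ip w (elem_tensor (g(j := \<psi>0)))"
      by (rule L2_ip_contract_fun_upd[OF w _ \<psi>L(1)]) (rule g)
    ultimately show ?thesis
      unfolding \<psi>0_def[symmetric] \<psi>1_def[symmetric] by simp
  qed
  then show ?thesis by (simp add: is_weak_deriv_iff)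
qed

lemma contract_in_H1:
  fixes v :: "(real^'d::finite) L0"
  assumes \<Omega>: "\<And>k. open (\<Omega> k)" and v: "v \<in> H1 (prod_domain \<Omega>)"
    and g: "\<And>k. k \<noteq> j \<Longrightarrow> g k \<in> L2 (\<Omega> k)"
  shows "contract j g v \<in> H1 (\<Omega> j)"
proof -
  have j: "axis j 1 \<in> (Basis :: (real^'d) set)" by (auto simp: Basis_vec_def)
  obtain w where w: "w \<in> L2 (prod_domain \<Omega>)" "is_weak_deriv (prod_domain \<Omega>) (axis j 1) v w"
    using v j unfolding H1_def by blast
  have "is_weak_deriv (\<Omega> j) 1 (contract j g v) (contract j g w)"
    using H1_imp_L2[OF v] w g by (intro weak_deriv_contract[OF \<Omega>]) auto
  then show ?thesis
    unfolding H1_def using contract_in_L2[OF H1_imp_L2[OF v] g] contract_in_L2[OF w(1) g] by auto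
qed

lemma min_subspace_subset_L2:
  "u \<in> L2 (prod_domain \<Omega>) \<Longrightarrow> min_subspace \<Omega> j u \<subseteq> L2 (\<Omega> j)"
  unfolding min_subspace_def by (rule span_minimal[OF _ subspace_L2]) (auto intro: contract_in_L2)

lemma min_subspace_subset_H1:
  assumes "\<And>k. open (\<Omega> k)" "u \<in> H1 (prod_domain \<Omega>)"
  shows "min_subspace \<Omega> j u \<subseteq> H1 (\<Omega> j)"
  unfolding min_subspace_def
  by (rule span_minimal[OF _ subspace_H1]) (use assms in \<open>auto intro: contract_in_H1\<close>)

lemma contract_in_min_subspace:
  "(\<And>k. k \<noteq> j \<Longrightarrow> g k \<in> L2 (\<Omega> k)) \<Longrightarrow> contract j g u \<in> min_subspace \<Omega> j u"
  unfolding min_subspace_def by (intro span_base) auto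

text \<open>Each factor \<open>h k\<close> may be replaced by its orthogonal projection onto the span of \<open>E k\<close>, because
  \<open>\<langle>v, \<Otimes>h\<rangle> = \<langle>contract k h v, h k\<rangle>\<close> and the contraction lies in that span. The factors are replaced one
  after the other.\<close>

lemma L2_ip_elem_tensor_projections:
  fixes v :: "(real^'d::finite) L0"
  assumes v: "v \<in> L2 (prod_domain \<Omega>)"
    and E: "\<And>k. finite (E k)" "\<And>k. E k \<subseteq> L2 (\<Omega> k)"
    and on: "\<And>k e e'. e \<in> E k \<Longrightarrow> e' \<in> E k \<Longrightarrow> L2_ip e e' = (if e = e' then 1 else 0)"
    and span: "\<And>k. min_subspace \<Omega> k v \<subseteq> span (E k)"
    and h: "\<And>k. h k \<in> L2 (\<Omega> k)"
  shows "L2_ip v (elem_tensor (\<lambda>k. \<Sum>e\<in>E k. L2_ip (h k) e *\<^sub>R e)) = L2_ip v (elem_tensor h)"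
proof -
  define p where "p k = (\<Sum>e\<in>E k. L2_ip (h k) e *\<^sub>R e)" for k
  have p: "p k \<in> L2 (\<Omega> k)" for k
    unfolding p_def by (rule subspace_sum[OF subspace_L2]) (use E(2) in \<open>auto intro!: subspace_mul[OF subspace_L2]\<close>)
  have "L2_ip v (elem_tensor (\<lambda>k. if k \<in> S then p k else h k)) = L2_ip v (elem_tensor h)" if "finite S" for S
    using that
  proof (induction S rule: finite_induct)
    case (insert i S)
    define g where "g k = (if k \<in> S then p k else h k)" for k
    have g: "g k \<in> L2 (\<Omega> k)" for k using p h by (simp add: g_def)
    have eq: "(\<lambda>k. if k \<in> insert i S then p k else h k) = g(i := p i)" by (auto simp: g_def)
    have "L2_ip v (elem_tensor (g(i := p i))) = L2_ip (contract i g v) (p i)"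
      by (rule L2_ip_contract_fun_upd[OF v g p, symmetric])
    also have "\<dots> = L2_ip (contract i g v) (h i)"
      unfolding p_def
    proof (rule L2.orthonormal_expansion[OF E on h])
      show "contract i g v \<in> span (E i)" using span contract_in_min_subspace[of i g \<Omega> v] g by blast
    qed
    also have "\<dots> = L2_ip (contract i g v) (g i)" using insert.hyps by (simp add: g_def)
    also have "\<dots> = L2_ip v (elem_tensor g)" by (rule L2_ip_contract[OF v g])
    also have "\<dots> = L2_ip v (elem_tensor h)" using insert.IH by (simp add: g_def[abs_def])
    finally show ?case unfolding eq .
  qed simp
  from this[of UNIV] show ?thesis by (simp add: p_def[abs_def])
qed

text \<open>With orthonormal bases \<open>E k\<close> of the minimal subspaces, \<open>v\<close> equals the sum of \<open>\<langle>v, \<Otimes>\<beta>\<rangle> \<Otimes>\<beta>\<close> over all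
  choices \<open>\<beta>\<close> of basis vectors: both sides have the same inner product with every elementary tensor.\<close>

lemma in_alg_tensor_min_subspaces:
  fixes v :: "(real^'d::finite) L0"
  assumes \<Omega>: "\<And>k. open (\<Omega> k)" and v: "v \<in> L2 (prod_domain \<Omega>)"
    and fin: "\<And>k. \<exists>B. finite B \<and> min_subspace \<Omega> k v \<subseteq> span B"
  shows "v \<in> alg_tensor (\<lambda>k. min_subspace \<Omega> k v)"
proof -
  have "\<exists>E. finite E \<and> span E = min_subspace \<Omega> k v \<and>
      (\<forall>e\<in>E. \<forall>e'\<in>E. L2_ip e e' = (if e = e' then 1 else 0))" for k
  proof -
    obtain B0 where B0: "finite B0" "min_subspace \<Omega> k v \<subseteq> span B0" using fin by blast
    obtain B where B: "B \<subseteq> min_subspace \<Omega> k v" "independent B" "min_subspace \<Omega> k v \<subseteq> span B"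
      using maximal_independent_subset by blast
    have "finite B" using independent_span_bound[OF B0(1) B(2)] B(1) B0(2) by blast
    moreover have "B \<subseteq> L2 (\<Omega> k)" using B(1) min_subspace_subset_L2[OF v] by blast
    ultimately obtain E where "finite E" "span E = span B"
      "\<And>e e'. e \<in> E \<Longrightarrow> e' \<in> E \<Longrightarrow> L2_ip e e' = (if e = e' then 1 else 0)"
      using L2.finite_orthonormal_basis by blast
    moreover have "span B = min_subspace \<Omega> k v"
      using B by (intro subset_antisym span_minimal) (auto simp: min_subspace_def)
    ultimately show ?thesis by blast
  qed
  then obtain E where E: "\<And>k. finite (E k)" "\<And>k. span (E k) = min_subspace \<Omega> k v"
    and on: "\<And>k e e'. e \<in> E k \<Longrightarrow> e' \<in> E k \<Longrightarrow> L2_ip e e' = (if e = e' then 1 else 0)"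
    by metis
  have EU: "E k \<subseteq> min_subspace \<Omega> k v" for k using E(2)[of k] span_superset[of "E k"] by simp
  have EL: "E k \<subseteq> L2 (\<Omega> k)" for k using EU min_subspace_subset_L2[OF v] by blast
  have US: "min_subspace \<Omega> k v \<subseteq> span (E k)" for k using E(2)[of k] by simp
  define w where "w = (\<Sum>\<beta>\<in>PiE UNIV E. L2_ip v (elem_tensor \<beta>) *\<^sub>R elem_tensor \<beta>)"
  have \<beta>L: "\<beta> k \<in> L2 (\<Omega> k)" if "\<beta> \<in> PiE UNIV E" for \<beta> k
    using that EL by (auto simp: PiE_iff)
  have finE: "finite (PiE UNIV E)" using E(1) by (intro finite_PiE) auto
  have wL: "w \<in> L2 (prod_domain \<Omega>)"
    unfolding w_def by (rule subspace_sum[OF subspace_L2]) (auto intro!: subspace_mul[OF subspace_L2] elem_tensor_in_L2 \<beta>L)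
  have "v - w = 0"
  proof (rule elem_tensors_separate_L2[OF \<Omega>])
    show "v - w \<in> L2 (prod_domain \<Omega>)" using v wL by simp
    fix h assume h: "\<And>k. h k \<in> L2 (\<Omega> k)"
    have hT: "elem_tensor h \<in> L2 (prod_domain \<Omega>)" by (rule elem_tensor_in_L2[OF h])
    have \<beta>T: "elem_tensor \<beta> \<in> L2 (prod_domain \<Omega>)" if "\<beta> \<in> PiE UNIV E" for \<beta>
      by (rule elem_tensor_in_L2[OF \<beta>L[OF that]])
    have "L2_ip v (elem_tensor h) = L2_ip v (elem_tensor (\<lambda>k. \<Sum>e\<in>E k. L2_ip (h k) e *\<^sub>R e))"
      by (rule L2_ip_elem_tensor_projections[symmetric, OF v E(1) EL on US h])
    also have "\<dots> = L2_ip (elem_tensor (\<lambda>k. \<Sum>e\<in>E k. L2_ip (h k) e *\<^sub>R e)) v"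
      by (rule L2_ip_commute)
    also have "\<dots> = (\<Sum>\<beta>\<in>PiE UNIV E. (\<Prod>k\<in>UNIV. L2_ip (h k) (\<beta> k)) * L2_ip (elem_tensor \<beta>) v)"
      unfolding elem_tensor_sum[OF E(1)]
      using \<beta>T v by (subst L2.ip_sum_left[of _ _ "prod_domain \<Omega>"]) (auto simp: L2_ip_scaleR_left)
    also have "\<dots> = (\<Sum>\<beta>\<in>PiE UNIV E. L2_ip v (elem_tensor \<beta>) * L2_ip (elem_tensor \<beta>) (elem_tensor h))"
      by (intro sum.cong refl, subst L2_ip_elem_tensor[OF \<beta>L h]) (auto simp: L2_ip_commute mult.commute)
    also have "\<dots> = L2_ip w (elem_tensor h)"
      unfolding w_def
      using \<beta>T hT by (subst L2.ip_sum_left[of _ _ "prod_domain \<Omega>"]) (auto simp: L2_ip_scaleR_left)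
    finally show "L2_ip (v - w) (elem_tensor h) = 0"
      using v wL hT by (simp add: L2.ip_diff_left[of _ "prod_domain \<Omega>"])
  qed
  then have "v = w" by simp
  also have "w \<in> alg_tensor (\<lambda>k. min_subspace \<Omega> k v)"
    unfolding w_def alg_tensor_def
  proof (intro span_sum span_scale span_base)
    fix \<beta> assume "\<beta> \<in> PiE UNIV E"
    then show "elem_tensor \<beta> \<in> {elem_tensor v' |v'. \<forall>j. v' j \<in> min_subspace \<Omega> j v}"
      using EU by (auto simp: PiE_iff)
  qed
  finally show ?thesis .
qed

text \<open>Membership in the algebraic tensor product is automatic: a function in \<open>H\<^sup>1\<close> with finite-dimensional
  minimal subspaces is a tensor over these, and they consist of \<open>H\<^sup>1\<close> functions. Only the rank bounds
  remain as conditions.\<close>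

lemma tucker_eq:
  fixes \<Omega> :: "'d::finite \<Rightarrow> real set"
  assumes \<Omega>: "\<And>k. open (\<Omega> k)"
  shows "tucker \<Omega> r = {v \<in> H1 (prod_domain \<Omega>). \<forall>j. dim_at_most (min_subspace \<Omega> j v) (r j)}"
proof -
  have "alg_tensor (\<lambda>k. H1 (\<Omega> k)) \<subseteq> H1 (prod_domain \<Omega>)"
    unfolding alg_tensor_def
    by (rule span_minimal[OF _ subspace_H1[OF open_prod_domain[OF \<Omega>]]]) (auto intro: elem_tensor_in_H1[OF \<Omega>])
  moreover have "v \<in> alg_tensor (\<lambda>k. H1 (\<Omega> k))"
    if v: "v \<in> H1 (prod_domain \<Omega>)" and dim: "\<forall>j. dim_at_most (min_subspace \<Omega> j v) (r j)" for v
  proof -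
    have "v \<in> alg_tensor (\<lambda>k. min_subspace \<Omega> k v)"
      using dim by (intro in_alg_tensor_min_subspaces[OF \<Omega> H1_imp_L2[OF v]]) (auto simp: dim_at_most_def)
    also have "\<dots> \<subseteq> alg_tensor (\<lambda>k. H1 (\<Omega> k))"
      unfolding alg_tensor_def using min_subspace_subset_H1[OF \<Omega> v] by (intro span_mono) blast
    finally show ?thesis .
  qed
  ultimately show ?thesis unfolding tucker_def by blast
qed

section \<open>Weak closedness of the bounded-rank tensors\<close>

lemma dim_at_most_card_le:
  assumes "dim_at_most U n" "C \<subseteq> U" "independent C"
  shows "card C \<le> n"
proof -
  obtain B where B: "finite B" "U \<subseteq> span B" and n: "dim U \<le> n"
    using assms(1) by (auto simp: dim_at_most_def)
  obtain D where D: "D \<subseteq> U" "independent D" "U \<subseteq> span D" "card D = dim U"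
    using basis_exists by blast
  have "finite D" using independent_span_bound[OF B(1) D(2)] D(1) B(2) by blast
  then have "card C \<le> card D"
    using independent_span_bound[OF _ assms(3)] assms(2) D(3) by blast
  then show ?thesis using D(4) n by simp
qed

lemma not_dim_at_most_span:
  assumes "\<not> dim_at_most (span S) n"
  obtains B where "B \<subseteq> S" "independent B" "finite B" "card B = Suc n"
proof -
  obtain D where D: "D \<subseteq> S" "independent D" "S \<subseteq> span D"
    using maximal_independent_subset by blast
  have span: "span S = span D"
    using D by (intro subset_antisym span_minimal span_mono) auto
  have "infinite D \<or> Suc n \<le> card D"
  proof (rule ccontr)
    assume "\<not> ?thesis"
    then have "finite D" "card D \<le> n" by auto
    then have "dim_at_most (span S) n"
      unfolding dim_at_most_def span using dim_eq_card_independent[OF D(2)] by auto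
    then show False using assms by simp
  qed
  then obtain B where B: "B \<subseteq> D" "finite B" "card B = Suc n"
    by (metis infinite_arbitrarily_large obtain_subset_with_card_n)
  then show thesis using that[of B] D independent_mono by blast
qed

text \<open>If the dimension exceeds \<open>n\<close>, then there are \<open>n + 1\<close> independent contractions of \<open>m\<close>. Their
  inner products with a dual system are values of weakly continuous functionals at \<open>m\<close>, by the adjointness
  of contraction. On a weak neighbourhood of \<open>m\<close> these values stay close to the identity matrix, so the
  same contractions remain independent.\<close>

lemma weakly_open_dim_greater:
  fixes \<Omega> :: "'d::finite \<Rightarrow> real set"
  assumes \<Omega>: "\<And>k. open (\<Omega> k)"
  shows "openin (weak_topology (H1 (prod_domain \<Omega>)) (H1_norm (prod_domain \<Omega>)))
    {v \<in> H1 (prod_domain \<Omega>). \<not> dim_at_most (min_subspace \<Omega> j v) n}"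
proof (subst openin_subopen, safe)
  let ?X = "H1 (prod_domain \<Omega>)" and ?N = "H1_norm (prod_domain \<Omega>)"
  fix m assume m: "m \<in> ?X" and "\<not> dim_at_most (min_subspace \<Omega> j m) n"
  then have "\<not> dim_at_most (span {contract j g m | g. \<forall>k. k \<noteq> j \<longrightarrow> g k \<in> L2 (\<Omega> k)}) n"
    unfolding min_subspace_def by simp
  then obtain B where B: "B \<subseteq> {contract j g m | g. \<forall>k. k \<noteq> j \<longrightarrow> g k \<in> L2 (\<Omega> k)}"
    "independent B" "finite B" "card B = Suc n"
    by (rule not_dim_at_most_span)
  note mL = H1_imp_L2[OF m]
  have "\<exists>g. b = contract j g m \<and> (\<forall>k. k \<noteq> j \<longrightarrow> g k \<in> L2 (\<Omega> k))" if "b \<in> B" for b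
    using B(1) that by blast
  then obtain g where g: "\<And>b. b \<in> B \<Longrightarrow> b = contract j (g b) m"
    "\<And>b k. b \<in> B \<Longrightarrow> k \<noteq> j \<Longrightarrow> g b k \<in> L2 (\<Omega> k)" by metis
  have BL: "B \<subseteq> L2 (\<Omega> j)"
  proof
    fix b assume "b \<in> B"
    then have "contract j (g b) m \<in> L2 (\<Omega> j)" using g(2) by (intro contract_in_L2[OF mL])
    then show "b \<in> L2 (\<Omega> j)" by (simp only: g(1)[OF \<open>b \<in> B\<close>, symmetric])
  qed
  obtain h where h: "\<And>b. b \<in> B \<Longrightarrow> h b \<in> L2 (\<Omega> j)"
    and dual: "\<And>b c. b \<in> B \<Longrightarrow> c \<in> B \<Longrightarrow> L2_ip b (h c) = (if b = c then 1 else 0)"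
    using L2.biorthogonal_system[OF B(3) BL B(2)] by blast
  define G where "G b c = elem_tensor ((g b)(j := h c))" for b c
  have GL: "G b c \<in> L2 (prod_domain \<Omega>)" if "b \<in> B" "c \<in> B" for b c
    unfolding G_def by (rule elem_tensor_in_L2) (use g h that in auto)
  have ip: "L2_ip u (G b c) = L2_ip (contract j (g b) u) (h c)"
    if "b \<in> B" "c \<in> B" "u \<in> L2 (prod_domain \<Omega>)" for b c u
    unfolding G_def by (rule L2_ip_contract_fun_upd[symmetric, OF that(3) g(2)[OF that(1)] h[OF that(2)]])
  define e where "e = 1 / (real (card B) + 1)"
  define W where "W b c = {u \<in> ?X. L2_ip u (G b c) \<in> ball (if b = c then 1 else 0) e}" for b c
  define V where "V = (\<Inter>p\<in>B \<times> B. W (fst p) (snd p))"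
  have Wopen: "openin (weak_topology ?X ?N) (W b c)" if "b \<in> B" "c \<in> B" for b c
    unfolding weak_topology_def W_def
  proof (rule topology_generated_by_Basis, rule CollectI, intro exI conjI)
    show "(\<lambda>u. L2_ip u (G b c)) \<in> continuous_dual ?X ?N"
      by (rule L2_functional_in_H1_dual[OF open_prod_domain[OF \<Omega>] GL[OF that]])
  qed (rule refl open_ball)+
  have ne: "B \<noteq> {}" using B(4) by auto
  have "openin (weak_topology ?X ?N) V"
    unfolding V_def using B(3) ne Wopen by (intro openin_INT2) auto
  moreover have "m \<in> V"
  proof -
    have "L2_ip m (G b c) = (if b = c then 1 else 0)" if "b \<in> B" "c \<in> B" for b c
      using dual[OF that] by (simp only: ip[OF that mL] g(1)[OF that(1), symmetric])
    moreover have "e > 0" by (simp add: e_def)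
    ultimately show ?thesis unfolding V_def W_def using m by auto
  qed
  moreover have "V \<subseteq> {v \<in> ?X. \<not> dim_at_most (min_subspace \<Omega> j v) n}"
  proof
    fix u assume u: "u \<in> V"
    then have uX: "u \<in> ?X" and W: "\<And>b c. b \<in> B \<Longrightarrow> c \<in> B \<Longrightarrow> u \<in> W b c"
      using ne by (auto simp: V_def W_def)
    note uL = H1_imp_L2[OF uX]
    have close: "\<bar>L2_ip (contract j (g b) u) (h c) - (if b = c then 1 else 0)\<bar> < 1 / (real (card B) + 1)"
      if "b \<in> B" "c \<in> B" for b c
      using W[OF that] ip[OF that uL] unfolding W_def e_def by (simp add: dist_real_def abs_minus_commute)
    have wL: "contract j (g b) u \<in> L2 (\<Omega> j)" if "b \<in> B" for b
      by (rule contract_in_L2[OF uL g(2)[OF that]])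
    note ind = L2.independent_if_almost_biorthogonal[OF B(3) wL h close]
    have "(\<lambda>b. contract j (g b) u) ` B \<subseteq> min_subspace \<Omega> j u"
      using contract_in_min_subspace g(2) by blast
    moreover have "card ((\<lambda>b. contract j (g b) u) ` B) = Suc n"
      using card_image[OF ind(1)] B(4) by simp
    ultimately have "\<not> dim_at_most (min_subspace \<Omega> j u) n"
      using dim_at_most_card_le ind(2) by (metis Suc_n_not_le_n)
    with uX show "u \<in> {v \<in> ?X. \<not> dim_at_most (min_subspace \<Omega> j v) n}" by blast
  qed
  ultimately show "\<exists>T. openin (weak_topology ?X ?N) T \<and> m \<in> T \<and>
      T \<subseteq> {v \<in> ?X. \<not> dim_at_most (min_subspace \<Omega> j v) n}" by blast
qed

lemma zero_in_tucker:
  fixes \<Omega> :: "'d::finite \<Rightarrow> real set"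
  shows "0 \<in> tucker \<Omega> r"
proof -
  have "contract j g 0 = 0" if g: "\<forall>k. k \<noteq> j \<longrightarrow> g k \<in> L2 (\<Omega> k)" for j and g :: "'d \<Rightarrow> real L0"
  proof (rule L2_ip_definite)
    let ?c = "contract j g 0"
    have 0: "(0 :: (real^'d) L0) \<in> L2 (prod_domain \<Omega>)" by simp
    show c: "?c \<in> L2 (\<Omega> j)" using g by (intro contract_in_L2[OF 0]) auto
    have gc: "(g(j := ?c)) k \<in> L2 (\<Omega> k)" for k using g c by simp
    have "L2_ip ?c ?c = L2_ip 0 (elem_tensor (g(j := ?c)))"
      using g c by (intro L2_ip_contract_fun_upd[OF 0]) auto
    also have "\<dots> = 0" by (rule L2.ip_zero_left[OF elem_tensor_in_L2[OF gc]])
    finally show "L2_ip ?c ?c = 0" .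
  qed
  then have "{contract j g (0 :: (real^'d) L0) | g. \<forall>k. k \<noteq> j \<longrightarrow> g k \<in> L2 (\<Omega> k)} \<subseteq> {0}" for j
    by blast
  then have "min_subspace \<Omega> j 0 \<subseteq> {0}" for j
    unfolding min_subspace_def by (intro span_minimal subspace_single_0)
  then have "min_subspace \<Omega> j 0 = {0}" for j
    using span_0 unfolding min_subspace_def by blast
  moreover have "dim_at_most {0 :: real L0} n" for n
  proof -
    have "dim {0 :: real L0} = 0"
      using dim_span[of "{} :: real L0 set"] dim_eq_card_independent[OF independent_empty] by simp
    moreover have "finite ({} :: real L0 set) \<and> {0} \<subseteq> span {}" by simp
    ultimately show ?thesis unfolding dim_at_most_def by (metis le0)
  qed
  ultimately have "dim_at_most (min_subspace \<Omega> j 0) (r j)" for j by simp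
  then show ?thesis by (simp add: tucker_def alg_tensor_def span_0)
qed

theorem theorem3p3:
  fixes \<Omega> :: "'d::finite \<Rightarrow> real set" and r :: "'d \<Rightarrow> nat"
  assumes "\<And>j. open (\<Omega> j)" and "\<And>j. is_interval (\<Omega> j)" and "\<And>j. \<Omega> j \<noteq> {}"
  shows "weakly_closed_in (H1 (prod_domain \<Omega>)) (H1_norm (prod_domain \<Omega>)) (tucker \<Omega> r) \<and>
         proximinal_in (H1 (prod_domain \<Omega>)) (H1_norm (prod_domain \<Omega>)) (tucker \<Omega> r)"
proof -
  let ?X = "H1 (prod_domain \<Omega>)" and ?N = "H1_norm (prod_domain \<Omega>)"
  note eq = tucker_eq[of \<Omega>, OF assms(1)]
  have "?X - tucker \<Omega> r = (\<Union>j. {v \<in> ?X. \<not> dim_at_most (min_subspace \<Omega> j v) (r j)})"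
    unfolding eq by blast
  moreover have "openin (weak_topology ?X ?N) (\<Union>j. {v \<in> ?X. \<not> dim_at_most (min_subspace \<Omega> j v) (r j)})"
    by (intro openin_Union) (auto intro!: weakly_open_dim_greater[of \<Omega>, OF assms(1)])
  moreover have "tucker \<Omega> r \<subseteq> ?X" unfolding eq by blast
  ultimately have closed: "weakly_closed_in ?X ?N (tucker \<Omega> r)"
    unfolding weakly_closed_in_def closedin_def topspace_weak_topology by simp
  interpret H1: hilbert_subspace ?X "H1_ip (prod_domain \<Omega>)"
    by (rule hilbert_subspace_H1[OF open_prod_domain[OF assms(1)]])
  have N: "?N = (\<lambda>u. sqrt (H1_ip (prod_domain \<Omega>) u u))"
    by (rule ext) (rule H1_norm_eq)
  have "proximinal_in ?X ?N (tucker \<Omega> r)"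
    using closed zero_in_tucker[of \<Omega> r] unfolding N
    by (intro H1.weakly_closed_imp_proximinal) auto
  with closed show ?thesis by blast
qed

end
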